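(* Let $k\ge 2$ and $s>2k$ be integers and put $\delta=8^{-2k}$. Then for almost all $\boldsymbol{\lambda}\in\Lambda^{(s)}_k$ (with respect to Lebesgue measure on $\mathbb{R}^s$) there exist a number $P_0=P_0(\boldsymbol{\lambda},k)$ and a positive real number $J_{k,s}(\boldsymbol{\lambda})$ such that $$\bigl|N^{(k)}_{\boldsymbol{\lambda}}(P;\tau)-2\tau J_{k,s}(\boldsymbol{\lambda})P^{s-k}\bigr|<P^{s-k-\delta}$$ holds for all $P\ge P_0$, uniformly in $0<\tau\le 1$.
   Context: Let $\Lambda^{(s)}=(\mathbb{R}\setminus\{0\})^s$. If $k$ is odd, $\Lambda^{(s)}_k=\Lambda^{(s)}$; if $k$ is even, $\Lambda^{(s)}_k=\{\boldsymbol{\lambda}\in\Lambda^{(s)}:\lambda_i\lambda_j<0\text{ for some }1\le i,j\le s\}$. For $\boldsymbol{\lambda}\in\Lambda^{(s)}$, $P\ge1$ and $\tau>0$, $N^{(k)}_{\boldsymbol{\lambda}}(P;\tau)$ denotes the number of integer vectors $\mathbf{x}=(x_1,\dots,x_s)\in\mathbb{Z}^s$ with $|\mathbf{x}|=\max_j|x_j|\le P$ satisfying $|\lambda_1x_1^k+\lambda_2x_2^k+\dots+\lambda_sx_s^k|<\tau$. *)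

theory Defs
  imports "HOL-Analysis.Analysis"
begin

text \<open>Vectors of length \<open>s\<close> are rendered as \<open>real ^ 's\<close> and \<open>int ^ 's\<close> with \<open>s = CARD('s)\<close>.\<close>

definition Lambda :: "(real ^ 's) set" where
  "Lambda = {l. \<forall>i. l $ i \<noteq> 0}"

definition Lambda_k :: "nat \<Rightarrow> (real ^ 's) set" where
  "Lambda_k k = (if odd k then Lambda else {l \<in> Lambda. \<exists>i j. l $ i * l $ j < 0})"

definition max_norm :: "int ^ 's \<Rightarrow> int" where
  "max_norm x = (MAX j. \<bar>x $ j\<bar>)"

definition solutions :: "nat \<Rightarrow> real ^ 's \<Rightarrow> real \<Rightarrow> real \<Rightarrow> (int ^ 's) set" where
  "solutions k l P \<tau> =
     {x. real_of_int (max_norm x) \<le> P \<and>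
         \<bar>\<Sum>i\<in>UNIV. l $ i * real_of_int (x $ i) ^ k\<bar> < \<tau>}"

definition N :: "nat \<Rightarrow> real ^ 's \<Rightarrow> real \<Rightarrow> real \<Rightarrow> nat" where
  "N k l P \<tau> = card (solutions k l P \<tau>)"

lemma max_norm_le_iff: "max_norm x \<le> n \<longleftrightarrow> (\<forall>j. \<bar>x $ j\<bar> \<le> n)"
  by (simp add: max_norm_def)

text \<open>The cardinality in \<open>N\<close> is that of a finite set.\<close>

lemma finite_solutions: "finite (solutions k l P \<tau>)"
proof (rule finite_subset)
  show "solutions k l P \<tau> \<subseteq> vec_lambda ` {f. \<forall>j. f j \<in> {- \<lfloor>P\<rfloor>..\<lfloor>P\<rfloor>}}"
  proof
    fix x assume "x \<in> solutions k l P \<tau>"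
    then have "max_norm x \<le> \<lfloor>P\<rfloor>"
      by (simp add: solutions_def le_floor_iff)
    then have "\<forall>j. x $ j \<in> {- \<lfloor>P\<rfloor>..\<lfloor>P\<rfloor>}"
      by (auto simp: max_norm_le_iff abs_le_iff minus_le_iff)
    then show "x \<in> vec_lambda ` {f. \<forall>j. f j \<in> {- \<lfloor>P\<rfloor>..\<lfloor>P\<rfloor>}}"
      by (intro image_eqI[of _ _ "vec_nth x"]) auto
  qed
  have "finite (PiE (UNIV :: 'a set) (\<lambda>_. {- \<lfloor>P\<rfloor>..\<lfloor>P\<rfloor>}))"
    by (intro finite_PiE) auto
  then show "finite (vec_lambda ` {f :: 'a \<Rightarrow> int. \<forall>j. f j \<in> {- \<lfloor>P\<rfloor>..\<lfloor>P\<rfloor>}})"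
    by (simp add: PiE_UNIV_domain Pi_def)
qed

end

theory Submission
  imports Defs
begin

text \<open>
  Let \<open>\<lambda>\<close> range over a cube \<open>[-L, L]\<^sup>s\<close>. The second moment over \<open>\<lambda>\<close> of a count of lattice points is a
  double sum over points \<open>p, q\<close> of the volume of the intersection of the slabs \<open>\<bar>\<lambda> \<bullet> p\<^sup>k\<bar> < \<tau>\<close> and
  \<open>\<bar>\<lambda> \<bullet> q\<^sup>k\<bar> < \<sigma>\<close> with the cube, where powers are taken coordinatewise. If some \<open>2 \<times> 2\<close> minor of
  \<open>(p\<^sup>k, q\<^sup>k)\<close> is large, a linear map moving only two coordinates of \<open>\<lambda>\<close> shows that this volume,
  divided by \<open>\<tau>\<sigma>\<close>, hardly changes when \<open>p, q\<close> move by at most 1 and \<open>\<tau>, \<sigma>\<close> vary in \<open>(0, 1]\<close>. Pairs with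
  all minors small are so rare when \<open>s > 2k\<close> that trivial bounds suffice for them, and vectors with a
  small coordinate are negligible already in the mean. Hence, in mean over \<open>\<lambda>\<close>, the count with
  tolerance \<open>\<tau>\<close> over a shifted lattice is \<open>\<tau>\<close> times the count with tolerance 1 over \<open>\<int>\<^sup>s\<close>, up to a power
  saving.

  Splitting \<open>\<int>\<^sup>s\<close> into the classes modulo \<open>m\<close> turns this into a relation between the counts at heights
  \<open>P\<close> and \<open>mP\<close>, and passing through the height \<open>PP'\<close> compares any two heights \<open>P\<close> and \<open>P'\<close>. Along
  \<open>P = n\<^bsup>100k\<^esup>\<close> the errors are summable, so for almost all \<open>\<lambda>\<close> the normalized counts converge with rate
  \<open>1 / n\<close>; monotonicity in \<open>P\<close> and \<open>\<tau>\<close> fills the gaps. The limit is positive because, for \<open>m = P\<^sup>k\<close>, the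
  count at height \<open>mP\<close> with tolerance \<open>m\<^sup>k\<close> is bounded from below by solving for one variable.
\<close>

section \<open>Slabs and linear changes of the coefficient vector\<close>

text \<open>Counts are compared with one another in mean and never with an integral, so averaging
  over \<lambda> takes the place of Fourier analysis. The price is that the limit is known only as
  the limit of a Cauchy sequence. Its positivity needs an argument of its own, and there the sign
  condition in \<open>Lambda_k\<close> matters: for a definite form the same sequence tends to zero.

  The exponent 100k balances two demands. Consecutive heights must have ratio 1 + O(1/n), so that
  monotonicity loses only a relative 1/n. At the same time n must be a small power of the height, so
  that a power saving in the height pays for every power of n that is spent. These are a mean error
  n^-5, a factor n for the tolerances i/n, and a factor n^2 for the almost sure bound, after which a
  summable n^-2 remains. The resulting saving P^(-1/(100k)) beats P^(-\<delta>), because 64^k >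
  100k.\<close>

definition repl :: "'s \<Rightarrow> real ^ 's \<Rightarrow> real ^ 's \<Rightarrow> real ^ 's::finite" where
  "repl i u l = (\<chi> m. if m = i then l \<bullet> u else l $ m)"

lemma linear_repl: "linear (repl i u)"
  by (rule linearI) (auto simp: repl_def vec_eq_iff inner_add_left)

text \<open>The product form of Lebesgue measure lets Fubini isolate a single coordinate.\<close>

lemma lborel_vec: "(lborel :: (real ^ 's::finite) measure) = distr (PiM UNIV (\<lambda>_. lborel)) borel vec_lambda"
proof (rule lborel_eqI)
  have [measurable]: "vec_lambda \<in> borel_measurable (PiM UNIV (\<lambda>_::'s. lborel :: real measure))"
    by (subst borel_measurable_euclidean_space) (auto simp: Basis_vec_def inner_axis)
  interpret product_sigma_finite "\<lambda>_::'s. lborel :: real measure" ..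
  fix l u :: "real ^ 's"
  assume le: "\<And>b. b \<in> Basis \<Longrightarrow> l \<bullet> b \<le> u \<bullet> b"
  have le: "l $ i \<le> u $ i" for i
    using le[of "axis i 1"] by (simp add: inner_axis axis_in_Basis_iff)
  have "emeasure (distr (PiM UNIV (\<lambda>_. lborel)) borel vec_lambda) (box l u)
      = emeasure (PiM UNIV (\<lambda>_. lborel)) (PiE UNIV (\<lambda>i. {l $ i<..<u $ i}))"
    by (subst emeasure_distr) (auto simp: space_PiM PiE_UNIV_domain Pi_def mem_box_cart intro!: arg_cong2[where f = emeasure])
  also have "\<dots> = (\<Prod>i\<in>UNIV. ennreal (u $ i - l $ i))"
    by (subst emeasure_PiM) (auto simp: le)
  also have "\<dots> = ennreal (\<Prod>i\<in>UNIV. u $ i - l $ i)"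
    by (intro prod_ennreal) (simp add: le)
  also have "(\<Prod>i\<in>UNIV. u $ i - l $ i) = (\<Prod>b\<in>Basis. (u - l) \<bullet> b)"
    by (simp add: Basis_vec_def cart_eq_inner_axis axis_eq_axis prod.UNION_disjoint inner_diff_left)
  finally show "emeasure (distr (PiM UNIV (\<lambda>_. lborel)) borel vec_lambda) (box l u) = (\<Prod>b\<in>Basis. (u - l) \<bullet> b)" .
qed simp

text \<open>With all coordinates but i frozen, \<open>repl i u\<close> is the affine map x -> c +
  u_i x of the line, so the one-dimensional substitution rule gives the factor |u_i| and no
  determinant has to be computed.\<close>

lemma nn_integral_repl:
  fixes u :: "real ^ 's::finite"
  assumes [measurable]: "h \<in> borel_measurable borel" and u: "u $ i \<noteq> 0"
  shows "(\<integral>\<^sup>+l. h l \<partial>lborel) = ennreal \<bar>u $ i\<bar> * (\<integral>\<^sup>+l. h (repl i u l) \<partial>lborel)"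
proof -
  have [measurable]: "vec_lambda \<in> borel_measurable (PiM UNIV (\<lambda>_::'s. lborel :: real measure))"
    by (subst borel_measurable_euclidean_space) (auto simp: Basis_vec_def inner_axis)
  have [measurable]: "repl i u \<in> borel_measurable borel"
    by (intro borel_measurable_continuous_onI linear_continuous_on linear_repl[unfolded linear_conv_bounded_linear])
  interpret product_sigma_finite "\<lambda>_::'s. lborel :: real measure" ..
  let ?M = "PiM (UNIV - {i}) (\<lambda>_::'s. lborel :: real measure)"
  have split: "(\<integral>\<^sup>+l. g l \<partial>lborel) = (\<integral>\<^sup>+f. (\<integral>\<^sup>+x. g (vec_lambda (f(i := x))) \<partial>lborel) \<partial>?M)"
    if [measurable]: "g \<in> borel_measurable borel" for g :: "real ^ 's \<Rightarrow> ennreal"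
  proof -
    have "(\<integral>\<^sup>+l. g l \<partial>lborel) = (\<integral>\<^sup>+f. g (vec_lambda f) \<partial>PiM (insert i (UNIV - {i})) (\<lambda>_. lborel))"
      by (subst lborel_vec, subst nn_integral_distr) (auto simp: insert_UNIV)
    also have "\<dots> = (\<integral>\<^sup>+f. (\<integral>\<^sup>+x. g (vec_lambda (f(i := x))) \<partial>lborel) \<partial>?M)"
      by (rule product_nn_integral_insert) (auto simp: insert_UNIV)
    finally show ?thesis .
  qed
  have "(\<integral>\<^sup>+x. h (vec_lambda (f(i := x))) \<partial>lborel)
      = ennreal \<bar>u $ i\<bar> * (\<integral>\<^sup>+x. h (repl i u (vec_lambda (f(i := x)))) \<partial>lborel)" for f
  proof -
    have m: "(\<lambda>x. h (vec_lambda (f(i := x)))) \<in> borel_measurable borel"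
      by (intro measurable_compose[OF _ assms(1)], subst borel_measurable_euclidean_space)
        (auto simp: Basis_vec_def inner_axis)
    define c where "c = (\<Sum>m\<in>UNIV - {i}. f m * u $ m)"
    have r: "repl i u (vec_lambda (f(i := x))) = vec_lambda (f(i := c + u $ i * x))" for x
      unfolding repl_def c_def inner_vec_def by (auto simp: vec_eq_iff sum.remove[of UNIV i])
    show ?thesis
      by (subst nn_integral_real_affine[OF m u, of c]) (simp add: r)
  qed
  note * = this
  have "(\<lambda>(f, x). vec_lambda (f(i := x))) \<in> borel_measurable (?M \<Otimes>\<^sub>M (lborel :: real measure))"
    using measurable_compose[OF measurable_add_dim[of i "UNIV - {i}" "\<lambda>_. lborel :: real measure"],
        of vec_lambda borel]
    by (simp add: insert_UNIV split_beta')
  then have "(\<lambda>(f, x). h (repl i u (vec_lambda (f(i := x))))) \<in> borel_measurable (?M \<Otimes>\<^sub>M (lborel :: real measure))"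
    by (simp add: split_beta')
  then have "(\<lambda>f. \<integral>\<^sup>+x. h (repl i u (vec_lambda (f(i := x)))) \<partial>lborel) \<in> borel_measurable ?M"
    by (rule lborel.borel_measurable_nn_integral)
  then show ?thesis
    by (subst (1 2) split) (auto simp: * intro!: nn_integral_cmult)
qed

text \<open>In the new coordinates the slab |l . u| < 1 becomes |y_i| < 1. For a linear map it is
  enough to know the factor on boxes, where \<open>nn_integral_repl\<close> applies to the indicator
  of the image.\<close>

lemma measure_repl:
  fixes u :: "real ^ 's::finite"
  assumes "S \<in> lmeasurable" and u: "u $ i \<noteq> 0"
  shows "repl i u ` S \<in> lmeasurable" "measure lebesgue (repl i u ` S) = \<bar>u $ i\<bar> * measure lebesgue S"
proof -
  have inj: "inj (repl i u)"
  proof (rule linear_injective_0[OF linear_repl, THEN iffD2], intro allI impI)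
    fix l assume l: "repl i u l = 0"
    then have "l $ m = 0" if "m \<noteq> i" for m
      using that by (auto simp: repl_def vec_eq_iff split: if_splits)
    moreover from this have "l \<bullet> u = l $ i * u $ i"
      unfolding inner_vec_def by (subst sum.remove[of _ i]) auto
    moreover have "l \<bullet> u = 0" using arg_cong[OF l, of "\<lambda>x. x $ i"] by (simp add: repl_def)
    ultimately show "l = 0" using u by (metis mult_eq_0_iff vec_eq_iff zero_index)
  qed
  have "measure lebesgue (repl i u ` cbox a b) = \<bar>u $ i\<bar> * measure lebesgue (cbox a b)" for a b
  proof -
    have [measurable]: "repl i u ` cbox a b \<in> sets borel"
      by (intro borel_compact compact_continuous_image linear_continuous_on
          linear_repl[unfolded linear_conv_bounded_linear] compact_cbox)
    have "emeasure lborel (repl i u ` cbox a b) = (\<integral>\<^sup>+l. indicator (repl i u ` cbox a b) l \<partial>lborel)"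
      by simp
    also have "\<dots> = ennreal \<bar>u $ i\<bar> * (\<integral>\<^sup>+l. indicator (repl i u ` cbox a b) (repl i u l) \<partial>lborel)"
      by (rule nn_integral_repl) (use u in auto)
    also have "(\<lambda>l. indicator (repl i u ` cbox a b) (repl i u l) :: ennreal) = indicator (cbox a b)"
      using inj by (auto simp: indicator_def fun_eq_iff inj_image_mem_iff)
    finally show ?thesis by (simp add: measure_def enn2real_mult)
  qed
  then show "repl i u ` S \<in> lmeasurable" "measure lebesgue (repl i u ` S) = \<bar>u $ i\<bar> * measure lebesgue S"
    using measure_linear_sufficient[OF linear_repl assms(1)] by metis+
qed

lemma measure_scaleR:
  assumes "S \<in> lmeasurable" and c: "c > 0"
  shows "(*\<^sub>R) c ` S \<in> lmeasurable"
    and "measure lebesgue ((*\<^sub>R) c ` S) = c ^ CARD('s::finite) * measure lebesgue (S :: (real ^ 's) set)"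
proof -
  have lin: "linear ((*\<^sub>R) c :: real ^ 's \<Rightarrow> real ^ 's)"
    by (simp add: linear_iff algebra_simps)
  have "measure lebesgue ((*\<^sub>R) c ` cbox a b) = c ^ CARD('s) * measure lebesgue (cbox a b)" for a b :: "real ^ 's"
    using measure_lebesgue_affine[of c 0 "cbox a b"] c by simp
  then show "(*\<^sub>R) c ` S \<in> lmeasurable"
    "measure lebesgue ((*\<^sub>R) c ` S) = c ^ CARD('s) * measure lebesgue S"
    using measure_linear_sufficient[OF lin assms(1), of "c ^ CARD('s)"] by simp_all
qed

section \<open>Straightening two slabs at once\<close>

definition repl2 :: "'s \<Rightarrow> 's \<Rightarrow> real ^ 's \<Rightarrow> real ^ 's \<Rightarrow> real ^ 's \<Rightarrow> real ^ 's::finite" where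
  "repl2 i j u v l = (\<chi> m. if m = i then l \<bullet> u else if m = j then l \<bullet> v else l $ m)"

definition minor :: "'s \<Rightarrow> 's \<Rightarrow> real ^ 's \<Rightarrow> real ^ 's \<Rightarrow> real" where
  "minor i j u v = u $ i * v $ j - u $ j * v $ i"

text \<open>One step of Gaussian elimination. Once coordinate i holds l . u, the value l . v must be
  recovered from the new vector: v - (v_i / u_i) u has i-th entry 0 and does not see the change, and
  the missing multiple of l . u is read off coordinate i.\<close>

lemma repl2_eq_comp:
  assumes "i \<noteq> j" "u $ i \<noteq> 0"
  shows "repl2 i j u v = repl j (v - (v $ i / u $ i) *\<^sub>R u + (v $ i / u $ i) *\<^sub>R axis i 1) \<circ> repl i u"
proof
  fix l :: "real ^ 'a"
  define w where "w = v - (v $ i / u $ i) *\<^sub>R u"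
  have wi: "w $ i = 0" using assms by (simp add: w_def)
  have "repl i u l \<bullet> w = l \<bullet> w"
    unfolding inner_vec_def by (intro sum.cong) (auto simp: repl_def wi)
  then have "repl i u l \<bullet> (w + (v $ i / u $ i) *\<^sub>R axis i 1) = l \<bullet> v"
    using assms by (simp add: inner_add_right inner_axis w_def inner_diff_right repl_def)
  then show "repl2 i j u v l = (repl j (v - (v $ i / u $ i) *\<^sub>R u + (v $ i / u $ i) *\<^sub>R axis i 1) \<circ> repl i u) l"
    using assms unfolding w_def[symmetric] by (auto simp: vec_eq_iff repl2_def repl_def)
qed

lemma measure_repl2:
  assumes "i \<noteq> j" "u $ i \<noteq> 0" "minor i j u v \<noteq> 0" "S \<in> lmeasurable"
  shows "repl2 i j u v ` S \<in> lmeasurable"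
    and "measure lebesgue (repl2 i j u v ` S) = \<bar>minor i j u v\<bar> * measure lebesgue S"
proof -
  define w where "w = v - (v $ i / u $ i) *\<^sub>R u + (v $ i / u $ i) *\<^sub>R axis i 1"
  have im: "repl2 i j u v ` S = repl j w ` repl i u ` S"
    unfolding repl2_eq_comp[OF assms(1,2)] w_def by (simp add: image_comp)
  have "w $ j = v $ j - v $ i / u $ i * u $ j"
    using assms(1) by (simp add: w_def axis_def)
  then have w: "w $ j * u $ i = minor i j u v"
    using assms(2) by (simp add: minor_def field_simps)
  then have wj: "w $ j \<noteq> 0" using assms(3) by auto
  show "repl2 i j u v ` S \<in> lmeasurable"
    unfolding im by (intro measure_repl assms wj)
  show "measure lebesgue (repl2 i j u v ` S) = \<bar>minor i j u v\<bar> * measure lebesgue S"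
    unfolding im w[symmetric] by (simp add: measure_repl assms wj abs_mult)
qed

section \<open>Slabs inside a cube\<close>

definition slab :: "real \<Rightarrow> real ^ 's \<Rightarrow> (real ^ 's::finite) set" where
  "slab L u = {l. (\<forall>m. \<bar>l $ m\<bar> \<le> L) \<and> \<bar>l \<bullet> u\<bar> < 1}"

definition cube :: "real \<Rightarrow> (real ^ 's::finite) set" where
  "cube L = cbox (\<chi> m. - L) (\<chi> m. L)"

lemma in_cube: "l \<in> cube L \<longleftrightarrow> (\<forall>m. \<bar>l $ m\<bar> \<le> L)"
  by (auto simp: cube_def mem_box_cart abs_le_iff minus_le_iff)

lemma lmeasurable_cube [simp]: "cube L \<in> lmeasurable"
  by (simp add: cube_def)

lemma slab_eq: "slab L u = cube L \<inter> {l. \<bar>l \<bullet> u\<bar> < 1}"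
  by (auto simp: slab_def in_cube)

lemma lmeasurable_slab [simp]: "slab L u \<in> lmeasurable"
proof -
  have "open {l. \<bar>l \<bullet> u\<bar> < 1}"
    by (intro open_Collect_less continuous_intros)
  then have "{l. \<bar>l \<bullet> u\<bar> < 1} \<in> sets lebesgue" by (simp add: borel_open)
  then show ?thesis unfolding slab_eq
    by (intro fmeasurable_Int_fmeasurable) auto
qed

lemma lmeasurable_slab_Int [simp]: "slab L u \<inter> slab L v \<in> lmeasurable"
  by (intro fmeasurable.Int lmeasurable_slab)

lemma measure_le_of_bounded:
  fixes S :: "(real ^ 's::finite) set"
  assumes "S \<in> lmeasurable" and "\<And>l m. l \<in> S \<Longrightarrow> \<bar>l $ m\<bar> \<le> L" and "L \<ge> 0"
  shows "measure lebesgue S \<le> (2 * L) ^ CARD('s)"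
proof -
  have "measure lebesgue S \<le> measure lebesgue (cube L :: (real ^ 's) set)"
    using assms by (intro measure_mono_fmeasurable) (auto simp: in_cube)
  also have "\<dots> = (2 * L) ^ CARD('s)"
  proof -
    have "cube L \<noteq> ({} :: (real ^ 's) set)"
      using assms(3) in_cube[of "0 :: real ^ 's" L] by auto
    then have "measure lborel (cube L :: (real ^ 's) set) = (2 * L) ^ CARD('s)"
      unfolding cube_def by (subst content_cbox_cart) auto
    then show ?thesis by (simp add: cube_def)
  qed
  finally show ?thesis .
qed

text \<open>Straightening keeps the slab inside the cube, since the new coordinate is below 1 <= L
  in absolute value; the image is then no larger than the cube.\<close>

lemma measure_slab_le:
  fixes u :: "real ^ 's::finite"
  assumes "L \<ge> 1"
  shows "\<bar>u $ i\<bar> * measure lebesgue (slab L u) \<le> (2 * L) ^ CARD('s)"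
proof -
  have "measure lebesgue (repl i u ` slab L u) \<le> (2 * L) ^ CARD('s)" if "u $ i \<noteq> 0"
    using assms that
    by (intro measure_le_of_bounded measure_repl lmeasurable_slab) (auto simp: repl_def slab_def intro: order.trans)
  then show ?thesis using assms by (cases "u $ i = 0") (simp_all add: measure_repl)
qed

lemma measure_slab_Int_le:
  fixes u v :: "real ^ 's::finite"
  assumes "L \<ge> 1" "i \<noteq> j" "u $ i \<noteq> 0"
  shows "\<bar>minor i j u v\<bar> * measure lebesgue (slab L u \<inter> slab L v) \<le> (2 * L) ^ CARD('s)"
proof -
  have "measure lebesgue (repl2 i j u v ` (slab L u \<inter> slab L v)) \<le> (2 * L) ^ CARD('s)"
    if "minor i j u v \<noteq> 0"
    using assms that
    by (intro measure_le_of_bounded measure_repl2 lmeasurable_slab_Int) (auto simp: repl2_def slab_def intro: order.trans)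
  then show ?thesis using assms by (cases "minor i j u v = 0") (simp_all add: measure_repl2)
qed

text \<open>Solve for a change of the two coordinates \<open>i\<close> and \<open>j\<close> that carries the values at \<open>u, v\<close> over to
  \<open>u', v'\<close>; shrinking by \<open>1 + \<epsilon>\<close> then returns to the cube without leaving the slabs.\<close>

lemma slab_compare:
  fixes u v u' v' :: "real ^ 's::finite"
  assumes ij: "i \<noteq> j" and nz: "u $ i \<noteq> 0" "u' $ i \<noteq> 0" "minor i j u' v' \<noteq> 0" and e: "\<epsilon> \<ge> 0"
    and sh: "\<And>l m. l \<in> slab L u \<inter> slab L v \<Longrightarrow> m \<in> {i, j} \<Longrightarrow>
      \<bar>v' $ m * (l \<bullet> (u - u')) - u' $ m * (l \<bullet> (v - v'))\<bar> \<le> \<epsilon> * L * \<bar>minor i j u' v'\<bar>"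
  shows "\<bar>minor i j u v\<bar> * measure lebesgue (slab L u \<inter> slab L v)
    \<le> (1 + \<epsilon>) ^ CARD('s) * (\<bar>minor i j u' v'\<bar> * measure lebesgue (slab L u' \<inter> slab L v'))"
proof -
  let ?D = "minor i j u' v'"
  let ?A = "slab L u \<inter> slab L v" and ?A' = "slab L u' \<inter> slab L v'"
  have "repl2 i j u v ` ?A \<subseteq> repl2 i j u' v' ` ((*\<^sub>R) (1 + \<epsilon>) ` ?A')"
  proof
    fix y assume "y \<in> repl2 i j u v ` ?A"
    then obtain l where l: "l \<in> ?A" and y: "y = repl2 i j u v l" by auto
    define R S where "R = l \<bullet> (u - u')" and "S = l \<bullet> (v - v')"
    \<comment> \<open>Cramer's rule: a and b are the shifts of coordinates i and j that make l' . u'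
      = l . u and l' . v' = l . v. Hypothesis \<open>sh\<close> bounds precisely their
      numerators.\<close>
    define a b where "a = (v' $ j * R - u' $ j * S) / ?D" and "b = (u' $ i * S - v' $ i * R) / ?D"
    define l' where "l' = l + a *\<^sub>R axis i 1 + b *\<^sub>R axis j 1"
    have "a * u' $ i + b * u' $ j = R * ?D / ?D" "a * v' $ i + b * v' $ j = S * ?D / ?D"
      unfolding a_def b_def times_divide_eq_left add_divide_distrib[symmetric]
      by (simp_all add: minor_def algebra_simps)
    then have lu: "l' \<bullet> u' = l \<bullet> u" and lv: "l' \<bullet> v' = l \<bullet> v"
      using nz(3) by (simp_all add: l'_def inner_add_left inner_axis' R_def S_def inner_diff_right)
    have y': "y = repl2 i j u' v' l'"
      unfolding y repl2_def lu lv by (auto simp: l'_def vec_eq_iff axis_def)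
    have ab: "\<bar>a\<bar> \<le> \<epsilon> * L" "\<bar>b\<bar> \<le> \<epsilon> * L"
      using sh[OF l, of j] sh[OF l, of i] nz(3)
      by (simp_all add: a_def b_def R_def S_def abs_divide pos_divide_le_eq abs_minus_commute)
    have "\<bar>l $ m\<bar> \<le> L" for m using l by (simp add: slab_def)
    then have "\<bar>l $ m\<bar> \<le> L" "L \<ge> 0" for m by (auto intro: order.trans[OF abs_ge_zero])
    moreover have "\<bar>l' $ m\<bar> \<le> \<bar>l $ m\<bar> + \<epsilon> * L" for m
      using ab ij e \<open>L \<ge> 0\<close> by (auto simp: l'_def axis_def)
    ultimately have "\<bar>l' $ m\<bar> \<le> L + \<epsilon> * L" for m
      by (meson add_right_mono order.trans)
    then have "\<bar>l' $ m / (1 + \<epsilon>)\<bar> \<le> L" for m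
      using e by (simp add: abs_divide pos_divide_le_eq field_simps)
    moreover have "\<bar>t / (1 + \<epsilon>)\<bar> < 1" if "\<bar>t\<bar> < 1" for t
      using that e by (simp add: abs_divide)
    ultimately have "(1 / (1 + \<epsilon>)) *\<^sub>R l' \<in> ?A'"
      using l lu lv by (simp add: slab_def)
    moreover have "l' = (1 + \<epsilon>) *\<^sub>R ((1 / (1 + \<epsilon>)) *\<^sub>R l')" using e by simp
    ultimately show "y \<in> repl2 i j u' v' ` ((*\<^sub>R) (1 + \<epsilon>) ` ?A')"
      unfolding y' by blast
  qed
  moreover note scal = measure_scaleR[OF lmeasurable_slab_Int[of L u' v'], of "1 + \<epsilon>"]
  ultimately have "measure lebesgue (repl2 i j u v ` ?A)
      \<le> measure lebesgue (repl2 i j u' v' ` ((*\<^sub>R) (1 + \<epsilon>) ` ?A'))" if "minor i j u v \<noteq> 0"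
    using ij nz e that
    by (intro measure_mono_fmeasurable measure_repl2 fmeasurableD scal) auto
  then have "\<bar>minor i j u v\<bar> * measure lebesgue ?A \<le> \<bar>?D\<bar> * ((1 + \<epsilon>) ^ CARD('s) * measure lebesgue ?A')"
    if "minor i j u v \<noteq> 0"
    using ij nz e that by (simp add: measure_repl2 scal)
  then show ?thesis using e by (cases "minor i j u v = 0") (simp_all add: mult_ac)
qed

section \<open>Lattice points and first moments\<close>

definition pw :: "nat \<Rightarrow> real ^ 's \<Rightarrow> real ^ 's" where
  "pw k p = (\<chi> i. (p $ i) ^ k)"

text \<open>For z = e / m the points m * \<open>shifted z x\<close> run through the residue class of
  e modulo m; \<open>shifted 0\<close> embeds integer vectors into real ones.\<close>

definition shifted :: "real ^ 's \<Rightarrow> int ^ 's \<Rightarrow> real ^ 's" where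
  "shifted z x = (\<chi> i. real_of_int (x $ i) + z $ i)"

definition vecs :: "('s \<Rightarrow> int set) \<Rightarrow> (int ^ 's) set" where
  "vecs S = {x. \<forall>i. x $ i \<in> S i}"

text \<open>Half open, so that the classes modulo m split the box of height mP into exactly m^s
  boxes of height P, and a shift by z in [0, 1] stays within absolute value P.\<close>

definition interv :: "nat \<Rightarrow> int set" where
  "interv P = {- int P..<int P}"

text \<open>Dividing the vector by \<tau> reduces every tolerance to the slabs of tolerance 1
  studied above.\<close>

definition slabk :: "real \<Rightarrow> nat \<Rightarrow> real \<Rightarrow> real ^ 's \<Rightarrow> (real ^ 's::finite) set" where
  "slabk L k \<tau> p = slab L ((1 / \<tau>) *\<^sub>R pw k p)"

lemma sum_vecs_prod:
  fixes f :: "'s::finite \<Rightarrow> int \<Rightarrow> real"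
  assumes "\<And>i. finite (S i)"
  shows "(\<Sum>x\<in>vecs S. \<Prod>i\<in>UNIV. f i (x $ i)) = (\<Prod>i\<in>UNIV. \<Sum>a\<in>S i. f i a)"
proof -
  have "(\<Sum>x\<in>vecs S. \<Prod>i\<in>UNIV. f i (x $ i)) = (\<Sum>g\<in>PiE UNIV S. \<Prod>i\<in>UNIV. f i (g i))"
    by (rule sum.reindex_bij_witness[of _ vec_lambda vec_nth]) (auto simp: vecs_def PiE_UNIV_domain)
  then show ?thesis using assms by (simp add: prod_sum_PiE)
qed

lemma bij_vecs: "bij_betw vec_nth (vecs S) (PiE UNIV S)"
  by (rule bij_betwI[of _ _ _ vec_lambda]) (auto simp: vecs_def PiE_UNIV_domain)

lemma finite_vecs: "(\<And>i. finite (S i)) \<Longrightarrow> finite (vecs (S :: 's::finite \<Rightarrow> int set))"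
  using bij_betw_finite[OF bij_vecs[of S]] by (auto intro!: finite_PiE)

lemma card_vecs: "card (vecs (S :: 's::finite \<Rightarrow> int set)) = (\<Prod>i\<in>UNIV. card (S i))"
  using bij_betw_same_card[OF bij_vecs[of S]] by (simp add: card_PiE)

lemma card_interv [simp]: "card (interv P) = 2 * P" and finite_interv [simp]: "finite (interv P)"
  by (simp_all add: interv_def)

section \<open>Sums of negative powers\<close>

lemma sum_inverse_sqrt_le: "(\<Sum>r=1..P. 1 / sqrt (real r)) \<le> 2 * sqrt (real P)"
proof (induction P)
  case (Suc P)
  have "(sqrt (real P) - sqrt (real (Suc P)))\<^sup>2 \<ge> 0" by simp
  then have "2 * sqrt (real P) * sqrt (real (Suc P)) + 1 \<le> 2 * sqrt (real (Suc P)) * sqrt (real (Suc P))"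
    by (simp add: power2_diff mult_ac)
  then have "2 * sqrt (real P) + 1 / sqrt (real (Suc P)) \<le> 2 * sqrt (real (Suc P))"
    by (simp add: divide_simps del: of_nat_Suc)
  then show ?case using Suc by simp
qed simp

text \<open>Everything reduces to the exponent 1/2 by r^-a <= P^(1/2 - a) r^(-1/2). The case of
  interest is a = k / (s - 1), where s > 2k gives a <= 1/2.\<close>

lemma sum_powr_le:
  assumes "0 \<le> a" "a \<le> 1 / 2"
  shows "(\<Sum>r=1..P. real r powr - a) \<le> 2 * real P powr (1 - a)"
proof -
  have "real r powr - a \<le> real P powr (1 / 2 - a) * (1 / sqrt (real r))" if "r \<in> {1..P}" for r
  proof -
    have "real r powr - a = real r powr (1 / 2 - a) * real r powr (- (1 / 2))"
      by (simp add: powr_add[symmetric])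
    also have "\<dots> \<le> real P powr (1 / 2 - a) * real r powr (- (1 / 2))"
      using that assms by (intro mult_right_mono powr_mono2) auto
    also have "real r powr (- (1 / 2)) = 1 / sqrt (real r)"
      using that by (simp add: powr_minus powr_half_sqrt inverse_eq_divide)
    finally show ?thesis .
  qed
  then have "(\<Sum>r=1..P. real r powr - a) \<le> (\<Sum>r=1..P. real P powr (1 / 2 - a) * (1 / sqrt (real r)))"
    by (rule sum_mono)
  also have "\<dots> \<le> real P powr (1 / 2 - a) * (2 * sqrt (real P))"
    unfolding sum_distrib_left[symmetric] by (intro mult_left_mono sum_inverse_sqrt_le) auto
  also have "\<dots> = 2 * (real P powr (1 / 2 - a) * real P powr (1 / 2))"
    by (simp add: powr_half_sqrt)
  also have "\<dots> = 2 * real P powr (1 - a)"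
    unfolding powr_add[symmetric] by simp
  finally show ?thesis .
qed

lemma sum_Un_le:
  fixes f :: "'a \<Rightarrow> real"
  assumes "finite A" "finite B" "\<And>x. 0 \<le> f x"
  shows "sum f (A \<union> B) \<le> sum f A + sum f B"
  using assms by (simp add: sum_Un sum_nonneg)

text \<open>The point 0 contributes 1 <= P^(1-a) and each sign at most 2 P^(1-a), which makes
  5.\<close>

lemma sum_interv_powr_le:
  assumes "0 \<le> a" "a \<le> 1 / 2" "P \<ge> 1"
  shows "(\<Sum>x\<in>interv P. max 1 \<bar>real_of_int x\<bar> powr - a) \<le> 5 * real P powr (1 - a)"
proof -
  let ?f = "\<lambda>x::int. max 1 \<bar>real_of_int x\<bar> powr - a"
  have sub: "interv P \<subseteq> {0} \<union> int ` {1..P} \<union> (\<lambda>r. - int r) ` {1..P}"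
  proof
    fix x assume x: "x \<in> interv P"
    consider "x = 0" | "x > 0" | "x < 0" by linarith
    then show "x \<in> {0} \<union> int ` {1..P} \<union> (\<lambda>r. - int r) ` {1..P}"
    proof cases
      case 2
      then have "x = int (nat x)" "nat x \<in> {1..P}" using x by (auto simp: interv_def)
      then show ?thesis by blast
    next
      case 3
      then have "x = - int (nat (- x))" "nat (- x) \<in> {1..P}" using x by (auto simp: interv_def)
      then show ?thesis by blast
    qed simp
  qed
  have "sum ?f (interv P) \<le> sum ?f ({0} \<union> int ` {1..P} \<union> (\<lambda>r. - int r) ` {1..P})"
    by (intro sum_mono2 sub) auto
  also have "\<dots> \<le> sum ?f ({0} \<union> int ` {1..P}) + sum ?f ((\<lambda>r. - int r) ` {1..P})"
    by (intro sum_Un_le) auto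
  also have "\<dots> \<le> sum ?f {0} + sum ?f (int ` {1..P}) + sum ?f ((\<lambda>r. - int r) ` {1..P})"
    by (intro add_right_mono sum_Un_le) auto
  also have "sum ?f (int ` {1..P}) = (\<Sum>r=1..P. real r powr - a)"
    by (subst sum.reindex) (auto intro!: sum.cong simp: inj_on_def max_def)
  also have "sum ?f ((\<lambda>r. - int r) ` {1..P}) = (\<Sum>r=1..P. real r powr - a)"
    by (subst sum.reindex) (auto intro!: sum.cong simp: inj_on_def max_def)
  also have "sum ?f {0} = 1" by simp
  also have "1 \<le> real P powr (1 - a)"
    using assms by (intro ge_one_powr_ge_zero) auto
  finally show ?thesis using sum_powr_le[OF assms(1,2), of P] by linarith
qed

section \<open>Volumes of single slabs\<close>

lemma lmeasurable_slabk [simp]: "slabk L k \<tau> p \<in> lmeasurable"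
  by (simp add: slabk_def)

lemma measure_slabk_le:
  fixes p :: "real ^ 's::finite"
  assumes "L \<ge> 1" "0 < \<tau>" "\<tau> \<le> 1"
  shows "measure lebesgue (slabk L k \<tau> p) \<le> (2 * L) ^ CARD('s)"
    and "\<bar>p $ m\<bar> ^ k * measure lebesgue (slabk L k \<tau> p) \<le> \<tau> * (2 * L) ^ CARD('s)"
proof -
  show "measure lebesgue (slabk L k \<tau> p) \<le> (2 * L) ^ CARD('s)"
    using assms(1) by (intro measure_le_of_bounded lmeasurable_slabk) (auto simp: slabk_def slab_def)
  show "\<bar>p $ m\<bar> ^ k * measure lebesgue (slabk L k \<tau> p) \<le> \<tau> * (2 * L) ^ CARD('s)"
    using measure_slab_le[OF assms(1), of "(1 / \<tau>) *\<^sub>R pw k p" m] assms(2)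
    by (simp add: pw_def slabk_def abs_mult power_abs field_simps)
qed

text \<open>A shift by at most 1 can at worst halve a coordinate of absolute value at least 2, which
  costs 2^k; for smaller coordinates the volume of the cube is bound enough.\<close>

lemma measure_slabk_shifted_le:
  fixes z :: "real ^ 's::finite"
  assumes "L \<ge> 1" "0 < \<tau>" "\<tau> \<le> 1" and z: "\<And>i. 0 \<le> z $ i \<and> z $ i \<le> 1"
  shows "max 1 \<bar>real_of_int (x $ m)\<bar> ^ k * measure lebesgue (slabk L k \<tau> (shifted z x)) \<le> (2 * L) ^ CARD('s) * 2 ^ k"
proof -
  let ?M = "measure lebesgue (slabk L k \<tau> (shifted z x))"
  show ?thesis
  proof (cases "\<bar>x $ m\<bar> \<le> 1")
    case True
    then have "max 1 \<bar>real_of_int (x $ m)\<bar> = 1" by linarith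
    moreover have "?M * 1 \<le> (2 * L) ^ CARD('s) * 2 ^ k"
      using measure_slabk_le(1)[OF assms(1-3), of k "shifted z x"] assms(1) by (intro mult_mono) auto
    ultimately show ?thesis by simp
  next
    case False
    let ?a = "\<bar>real_of_int (x $ m)\<bar>"
    have 1: "max 1 ?a = ?a" "?a \<ge> 2" using False by linarith+
    have "?a / 2 \<le> \<bar>shifted z x $ m\<bar>"
      using 1 z[of m] unfolding shifted_def vec_lambda_beta by (smt (verit) field_sum_of_halves)
    then have "(?a / 2) ^ k * ?M \<le> \<bar>shifted z x $ m\<bar> ^ k * ?M"
      by (intro mult_right_mono power_mono) auto
    also have "\<dots> \<le> \<tau> * (2 * L) ^ CARD('s)" by (rule measure_slabk_le[OF assms(1-3)])
    also have "\<dots> \<le> 1 * (2 * L) ^ CARD('s)" using assms by (intro mult_right_mono) auto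
    finally show ?thesis by (simp add: 1 power_divide field_simps)
  qed
qed

text \<open>Bounding by the geometric mean over the coordinates other than \<open>i\<close> makes the sum factorize.\<close>

lemma first_moment:
  fixes z :: "real ^ 's::finite"
  assumes "L \<ge> 1" "0 < \<tau>" "\<tau> \<le> 1" and z: "\<And>i. 0 \<le> z $ i \<and> z $ i \<le> 1"
    and s: "CARD('s) > 2 * k" "k \<ge> 1" and P: "P \<ge> 1" and S: "finite S"
  shows "(\<Sum>x\<in>vecs (\<lambda>m. if m = i then S else interv P). measure lebesgue (slabk L k \<tau> (shifted z x)))
    \<le> (2 * L) ^ CARD('s) * 2 ^ k * 5 ^ (CARD('s) - 1) * real (card S) * real P ^ (CARD('s) - 1 - k)"
proof -
  \<comment> \<open>The exponent k is shared equally among the s - 1 coordinates other than i: the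
    largest of them, raised to -k, is at most the product of all of them, each raised to -a.\<close>
  define a where "a = real k / real (CARD('s) - 1)"
  define C where "C = (2 * L) ^ CARD('s) * 2 ^ k"
  define f where "f = (\<lambda>m (x::int). if m = i then 1 else max 1 \<bar>real_of_int x\<bar> powr - a)"
  have C0: "C \<ge> 0" using assms by (simp add: C_def)
  have a: "0 \<le> a" "a \<le> 1 / 2" using s by (auto simp: a_def field_simps)
  have card: "card (UNIV - {i}) = CARD('s) - 1" by (simp add: card_Diff_singleton)
  have "card (UNIV - {i}) > 0" using card s by linarith
  then have ne: "UNIV - {i} \<noteq> {}" by force
  have ex_max: "\<exists>m\<in>A. \<forall>j\<in>A. g j \<le> g m" if "A \<noteq> {}" for A and g :: "'s \<Rightarrow> real"
  proof -
    have "Max (g ` A) \<in> g ` A" using that by (intro Max_in) auto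
    then obtain m where "m \<in> A" "Max (g ` A) = g m" by (rule imageE) auto
    moreover have "g j \<le> Max (g ` A)" if "j \<in> A" for j using that by (intro Max_ge) auto
    ultimately show ?thesis by (metis (no_types))
  qed
  have bound: "measure lebesgue (slabk L k \<tau> (shifted z x)) \<le> C * (\<Prod>m\<in>UNIV. f m (x $ m))" for x
  proof -
    let ?b = "\<lambda>m. max 1 \<bar>real_of_int (x $ m)\<bar>"
    obtain m where m: "m \<in> UNIV - {i}" and m': "\<And>j. j \<in> UNIV - {i} \<Longrightarrow> ?b j \<le> ?b m"
      using ex_max[OF ne, of ?b] by blast
    have pos: "?b m powr (- a) > 0"
      unfolding powr_gt_zero by linarith
    have "measure lebesgue (slabk L k \<tau> (shifted z x)) * ?b m ^ k \<le> C"
      using measure_slabk_shifted_le[OF assms(1-4), of x m k] by (simp add: C_def mult.commute)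
    then have "measure lebesgue (slabk L k \<tau> (shifted z x)) \<le> C / ?b m ^ k"
      by (subst pos_le_divide_eq) auto
    also have "\<dots> = C * ?b m powr (- real k)"
      by (simp add: powr_minus powr_realpow divide_inverse)
    also have "\<dots> = C * (?b m powr (- a)) powr real (CARD('s) - 1)"
      using s by (simp add: powr_powr a_def)
    also have "\<dots> = C * (\<Prod>j\<in>UNIV - {i}. ?b m powr (- a))"
      by (simp only: prod_constant card powr_realpow[OF pos])
    also have "\<dots> \<le> C * (\<Prod>j\<in>UNIV - {i}. f j (x $ j))"
      using m' a C0 by (intro mult_left_mono prod_mono) (auto simp: f_def intro!: powr_mono2')
    also have "(\<Prod>j\<in>UNIV - {i}. f j (x $ j)) = (\<Prod>j\<in>UNIV. f j (x $ j))"
      by (subst (2) prod.remove[of _ i]) (auto simp: f_def)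
    finally show ?thesis .
  qed
  have "(\<Sum>x\<in>vecs (\<lambda>m. if m = i then S else interv P). measure lebesgue (slabk L k \<tau> (shifted z x)))
      \<le> (\<Sum>x\<in>vecs (\<lambda>m. if m = i then S else interv P). C * (\<Prod>m\<in>UNIV. f m (x $ m)))"
    by (intro sum_mono bound)
  also have "\<dots> = C * (\<Prod>m\<in>UNIV. \<Sum>x\<in>(if m = i then S else interv P). f m x)"
    using S by (simp add: sum_distrib_left[symmetric] sum_vecs_prod)
  also have "(\<Prod>m\<in>UNIV. \<Sum>x\<in>(if m = i then S else interv P). f m x)
      = real (card S) * (\<Prod>m\<in>UNIV - {i}. \<Sum>x\<in>interv P. max 1 \<bar>real_of_int x\<bar> powr - a)"
    by (subst prod.remove[of _ i]) (auto simp: f_def intro!: prod.cong sum.cong)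
  also have "C * \<dots> \<le> C * (real (card S) * (\<Prod>m\<in>UNIV - {i}. 5 * real P powr (1 - a)))"
    using C0 by (intro mult_left_mono prod_mono conjI sum_interv_powr_le a P sum_nonneg) auto
  also have "(\<Prod>m\<in>UNIV - {i}. 5 * real P powr (1 - a)) = 5 ^ (CARD('s) - 1) * (real P powr (1 - a)) ^ (CARD('s) - 1)"
    by (simp add: card power_mult_distrib)
  also have "(real P powr (1 - a)) ^ (CARD('s) - 1) = real P powr ((1 - a) * real (CARD('s) - 1))"
    using P by (simp add: powr_realpow[symmetric] powr_powr)
  also have "(1 - a) * real (CARD('s) - 1) = real (CARD('s) - 1 - k)"
    using s by (simp add: a_def left_diff_distrib of_nat_diff)
  also have "real P powr real (CARD('s) - 1 - k) = real P ^ (CARD('s) - 1 - k)"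
    using P by (simp add: powr_realpow)
  finally show ?thesis by (simp add: C_def mult_ac)
qed

section \<open>Counting nearly proportional pairs\<close>

lemma abs_power_diff_le:
  fixes a b :: real
  assumes "\<bar>a\<bar> \<le> M" "\<bar>b\<bar> \<le> M"
  shows "\<bar>a ^ k - b ^ k\<bar> \<le> real k * \<bar>a - b\<bar> * M ^ (k - 1)"
proof -
  have "\<bar>(\<Sum>i<k. b ^ (k - Suc i) * a ^ i)\<bar> \<le> (\<Sum>i<k. M ^ (k - 1))"
  proof (rule order.trans[OF sum_abs], rule sum_mono)
    fix i assume i: "i \<in> {..<k}"
    have "\<bar>b ^ (k - Suc i) * a ^ i\<bar> \<le> M ^ (k - Suc i) * M ^ i"
      unfolding abs_mult power_abs using assms by (intro mult_mono power_mono) auto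
    also have "\<dots> = M ^ (k - 1)" using i by (simp add: power_add[symmetric])
    finally show "\<bar>b ^ (k - Suc i) * a ^ i\<bar> \<le> M ^ (k - 1)" .
  qed
  then have "\<bar>a - b\<bar> * \<bar>(\<Sum>i<k. b ^ (k - Suc i) * a ^ i)\<bar> \<le> \<bar>a - b\<bar> * (real k * M ^ (k - 1))"
    by (intro mult_left_mono) auto
  then show ?thesis
    by (simp add: power_diff_sumr2 abs_mult mult_ac)
qed

text \<open>Turns closeness of k-th powers into closeness of their bases, with a gain that grows
  with the size Q of the bases.\<close>

lemma abs_power_diff_ge:
  fixes a b Q :: real
  assumes "0 \<le> Q" "Q \<le> a" "Q \<le> b" "k \<ge> 1"
  shows "\<bar>a - b\<bar> * Q ^ (k - 1) \<le> \<bar>a ^ k - b ^ k\<bar>"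
proof -
  have *: "(c - d) * Q ^ (k - 1) \<le> c ^ k - d ^ k" if "0 \<le> d" "d \<le> c" "Q \<le> c" for c d
  proof -
    have k: "c ^ k = c * c ^ (k - 1)" "d ^ k = d * d ^ (k - 1)"
      using assms(4) by (simp_all add: power_eq_if)
    have "(c - d) * Q ^ (k - 1) \<le> (c - d) * c ^ (k - 1)"
      using that assms by (intro mult_left_mono power_mono) auto
    also have "\<dots> = c ^ k - d * c ^ (k - 1)" by (simp add: k algebra_simps)
    also have "\<dots> \<le> c ^ k - d * d ^ (k - 1)"
      using that by (intro diff_left_mono mult_left_mono power_mono) auto
    finally show ?thesis by (simp add: k)
  qed
  show ?thesis
    using *[of a b] *[of b a] assms by (cases a b rule: linorder_le_cases) auto
qed

text \<open>Each of the intervals about r and -r has at most 2h + 1 <= 3h integers. Absolute values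
  occur because for even k the minors do not determine signs.\<close>

lemma card_int_near_le:
  assumes "h \<ge> (1::real)"
  shows "finite {y::int. \<bar>\<bar>real_of_int y\<bar> - r\<bar> \<le> h}" and "real (card {y::int. \<bar>\<bar>real_of_int y\<bar> - r\<bar> \<le> h}) \<le> 6 * h"
proof -
  have card: "real (card {\<lceil>t - h\<rceil>..\<lfloor>t + h\<rfloor>}) \<le> 3 * h" for t
    using assms by (simp, linarith)
  have sub: "{y::int. \<bar>\<bar>real_of_int y\<bar> - r\<bar> \<le> h} \<subseteq> {\<lceil>r - h\<rceil>..\<lfloor>r + h\<rfloor>} \<union> {\<lceil>- r - h\<rceil>..\<lfloor>- r + h\<rfloor>}"
    by (auto simp: le_floor_iff ceiling_le_iff abs_le_iff abs_if split: if_splits)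
  show "finite {y::int. \<bar>\<bar>real_of_int y\<bar> - r\<bar> \<le> h}" using sub by (rule finite_subset) auto
  have "card {y::int. \<bar>\<bar>real_of_int y\<bar> - r\<bar> \<le> h} \<le> card {\<lceil>r - h\<rceil>..\<lfloor>r + h\<rfloor>} + card {\<lceil>- r - h\<rceil>..\<lfloor>- r + h\<rfloor>}"
    by (rule order.trans[OF card_mono[OF _ sub] card_Un_le]) auto
  then show "real (card {y::int. \<bar>\<bar>real_of_int y\<bar> - r\<bar> \<le> h}) \<le> 6 * h"
    using card[of r] card[of "- r"] by linarith
qed

text \<open>The lower bound Q keeps the pivot u_i away from 0 and lets small minors of k-th powers
  be read as near proportionality of the vectors themselves.\<close>

definition goodvecs :: "nat \<Rightarrow> real \<Rightarrow> (int ^ 's) set" where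
  "goodvecs P Q = {x \<in> vecs (\<lambda>_. interv P). \<forall>m. Q \<le> \<bar>real_of_int (x $ m)\<bar>}"

lemma finite_goodvecs [simp]: "finite (goodvecs P Q :: (int ^ 's::finite) set)"
  by (auto simp: goodvecs_def intro: finite_subset[OF _ finite_vecs[of "\<lambda>_. interv P"]])

lemma card_goodvecs_le: "card (goodvecs P Q :: (int ^ 's::finite) set) \<le> (2 * P) ^ CARD('s)"
proof -
  have "card (goodvecs P Q :: (int ^ 's) set) \<le> card (vecs (\<lambda>_::'s. interv P))"
    by (intro card_mono finite_vecs) (auto simp: goodvecs_def)
  then show ?thesis by (simp add: card_vecs)
qed

text \<open>Given x and the entry y_i, a small minor with columns i and j confines |y_j| to distance
  h from |x_j y_i / x_i|. There are at most (2P)^s choices of x, 2P of y_i, and 6h of each of the s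
  - 1 other entries of y.\<close>

lemma card_near_parallel_le:
  fixes i :: "'s::finite"
  assumes Q: "Q \<ge> 1" and h: "h \<ge> 1" and D: "\<Delta> \<le> h * Q ^ (2 * k - 1)" and k: "k \<ge> 1"
  shows "real (card {(x, y) \<in> goodvecs P Q \<times> goodvecs P Q. \<forall>j. j \<noteq> i \<longrightarrow>
      \<bar>minor i j (pw k (shifted 0 x)) (pw k (shifted 0 y))\<bar> \<le> \<Delta>})
    \<le> (2 * real P) ^ (CARD('s) + 1) * (6 * h) ^ (CARD('s) - 1)"
proof -
  define r where "r x b j = \<bar>real_of_int (x $ j)\<bar> * \<bar>real_of_int b\<bar> / \<bar>real_of_int (x $ i)\<bar>" for x :: "int ^ 's" and b j
  define T where "T x b = vecs (\<lambda>m. if m = i then {b} else {y. \<bar>\<bar>real_of_int y\<bar> - r x b m\<bar> \<le> h})" for x b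
  have card: "card (UNIV - {i}) = CARD('s) - 1" by (simp add: card_Diff_singleton)
  have finT: "finite (T x b)" for x b
    unfolding T_def by (intro finite_vecs) (auto intro: card_int_near_le h)
  have cardT: "real (card (T x b)) \<le> (6 * h) ^ (CARD('s) - 1)" for x b
  proof -
    have "real (card (T x b)) = (\<Prod>m\<in>UNIV - {i}. real (card {y::int. \<bar>\<bar>real_of_int y\<bar> - r x b m\<bar> \<le> h}))"
      unfolding T_def card_vecs of_nat_prod by (subst prod.remove[of _ i]) (auto intro!: prod.cong)
    also have "\<dots> \<le> (\<Prod>m\<in>UNIV - {i}. 6 * h)"
      by (intro prod_mono conjI card_int_near_le h) auto
    finally show ?thesis by (simp add: card)
  qed
  have sub: "{(x, y) \<in> goodvecs P Q \<times> goodvecs P Q. \<forall>j. j \<noteq> i \<longrightarrow>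
      \<bar>minor i j (pw k (shifted 0 x)) (pw k (shifted 0 y))\<bar> \<le> \<Delta>}
      \<subseteq> Sigma (goodvecs P Q) (\<lambda>x. \<Union>b\<in>interv P. T x b)" (is "?A \<subseteq> _")
  proof (rule subsetI)
    fix p assume p: "p \<in> ?A"
    obtain x y where pxy: "p = (x, y)" by fastforce
    have xy: "x \<in> goodvecs P Q" "y \<in> goodvecs P Q"
      and m: "\<forall>j. j \<noteq> i \<longrightarrow> \<bar>minor i j (pw k (shifted 0 x)) (pw k (shifted 0 y))\<bar> \<le> \<Delta>"
      using p by (auto simp: pxy)
    have "\<bar>\<bar>real_of_int (y $ j)\<bar> - r x (y $ i) j\<bar> \<le> h" if j: "j \<noteq> i" for j
    proof -
      let ?xi = "\<bar>real_of_int (x $ i)\<bar>" and ?xj = "\<bar>real_of_int (x $ j)\<bar>"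
      let ?yi = "\<bar>real_of_int (y $ i)\<bar>" and ?yj = "\<bar>real_of_int (y $ j)\<bar>"
      have ge: "?xi \<ge> Q" "?xj \<ge> Q" "?yi \<ge> Q" "?yj \<ge> Q" using xy by (auto simp: goodvecs_def)
      then have QQ: "Q * Q \<le> ?xi * ?yj" "Q * Q \<le> ?xj * ?yi"
        using Q by (auto intro!: mult_mono)
      \<comment> \<open>Both products are at least Q^2, so their k-th powers differ by at least
        Q^(2k-2) times their own difference; of the allowance h Q^(2k-1) only h Q remains.\<close>
      have "\<bar>?xi * ?yj - ?xj * ?yi\<bar> * (Q * Q) ^ (k - 1) \<le> \<bar>(?xi * ?yj) ^ k - (?xj * ?yi) ^ k\<bar>"
        using QQ Q k by (intro abs_power_diff_ge) auto
      also have "\<dots> = \<bar>\<bar>(real_of_int (x $ i) * real_of_int (y $ j)) ^ k\<bar> - \<bar>(real_of_int (x $ j) * real_of_int (y $ i)) ^ k\<bar>\<bar>"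
        by (simp add: power_abs abs_mult)
      also have "\<dots> \<le> \<bar>(real_of_int (x $ i) * real_of_int (y $ j)) ^ k - (real_of_int (x $ j) * real_of_int (y $ i)) ^ k\<bar>"
        by (rule abs_triangle_ineq3)
      also have "\<dots> = \<bar>minor i j (pw k (shifted 0 x)) (pw k (shifted 0 y))\<bar>"
        by (simp add: minor_def pw_def shifted_def power_mult_distrib)
      also have "\<dots> \<le> h * Q ^ (2 * k - 1)" using m j D by (meson order.trans)
      also have "Q ^ (2 * k - 1) = Q * (Q * Q) ^ (k - 1)"
        using k by (cases k) (simp_all add: power_mult_distrib power_add[symmetric] mult_2)
      finally have "\<bar>?xi * ?yj - ?xj * ?yi\<bar> * (Q * Q) ^ (k - 1) \<le> (h * Q) * (Q * Q) ^ (k - 1)"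
        by (simp add: mult.assoc)
      then have "\<bar>?xi * ?yj - ?xj * ?yi\<bar> \<le> h * Q" using Q by simp
      also have "\<dots> \<le> h * ?xi" using ge h by (intro mult_left_mono) auto
      finally have 1: "\<bar>?xi * ?yj - ?xj * ?yi\<bar> \<le> h * ?xi" .
      have xi: "?xi > 0" using ge Q by linarith
      have "?yj - r x (y $ i) j = (?xi * ?yj - ?xj * ?yi) / ?xi"
        using xi unfolding r_def by (simp add: field_simps)
      then have "\<bar>?yj - r x (y $ i) j\<bar> = \<bar>?xi * ?yj - ?xj * ?yi\<bar> / ?xi"
        by (simp add: abs_divide)
      then show ?thesis using 1 xi by (simp add: divide_le_eq)
    qed
    then have "y \<in> T x (y $ i)" by (simp add: T_def vecs_def)
    moreover have "y $ i \<in> interv P" using xy by (auto simp: goodvecs_def vecs_def)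
    ultimately show "p \<in> Sigma (goodvecs P Q) (\<lambda>x. \<Union>b\<in>interv P. T x b)" using xy pxy by blast
  qed
  have "real (card (goodvecs P Q :: (int ^ 's) set)) \<le> real ((2 * P) ^ CARD('s))"
    by (intro of_nat_mono card_goodvecs_le)
  then have cardG: "real (card (goodvecs P Q :: (int ^ 's) set)) \<le> (2 * real P) ^ CARD('s)" by simp
  have cardU: "real (card (\<Union>b\<in>interv P. T x b)) \<le> (\<Sum>b\<in>interv P. real (card (T x b)))" for x
    using of_nat_mono[OF card_UN_le[OF finite_interv, of "T x" P], where 'a = real] by simp
  have finS: "finite (Sigma (goodvecs P Q) (\<lambda>x. \<Union>b\<in>interv P. T x b))"
    by (intro finite_SigmaI finite_UN_I finT finite_goodvecs finite_interv)
  have "real (card {(x, y) \<in> goodvecs P Q \<times> goodvecs P Q. \<forall>j. j \<noteq> i \<longrightarrow>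
      \<bar>minor i j (pw k (shifted 0 x)) (pw k (shifted 0 y))\<bar> \<le> \<Delta>})
      \<le> real (card (Sigma (goodvecs P Q) (\<lambda>x. \<Union>b\<in>interv P. T x b)))"
    using card_mono[OF finS sub] by simp
  also have "\<dots> = (\<Sum>x\<in>goodvecs P Q. real (card (\<Union>b\<in>interv P. T x b)))"
    by (subst card_SigmaI) (auto intro: finT)
  also have "\<dots> \<le> (\<Sum>x\<in>(goodvecs P Q :: (int ^ 's) set). \<Sum>b\<in>interv P. real (card (T x b)))"
    by (intro sum_mono cardU)
  also have "\<dots> \<le> (\<Sum>x\<in>(goodvecs P Q :: (int ^ 's) set). \<Sum>b\<in>interv P. (6 * h) ^ (CARD('s) - 1))"
    by (intro sum_mono cardT)
  also have "\<dots> = real (card (goodvecs P Q :: (int ^ 's) set)) * (2 * real P * (6 * h) ^ (CARD('s) - 1))"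
    by simp
  also have "\<dots> \<le> (2 * real P) ^ CARD('s) * (2 * real P * (6 * h) ^ (CARD('s) - 1))"
    using cardG h by (intro mult_right_mono) auto
  finally show ?thesis by (simp add: mult_ac)
qed

section \<open>Comparing pairs of slabs\<close>

lemma minor_scaleR: "minor i j (a *\<^sub>R u) (b *\<^sub>R v) = a * b * minor i j u v"
  by (simp add: minor_def algebra_simps)

lemma abs_pw_nth_le: "(\<And>m. \<bar>p $ m\<bar> \<le> P) \<Longrightarrow> \<bar>pw k p $ m\<bar> \<le> P ^ k"
  by (simp add: pw_def power_abs power_mono)

lemma abs_pw_diff_le:
  assumes "\<And>m. \<bar>p $ m\<bar> \<le> P" "\<And>m. \<bar>p' $ m\<bar> \<le> P" "\<bar>p $ m - p' $ m\<bar> \<le> 1" "P \<ge> 0"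
  shows "\<bar>pw k p $ m - pw k p' $ m\<bar> \<le> real k * P ^ (k - 1)"
proof -
  have "\<bar>pw k p $ m - pw k p' $ m\<bar> \<le> real k * \<bar>p $ m - p' $ m\<bar> * P ^ (k - 1)"
    unfolding pw_def vec_lambda_beta using assms by (intro abs_power_diff_le) auto
  also have "\<dots> \<le> real k * 1 * P ^ (k - 1)"
    using assms by (intro mult_right_mono mult_left_mono) auto
  finally show ?thesis by simp
qed

lemma abs_minor_diff_le:
  assumes p: "\<And>m. \<bar>p $ m\<bar> \<le> P" "\<And>m. \<bar>p' $ m\<bar> \<le> P" "\<And>m. \<bar>p $ m - p' $ m\<bar> \<le> 1"
    and q: "\<And>m. \<bar>q $ m\<bar> \<le> P" "\<And>m. \<bar>q' $ m\<bar> \<le> P" "\<And>m. \<bar>q $ m - q' $ m\<bar> \<le> 1"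
    and P: "P \<ge> 0" and k: "k \<ge> 1"
  shows "\<bar>minor i j (pw k p) (pw k q) - minor i j (pw k p') (pw k q')\<bar> \<le> 4 * real k * P ^ (2 * k - 1)"
proof -
  have *: "\<bar>pw k p $ a * pw k q $ b - pw k p' $ a * pw k q' $ b\<bar> \<le> 2 * real k * P ^ (2 * k - 1)" for a b
  proof -
    have "\<bar>pw k p $ a * (pw k q $ b - pw k q' $ b)\<bar> \<le> P ^ k * (real k * P ^ (k - 1))"
      unfolding abs_mult by (intro mult_mono abs_pw_nth_le abs_pw_diff_le p q P) (use P in auto)
    moreover have "\<bar>(pw k p $ a - pw k p' $ a) * pw k q' $ b\<bar> \<le> (real k * P ^ (k - 1)) * P ^ k"
      unfolding abs_mult by (intro mult_mono abs_pw_nth_le abs_pw_diff_le p q P) (use P in auto)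
    moreover have "P ^ (2 * k - 1) = P ^ k * P ^ (k - 1)"
      using k by (simp add: power_add[symmetric] mult_2)
    ultimately show ?thesis by (simp add: algebra_simps)
  qed
  show ?thesis using *[of i j] *[of j i] unfolding minor_def by linarith
qed

definition pairm :: "real \<Rightarrow> nat \<Rightarrow> real \<Rightarrow> real ^ 's \<Rightarrow> real \<Rightarrow> real ^ 's::finite \<Rightarrow> real" where
  "pairm L k \<tau> p \<sigma> q = measure lebesgue (slabk L k \<tau> p \<inter> slabk L k \<sigma> q)"

lemma pairm_nonneg [simp]: "pairm L k \<tau> p \<sigma> q \<ge> 0"
  by (simp add: pairm_def)

lemma pairm_le_minor:
  fixes p :: "real ^ 's::finite"
  assumes "L \<ge> 1" "i \<noteq> j" "p $ i \<noteq> 0" "0 < \<tau>" "0 < \<sigma>"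
    and "\<Delta> > 0" "\<Delta> \<le> \<bar>minor i j (pw k p) (pw k q)\<bar>"
  shows "pairm L k \<tau> p \<sigma> q / (\<tau> * \<sigma>) \<le> (2 * L) ^ CARD('s) / \<Delta>"
proof -
  have "\<bar>minor i j ((1 / \<tau>) *\<^sub>R pw k p) ((1 / \<sigma>) *\<^sub>R pw k q)\<bar> * pairm L k \<tau> p \<sigma> q \<le> (2 * L) ^ CARD('s)"
    unfolding pairm_def slabk_def using assms by (intro measure_slab_Int_le) (auto simp: pw_def)
  then have *: "\<bar>minor i j (pw k p) (pw k q)\<bar> * (pairm L k \<tau> p \<sigma> q / (\<tau> * \<sigma>)) \<le> (2 * L) ^ CARD('s)"
    using assms(4,5) by (simp add: minor_scaleR abs_mult field_simps)
  have "\<Delta> * (pairm L k \<tau> p \<sigma> q / (\<tau> * \<sigma>)) \<le> (2 * L) ^ CARD('s)"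
    by (rule order.trans[OF mult_right_mono[OF assms(7)] *]) (use assms in simp)
  then show ?thesis using assms(6) by (simp add: pos_le_divide_eq mult.commute)
qed

text \<open>The ratio \<epsilon> weighs the effect of a unit shift, of order P^(2k-1), against the
  minor. \<open>slab_compare\<close> compares minor times volume at the cost (1 + \<epsilon>)^s, and
  one more factor 1 + \<epsilon> pays for the change of the minor. The quotients by \<tau> \<sigma>
  appear because minors of the rescaled vectors carry 1 / (\<tau> \<sigma>).\<close>

lemma pairm_compare:
  fixes p q p' q' :: "real ^ 's::finite"
  assumes L: "L \<ge> 1" and ij: "i \<noteq> j" and k: "k \<ge> 1" and P: "P \<ge> 1" and D0: "\<Delta> > 0"
    and p: "\<And>m. \<bar>p $ m\<bar> \<le> P" "\<And>m. \<bar>p' $ m\<bar> \<le> P" "\<And>m. \<bar>p $ m - p' $ m\<bar> \<le> 1" "p $ i \<noteq> 0" "p' $ i \<noteq> 0"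
    and q: "\<And>m. \<bar>q $ m\<bar> \<le> P" "\<And>m. \<bar>q' $ m\<bar> \<le> P" "\<And>m. \<bar>q $ m - q' $ m\<bar> \<le> 1"
    and D: "\<Delta> \<le> \<bar>minor i j (pw k p) (pw k q)\<bar>" "\<Delta> \<le> \<bar>minor i j (pw k p') (pw k q')\<bar>"
    and t: "0 < \<tau>" "\<tau> \<le> 1" "0 < \<sigma>" "\<sigma> \<le> 1" "0 < \<tau>'" "\<tau>' \<le> 1" "0 < \<sigma>'" "\<sigma>' \<le> 1"
    and e: "\<epsilon> = 4 * real CARD('s) * real k * P ^ (2 * k - 1) / \<Delta>"
  shows "pairm L k \<tau> p \<sigma> q / (\<tau> * \<sigma>) \<le> (1 + \<epsilon>) ^ (CARD('s) + 1) * (pairm L k \<tau>' p' \<sigma>' q' / (\<tau>' * \<sigma>'))"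
proof -
  let ?D = "minor i j (pw k p) (pw k q)" and ?D' = "minor i j (pw k p') (pw k q')"
  define u v u' v' where "u = (1 / \<tau>) *\<^sub>R pw k p" and "v = (1 / \<sigma>) *\<^sub>R pw k q"
    and "u' = (1 / \<tau>') *\<^sub>R pw k p'" and "v' = (1 / \<sigma>') *\<^sub>R pw k q'"
  note uv = u_def v_def u'_def v'_def
  have s1: "real CARD('s) \<ge> 1" by (simp add: Suc_leI)
  have e0: "\<epsilon> \<ge> 0" using P D0 by (simp add: e)
  have eD: "\<epsilon> * \<Delta> = 4 * real CARD('s) * real k * P ^ (2 * k - 1)" using D0 by (simp add: e)
  have P2: "P ^ (2 * k - 1) = P ^ k * P ^ (k - 1)" using k by (simp add: power_add[symmetric] mult_2)
  have mD': "\<bar>minor i j u' v'\<bar> = \<bar>?D'\<bar> / (\<tau>' * \<sigma>')"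
    using t by (simp add: uv minor_scaleR abs_mult)
  \<comment> \<open>Multiplication by \<theta>' makes the bound uniform in the tolerances. Changing
    the tolerance contributes (\<theta>' - \<theta>) w, at most 1, and moving r to r' contributes
    the rest; the factor 2 covers both, since the right side without it is at least 1.\<close>
  have dist: "\<bar>\<theta>' * (l \<bullet> ((1 / \<theta>) *\<^sub>R pw k r - (1 / \<theta>') *\<^sub>R pw k r'))\<bar> \<le> 2 * real CARD('s) * L * real k * P ^ (k - 1)"
    if r: "\<And>m. \<bar>r $ m\<bar> \<le> P" "\<And>m. \<bar>r' $ m\<bar> \<le> P" "\<And>m. \<bar>r $ m - r' $ m\<bar> \<le> 1"
      and th: "0 < \<theta>" "\<theta> \<le> 1" "0 < \<theta>'" "\<theta>' \<le> 1" and l: "l \<in> slab L ((1 / \<theta>) *\<^sub>R pw k r)"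
    for \<theta> \<theta>' r r' and l :: "real ^ 's"
  proof -
    define w where "w = l \<bullet> ((1 / \<theta>) *\<^sub>R pw k r)"
    have w: "\<bar>w\<bar> < 1" "l \<bullet> pw k r = \<theta> * w" using l th by (auto simp: slab_def w_def)
    have "\<bar>l \<bullet> (pw k r' - pw k r)\<bar> \<le> (\<Sum>m\<in>UNIV. \<bar>l $ m * (pw k r' $ m - pw k r $ m)\<bar>)"
      unfolding inner_vec_def by (rule order.trans[OF sum_abs]) simp
    also have "\<dots> \<le> (\<Sum>m\<in>(UNIV :: 's set). L * (real k * P ^ (k - 1)))"
      unfolding abs_mult using l r P L
      by (intro sum_mono mult_mono abs_pw_diff_le) (auto simp: slab_def abs_minus_commute)
    also have "\<dots> = real CARD('s) * L * real k * P ^ (k - 1)" by simp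
    finally have 1: "\<bar>l \<bullet> (pw k r' - pw k r)\<bar> \<le> real CARD('s) * L * real k * P ^ (k - 1)" .
    have "\<theta>' * (l \<bullet> ((1 / \<theta>) *\<^sub>R pw k r - (1 / \<theta>') *\<^sub>R pw k r')) = (\<theta>' - \<theta>) * w - l \<bullet> (pw k r' - pw k r)"
      using th w by (simp add: inner_diff_right field_simps)
    moreover have "\<bar>(\<theta>' - \<theta>) * w\<bar> \<le> 1 * 1"
      unfolding abs_mult using th w by (intro mult_mono) auto
    moreover have "1 * 1 * 1 * 1 \<le> real CARD('s) * L * real k * P ^ (k - 1)"
      using s1 L k P by (intro mult_mono) auto
    ultimately show ?thesis using 1 by linarith
  qed
  have main: "\<bar>minor i j u v\<bar> * pairm L k \<tau> p \<sigma> q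
      \<le> (1 + \<epsilon>) ^ CARD('s) * (\<bar>minor i j u' v'\<bar> * pairm L k \<tau>' p' \<sigma>' q')"
    unfolding pairm_def slabk_def uv[symmetric]
  proof (rule slab_compare[OF ij _ _ _ e0])
    show "u $ i \<noteq> 0" "u' $ i \<noteq> 0" using p t by (auto simp: uv pw_def)
    show "minor i j u' v' \<noteq> 0" using D D0 t mD' by auto
    fix l m assume l: "l \<in> slab L u \<inter> slab L v"
    have t': "\<tau>' * \<sigma>' > 0" using t by simp
    have "\<bar>v' $ m * (l \<bullet> (u - u')) - u' $ m * (l \<bullet> (v - v'))\<bar> * (\<tau>' * \<sigma>')
        = \<bar>pw k q' $ m * (\<tau>' * (l \<bullet> (u - u'))) - pw k p' $ m * (\<sigma>' * (l \<bullet> (v - v')))\<bar>"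
    proof -
      have "(v' $ m * (l \<bullet> (u - u')) - u' $ m * (l \<bullet> (v - v'))) * (\<tau>' * \<sigma>')
        = pw k q' $ m * (\<tau>' * (l \<bullet> (u - u'))) - pw k p' $ m * (\<sigma>' * (l \<bullet> (v - v')))"
        unfolding u'_def v'_def vector_scaleR_component using t by (simp add: field_simps)
      then show ?thesis using t' by (metis abs_mult abs_of_pos)
    qed
    also have "\<dots> \<le> \<bar>pw k q' $ m * (\<tau>' * (l \<bullet> (u - u')))\<bar> + \<bar>pw k p' $ m * (\<sigma>' * (l \<bullet> (v - v')))\<bar>"
      by (rule abs_triangle_ineq4)
    also have "\<dots> \<le> P ^ k * (2 * real CARD('s) * L * real k * P ^ (k - 1)) + P ^ k * (2 * real CARD('s) * L * real k * P ^ (k - 1))"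
      unfolding abs_mult[of "pw k q' $ m"] abs_mult[of "pw k p' $ m"] unfolding uv using l t P
      by (intro add_mono mult_mono abs_pw_nth_le dist p q) (auto simp: uv)
    also have "\<dots> = L * (\<epsilon> * \<Delta>)" unfolding eD P2 by (simp add: algebra_simps)
    also have "\<dots> = \<epsilon> * L * \<Delta>" by simp
    also have "\<dots> \<le> \<epsilon> * L * \<bar>?D'\<bar>" using e0 L D by (intro mult_left_mono) auto
    finally show "\<bar>v' $ m * (l \<bullet> (u - u')) - u' $ m * (l \<bullet> (v - v'))\<bar> \<le> \<epsilon> * L * \<bar>minor i j u' v'\<bar>"
      unfolding mD' using t' by (simp add: pos_le_divide_eq)
  qed
  have "\<bar>?D - ?D'\<bar> \<le> 4 * real k * P ^ (2 * k - 1)"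
    using P k by (intro abs_minor_diff_le p q) auto
  also have "\<dots> \<le> real CARD('s) * (4 * real k * P ^ (2 * k - 1))"
    using mult_right_mono[OF s1, of "4 * real k * P ^ (2 * k - 1)"] P by simp
  also have "\<dots> = \<epsilon> * \<Delta>" using eD by (simp add: algebra_simps)
  also have "\<dots> \<le> \<epsilon> * \<bar>?D\<bar>" using e0 D by (intro mult_left_mono)
  finally have D'D: "\<bar>?D'\<bar> \<le> (1 + \<epsilon>) * \<bar>?D\<bar>" by (simp add: algebra_simps)
  have m1: "\<bar>minor i j u v\<bar> = \<bar>?D\<bar> / (\<tau> * \<sigma>)" using t by (simp add: uv minor_scaleR abs_mult)
  have "\<bar>?D\<bar> * (pairm L k \<tau> p \<sigma> q / (\<tau> * \<sigma>)) \<le> (1 + \<epsilon>) ^ CARD('s) * (\<bar>?D'\<bar> * (pairm L k \<tau>' p' \<sigma>' q' / (\<tau>' * \<sigma>')))"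
    using main by (simp add: m1 mD')
  also have "\<dots> \<le> (1 + \<epsilon>) ^ CARD('s) * (((1 + \<epsilon>) * \<bar>?D\<bar>) * (pairm L k \<tau>' p' \<sigma>' q' / (\<tau>' * \<sigma>')))"
    using D'D e0 t by (intro mult_left_mono mult_right_mono) auto
  finally have "\<bar>?D\<bar> * (pairm L k \<tau> p \<sigma> q / (\<tau> * \<sigma>)) \<le> \<bar>?D\<bar> * ((1 + \<epsilon>) ^ (CARD('s) + 1) * (pairm L k \<tau>' p' \<sigma>' q' / (\<tau>' * \<sigma>')))"
    by (simp add: mult_ac)
  moreover have "\<bar>?D\<bar> > 0" using D D0 by linarith
  ultimately show ?thesis by (simp only: mult_le_cancel_left_pos)
qed

lemma power_one_plus_le:
  assumes "0 \<le> \<epsilon>" "\<epsilon> \<le> (1::real)"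
  shows "(1 + \<epsilon>) ^ d \<le> 1 + (2 ^ d - 1) * \<epsilon>"
proof (induction d)
  case (Suc d)
  have "(1 + \<epsilon>) ^ Suc d \<le> (1 + \<epsilon>) * (1 + (2 ^ d - 1) * \<epsilon>)"
    using Suc assms by (simp add: mult_left_mono)
  also have "\<dots> = 1 + \<epsilon> + (2 ^ d - 1) * \<epsilon> + ((2 ^ d - 1) * \<epsilon>) * \<epsilon>" by (simp add: algebra_simps)
  also have "((2 ^ d - 1) * \<epsilon>) * \<epsilon> \<le> ((2 ^ d - 1) * \<epsilon>) * 1"
    using assms by (intro mult_left_mono) auto
  finally show ?case by (simp add: algebra_simps)
qed simp

text \<open>\<open>pairm_compare\<close> is used in both directions, and its relative error
  \<epsilon> is multiplied by the size bound from \<open>pairm_le_minor\<close>.\<close>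

lemma pairm_compare_abs:
  fixes p q p' q' :: "real ^ 's::finite"
  assumes L: "L \<ge> 1" and ij: "i \<noteq> j" and k: "k \<ge> 1" and P: "P \<ge> 1" and D0: "\<Delta> > 0"
    and p: "\<And>m. \<bar>p $ m\<bar> \<le> P" "\<And>m. \<bar>p' $ m\<bar> \<le> P" "\<And>m. \<bar>p $ m - p' $ m\<bar> \<le> 1" "p $ i \<noteq> 0" "p' $ i \<noteq> 0"
    and q: "\<And>m. \<bar>q $ m\<bar> \<le> P" "\<And>m. \<bar>q' $ m\<bar> \<le> P" "\<And>m. \<bar>q $ m - q' $ m\<bar> \<le> 1"
    and D: "\<Delta> \<le> \<bar>minor i j (pw k p) (pw k q)\<bar>" "\<Delta> \<le> \<bar>minor i j (pw k p') (pw k q')\<bar>"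
    and t: "0 < \<tau>" "\<tau> \<le> 1" "0 < \<sigma>" "\<sigma> \<le> 1"
    and e: "\<epsilon> = 4 * real CARD('s) * real k * P ^ (2 * k - 1) / \<Delta>" "\<epsilon> \<le> 1"
  shows "\<bar>pairm L k \<tau> p \<sigma> q - \<tau> * \<sigma> * pairm L k 1 p' 1 q'\<bar> \<le> 2 ^ (CARD('s) + 1) * \<epsilon> * ((2 * L) ^ CARD('s) / \<Delta>)"
proof -
  define a b where "a = pairm L k \<tau> p \<sigma> q / (\<tau> * \<sigma>)" and "b = pairm L k 1 p' 1 q'"
  define d where "d = CARD('s) + 1"
  have e0: "\<epsilon> \<ge> 0" using P D0 by (simp add: e)
  have ab0: "a \<ge> 0" "b \<ge> 0" using t by (auto simp: a_def b_def)
  have a: "a \<le> (2 * L) ^ CARD('s) / \<Delta>" unfolding a_def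
    using t D D0 by (intro pairm_le_minor[OF L ij p(4)]) auto
  have b: "b \<le> (2 * L) ^ CARD('s) / \<Delta>" unfolding b_def
    using pairm_le_minor[OF L ij p(5) _ _ D0 D(2), of 1 1] by simp
  have dd: "(1 + \<epsilon>) ^ d \<le> 1 + (2 ^ d - 1) * \<epsilon>" by (rule power_one_plus_le[OF e0 e(2)])
  have "(2 ^ d - 1) * \<epsilon> \<le> 2 ^ d * \<epsilon>" using e0 by (intro mult_right_mono) auto
  then have dd: "(1 + \<epsilon>) ^ d \<le> 1 + 2 ^ d * \<epsilon>" using dd by linarith
  have "a \<le> (1 + \<epsilon>) ^ d * b"
    using pairm_compare[OF L ij k P D0 p q D t _ _ _ _ e(1), of 1 1] by (simp add: a_def b_def d_def)
  also have "\<dots> \<le> (1 + 2 ^ d * \<epsilon>) * b" using dd ab0 by (intro mult_right_mono)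
  finally have 1: "a - b \<le> 2 ^ d * \<epsilon> * b" by (simp add: algebra_simps)
  have "b \<le> (1 + \<epsilon>) ^ d * a"
    using pairm_compare[OF L ij k P D0 p(2,1) _ p(5,4) q(2,1) _ D(2,1) _ _ _ _ t e(1), of 1 1] p(3) q(3)
    by (simp add: a_def b_def d_def abs_minus_commute)
  also have "\<dots> \<le> (1 + 2 ^ d * \<epsilon>) * a" using dd ab0 by (intro mult_right_mono)
  finally have 2: "b - a \<le> 2 ^ d * \<epsilon> * a" by (simp add: algebra_simps)
  have "2 ^ d * \<epsilon> * a \<le> 2 ^ d * \<epsilon> * ((2 * L) ^ CARD('s) / \<Delta>)"
    "2 ^ d * \<epsilon> * b \<le> 2 ^ d * \<epsilon> * ((2 * L) ^ CARD('s) / \<Delta>)"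
    by (rule mult_left_mono[OF a] mult_left_mono[OF b], use e0 in simp)+
  with 1 2 have ab: "\<bar>a - b\<bar> \<le> 2 ^ d * \<epsilon> * ((2 * L) ^ CARD('s) / \<Delta>)" by linarith
  have "pairm L k \<tau> p \<sigma> q - \<tau> * \<sigma> * b = \<tau> * \<sigma> * (a - b)"
    using t by (simp add: a_def right_diff_distrib)
  then have "\<bar>pairm L k \<tau> p \<sigma> q - \<tau> * \<sigma> * b\<bar> = \<tau> * \<sigma> * \<bar>a - b\<bar>"
    using t by (simp add: abs_mult)
  also have "\<dots> \<le> 1 * 1 * \<bar>a - b\<bar>" using t by (intro mult_right_mono mult_mono) auto
  finally show ?thesis using ab by (simp add: b_def d_def)
qed

section \<open>Second moment over a cube\<close>

text \<open>A sum of truth values instead of a cardinality, so that moments over l expand term by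
  term.\<close>

definition cnt :: "nat \<Rightarrow> (int ^ 's) set \<Rightarrow> real ^ 's \<Rightarrow> real \<Rightarrow> real ^ 's::finite \<Rightarrow> real" where
  "cnt k X z \<tau> l = (\<Sum>x\<in>X. of_bool (\<bar>l \<bullet> pw k (shifted z x)\<bar> < \<tau>))"

lemma of_bool_eq_indicator:
  assumes "l \<in> cube L" "\<tau> > 0"
  shows "of_bool (\<bar>l \<bullet> pw k p\<bar> < \<tau>) = (indicator (slabk L k \<tau> p) l :: real)"
  using assms by (auto simp: indicator_def slabk_def slab_eq abs_mult pos_divide_less_eq)

lemma slabk_subset: "slabk L k \<tau> p \<subseteq> cube L"
  by (simp add: slabk_def slab_eq)

lemma integral_indicator_cube:
  assumes "A \<in> lmeasurable" "A \<subseteq> cube L"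
  shows "integrable (lebesgue_on (cube L)) (indicator A :: _ \<Rightarrow> real)"
    and "(\<integral>l. indicator A l \<partial>lebesgue_on (cube L)) = measure lebesgue A"
proof -
  have A: "A \<in> sets (lebesgue_on (cube L))"
    using assms by (auto simp: sets_restrict_space_iff fmeasurableD lmeasurable_cube[THEN fmeasurableD])
  interpret finite_measure "lebesgue_on (cube L)"
    by (rule finite_measure_lebesgue_on) simp
  show "integrable (lebesgue_on (cube L)) (indicator A :: _ \<Rightarrow> real)"
    by (rule integrable_real_indicator[OF A]) (simp add: emeasure_finite less_top[symmetric])
  show "(\<integral>l. indicator A l \<partial>lebesgue_on (cube L)) = measure lebesgue A"
    using assms A by (simp add: measure_restrict_space fmeasurableD Int_absorb2)
qed

lemma integral_cnt:
  assumes "\<tau> > 0"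
  shows "integrable (lebesgue_on (cube L)) (cnt k X z \<tau>)"
    and "(\<integral>l. cnt k X z \<tau> l \<partial>lebesgue_on (cube L)) = (\<Sum>x\<in>X. measure lebesgue (slabk L k \<tau> (shifted z x)))"
proof -
  have eq: "cnt k X z \<tau> l = (\<Sum>x\<in>X. indicator (slabk L k \<tau> (shifted z x)) l)" if "l \<in> cube L" for l
    unfolding cnt_def using of_bool_eq_indicator[OF that assms] by simp
  note ind = integral_indicator_cube[OF lmeasurable_slabk slabk_subset]
  show "integrable (lebesgue_on (cube L)) (cnt k X z \<tau>)"
    by (subst Bochner_Integration.integrable_cong[OF refl eq]) (auto intro!: Bochner_Integration.integrable_sum ind)
  show "(\<integral>l. cnt k X z \<tau> l \<partial>lebesgue_on (cube L)) = (\<Sum>x\<in>X. measure lebesgue (slabk L k \<tau> (shifted z x)))"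
    by (subst Bochner_Integration.integral_cong[OF refl eq]) (auto simp: Bochner_Integration.integral_sum ind simp del: Bochner_Integration.integral_indicator)
qed

lemma integral_cnt_mult:
  assumes "\<tau> > 0" "\<sigma> > 0"
  shows "integrable (lebesgue_on (cube L)) (\<lambda>l. cnt k X z \<tau> l * cnt k X z' \<sigma> l)"
    and "(\<integral>l. cnt k X z \<tau> l * cnt k X z' \<sigma> l \<partial>lebesgue_on (cube L))
      = (\<Sum>x\<in>X. \<Sum>y\<in>X. pairm L k \<tau> (shifted z x) \<sigma> (shifted z' y))"
proof -
  have eq: "cnt k X z \<tau> l * cnt k X z' \<sigma> l
      = (\<Sum>x\<in>X. \<Sum>y\<in>X. indicator (slabk L k \<tau> (shifted z x) \<inter> slabk L k \<sigma> (shifted z' y)) l)" if "l \<in> cube L" for l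
    unfolding cnt_def sum_product indicator_inter_arith using of_bool_eq_indicator[OF that] assms by simp
  note ind = integral_indicator_cube[OF fmeasurable.Int[OF lmeasurable_slabk lmeasurable_slabk] le_infI1[OF slabk_subset]]
  show "integrable (lebesgue_on (cube L)) (\<lambda>l. cnt k X z \<tau> l * cnt k X z' \<sigma> l)"
    by (subst Bochner_Integration.integrable_cong[OF refl eq]) (auto intro!: Bochner_Integration.integrable_sum ind)
  show "(\<integral>l. cnt k X z \<tau> l * cnt k X z' \<sigma> l \<partial>lebesgue_on (cube L))
      = (\<Sum>x\<in>X. \<Sum>y\<in>X. pairm L k \<tau> (shifted z x) \<sigma> (shifted z' y))"
    by (subst Bochner_Integration.integral_cong[OF refl eq])
      (auto simp: Bochner_Integration.integral_sum Bochner_Integration.integrable_sum ind pairm_def simp del: Bochner_Integration.integral_indicator)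
qed

text \<open>Expanding the square gives four pair sums. With b the volume at tolerances 1 and shift
  0, their main terms are \<tau>^2 b with signs +, -, -, + and cancel; the last sum is exact and the
  other three deviate by at most E, hence the 3.\<close>

lemma second_moment_le:
  fixes z :: "real ^ 's::finite"
  assumes t: "0 < \<tau>" "\<tau> \<le> 1"
    and E: "\<And>x y z' \<sigma> z'' \<sigma>'. x \<in> X \<Longrightarrow> y \<in> X \<Longrightarrow> (z', \<sigma>) \<in> {(z, \<tau>), (0, 1)} \<Longrightarrow> (z'', \<sigma>') \<in> {(z, \<tau>), (0, 1)} \<Longrightarrow>
      \<bar>pairm L k \<sigma> (shifted z' x) \<sigma>' (shifted z'' y) - \<sigma> * \<sigma>' * pairm L k 1 (shifted 0 x) 1 (shifted 0 y)\<bar> \<le> E x y"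
  shows "integrable (lebesgue_on (cube L)) (\<lambda>l. (cnt k X z \<tau> l - \<tau> * cnt k X 0 1 l)\<^sup>2)"
    and "(\<integral>l. (cnt k X z \<tau> l - \<tau> * cnt k X 0 1 l)\<^sup>2 \<partial>lebesgue_on (cube L)) \<le> 3 * (\<Sum>x\<in>X. \<Sum>y\<in>X. E x y)"
proof -
  let ?M = "lebesgue_on (cube L) :: (real ^ 's) measure"
  let ?F = "cnt k X z \<tau>" and ?G = "cnt k X 0 1"
  note int = integral_cnt_mult[where L = L and k = k and X = X]
  have eq: "(?F l - \<tau> * ?G l)\<^sup>2 = ?F l * ?F l - \<tau> * (?F l * ?G l) - \<tau> * (?G l * ?F l) + \<tau>\<^sup>2 * (?G l * ?G l)" for l
    by (simp add: power2_eq_square algebra_simps)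
  show "integrable ?M (\<lambda>l. (?F l - \<tau> * ?G l)\<^sup>2)"
    unfolding eq using t by (intro Bochner_Integration.integrable_add Bochner_Integration.integrable_diff
        integrable_mult_right int) auto
  let ?K = "\<lambda>\<sigma> z' \<sigma>' z'' x y. pairm L k \<sigma> (shifted z' x) \<sigma>' (shifted z'' y)"
  have "(\<integral>l. (?F l - \<tau> * ?G l)\<^sup>2 \<partial>?M)
      = (\<integral>l. ?F l * ?F l \<partial>?M) - \<tau> * (\<integral>l. ?F l * ?G l \<partial>?M) - \<tau> * (\<integral>l. ?G l * ?F l \<partial>?M) + \<tau>\<^sup>2 * (\<integral>l. ?G l * ?G l \<partial>?M)"
    unfolding eq using t int(1)[of \<tau> \<tau> z z] int(1)[of \<tau> 1 z 0] int(1)[of 1 \<tau> 0 z] int(1)[of 1 1 0 0] by simp (simp add: mult.commute)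
  also have "\<dots> = (\<Sum>x\<in>X. \<Sum>y\<in>X. ?K \<tau> z \<tau> z x y - \<tau> * ?K \<tau> z 1 0 x y - \<tau> * ?K 1 0 \<tau> z x y + \<tau>\<^sup>2 * ?K 1 0 1 0 x y)"
    using t by (simp add: int(2) sum.distrib sum_subtractf sum_distrib_left)
  also have "\<dots> \<le> (\<Sum>x\<in>X. \<Sum>y\<in>X. 3 * E x y)"
  proof (intro sum_mono)
    fix x y assume xy: "x \<in> X" "y \<in> X"
    let ?b = "?K 1 0 1 0 x y"
    have 1: "\<bar>?K \<tau> z \<tau> z x y - \<tau> * \<tau> * ?b\<bar> \<le> E x y" "\<bar>?K \<tau> z 1 0 x y - \<tau> * ?b\<bar> \<le> E x y"
      "\<bar>?K 1 0 \<tau> z x y - \<tau> * ?b\<bar> \<le> E x y"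
      using E[OF xy, of z \<tau> z \<tau>] E[OF xy, of z \<tau> 0 1] E[OF xy, of 0 1 z \<tau>] by simp_all
    have "\<tau> * \<bar>c\<bar> \<le> e" if "\<bar>c\<bar> \<le> e" for c e
      using that t by (meson abs_ge_zero mult_left_le_one_le order.trans less_imp_le)
    from this[OF 1(2)] this[OF 1(3)]
    have "\<bar>\<tau> * (?K \<tau> z 1 0 x y - \<tau> * ?b)\<bar> \<le> E x y" "\<bar>\<tau> * (?K 1 0 \<tau> z x y - \<tau> * ?b)\<bar> \<le> E x y"
      using t by (simp_all add: abs_mult)
    then show "?K \<tau> z \<tau> z x y - \<tau> * ?K \<tau> z 1 0 x y - \<tau> * ?K 1 0 \<tau> z x y + \<tau>\<^sup>2 * ?b \<le> 3 * E x y"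
      using 1(1) unfolding right_diff_distrib power2_eq_square mult.assoc[symmetric] by linarith
  qed
  also have "\<dots> = 3 * (\<Sum>x\<in>X. \<Sum>y\<in>X. E x y)" by (simp add: sum_distrib_left)
  finally show "(\<integral>l. (?F l - \<tau> * ?G l)\<^sup>2 \<partial>?M) \<le> 3 * (\<Sum>x\<in>X. \<Sum>y\<in>X. E x y)" .
qed

text \<open>For \<open>P = n\<^bsup>100k\<^esup>\<close> the minors are cut at \<open>P\<^bsup>2k\<^esup> / n\<^bsup>40k\<^esup>\<close> and \<open>P\<^bsup>2k\<^esup> / n\<^bsup>70k\<^esup>\<close>, and the
  coordinates at \<open>P / n\<^sup>5\<close>. A single cut would not do when \<open>s = 2k + 1\<close>: the comparison needs minors above
  \<open>P\<^bsup>2k - 1/2\<^esup>\<close>, the count of the remaining pairs needs them below it.\<close>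

lemma exponent_bounds:
  fixes k s :: nat
  assumes "k \<ge> 2" "s > 2 * k"
  shows "100 * k * (2 * s) + 100 * k * (2 * k - 1) + 10 \<le> 100 * k * (2 * s - 2 * k) + 2 * (k * (200 * k - 40))"
    and "100 * k * (s + 1) + 70 * k * (s - 1) + 10 \<le> 100 * k * (2 * s - 2 * k) + k * (200 * k - 70)"
    and "100 * k * (s + 1) + 40 * k * (s - 1) + 10 \<le> 100 * k * (2 * s - 2 * k) + (100 * k - 5) * k"
    and "k * (200 * k - 40) \<le> 70 * k + (100 * k - 5) * (2 * k - 1)"
    and "k * (200 * k - 70) \<le> 40 * k + (100 * k - 5) * (2 * k - 1)"
    and "1 + 100 * k * (2 * k - 1) \<le> k * (200 * k - 70)"
    and "k * (200 * k - 70) \<le> k * (200 * k - 40)"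
proof -
  obtain j where j: "k = 2 + j" using assms(1) le_Suc_ex by blast
  obtain r where r: "s = 2 * k + 1 + r" using assms(2) less_iff_Suc_add by auto
  have e: "2 * k - 1 = 2 * j + 3" "200 * k - 40 = 200 * j + 360" "200 * k - 70 = 200 * j + 330"
    "100 * k - 5 = 100 * j + 195" "s - 1 = 2 * j + 4 + r" "2 * s - 2 * k = 2 * j + 6 + 2 * r" "s = 2 * j + 5 + r"
    by (simp_all add: j r)
  show "100 * k * (2 * s) + 100 * k * (2 * k - 1) + 10 \<le> 100 * k * (2 * s - 2 * k) + 2 * (k * (200 * k - 40))"
    and "100 * k * (s + 1) + 70 * k * (s - 1) + 10 \<le> 100 * k * (2 * s - 2 * k) + k * (200 * k - 70)"
    and "100 * k * (s + 1) + 40 * k * (s - 1) + 10 \<le> 100 * k * (2 * s - 2 * k) + (100 * k - 5) * k"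
    and "k * (200 * k - 40) \<le> 70 * k + (100 * k - 5) * (2 * k - 1)"
    and "k * (200 * k - 70) \<le> 40 * k + (100 * k - 5) * (2 * k - 1)"
    and "1 + 100 * k * (2 * k - 1) \<le> k * (200 * k - 70)"
    and "k * (200 * k - 70) \<le> k * (200 * k - 40)"
    unfolding e unfolding e(7) j by (simp_all add: algebra_simps)
qed

text \<open>The three terms of the bound belong to three kinds of pairs, sorted by the largest minor
  with column i: above \<Delta>1 volumes are compared, between \<Delta>2 and \<Delta>1 each
  normalized volume is of order at most 1 / \<Delta>2, and below \<Delta>2 the volume of one slab,
  of order Q^-k, must do. The last two kinds are few by \<open>card_near_parallel_le\<close>; for
  the first all pairs are counted.\<close>

lemma good_second_moment_gen:
  fixes z :: "real ^ 's::finite"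
  assumes L: "L \<ge> 1" and k: "k \<ge> 1" and P: "P \<ge> 1" and Q: "Q \<ge> 1"
    and z: "\<And>m. 0 \<le> z $ m \<and> z $ m \<le> 1" and t: "0 < \<tau>" "\<tau> \<le> 1"
    and D12: "\<Delta>2 \<le> \<Delta>1" and D2: "8 * real CARD('s) * real k * real P ^ (2 * k - 1) \<le> \<Delta>2"
    and h: "h1 \<ge> 1" "h2 \<ge> 1" "\<Delta>1 \<le> h1 * Q ^ (2 * k - 1)" "\<Delta>2 \<le> h2 * Q ^ (2 * k - 1)"
  defines "X \<equiv> goodvecs P (Q + 1) :: (int ^ 's) set"
  shows "integrable (lebesgue_on (cube L)) (\<lambda>l. (cnt k X z \<tau> l - \<tau> * cnt k X 0 1 l)\<^sup>2)"
    and "(\<integral>l. (cnt k X z \<tau> l - \<tau> * cnt k X 0 1 l)\<^sup>2 \<partial>lebesgue_on (cube L))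
      \<le> 3 * (2 * L) ^ CARD('s) *
        (32 * real CARD('s) * real k * 2 ^ CARD('s) * (2 * real P) ^ (2 * CARD('s)) * real P ^ (2 * k - 1) / (\<Delta>1 * \<Delta>1)
          + 2 * (2 * real P) ^ (CARD('s) + 1) * (6 * h1) ^ (CARD('s) - 1) / \<Delta>2
          + (2 * real P) ^ (CARD('s) + 1) * (6 * h2) ^ (CARD('s) - 1) / Q ^ k)"
proof -
  obtain i :: 's where True by simp
  define mi where "mi x y j = minor i j (pw k (shifted 0 x)) (pw k (shifted 0 y))" for x y :: "int ^ 's" and j
  define Bad where "Bad \<Delta> = {(x, y) \<in> X \<times> X. \<forall>j. j \<noteq> i \<longrightarrow> \<bar>mi x y j\<bar> \<le> \<Delta>}" for \<Delta>
  define \<epsilon> where "\<epsilon> = 4 * real CARD('s) * real k * real P ^ (2 * k - 1) / (\<Delta>1 / 2)"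
  define EA where "EA = 2 ^ (CARD('s) + 1) * \<epsilon> * ((2 * L) ^ CARD('s) / (\<Delta>1 / 2))"
  define EB where "EB = (2 * L) ^ CARD('s) / (\<Delta>2 / 2)"
  define EC where "EC = (2 * L) ^ CARD('s) / Q ^ k"
  define E where "E x y = EA + of_bool ((x, y) \<in> Bad \<Delta>1) * EB + of_bool ((x, y) \<in> Bad \<Delta>2) * EC" for x y
  have s1: "real CARD('s) \<ge> 1" by (simp add: Suc_leI)
  have "1 * 1 * 1 \<le> real CARD('s) * real k * real P ^ (2 * k - 1)"
    using s1 k P by (intro mult_mono) auto
  then have D2': "\<Delta>2 > 0" using D2 by linarith
  then have D1': "\<Delta>1 > 0" using D12 by linarith
  have e1: "\<epsilon> \<le> 1" using D2 D12 D1' by (simp add: \<epsilon>_def pos_divide_le_eq)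
  have e0: "\<epsilon> \<ge> 0" using D1' by (simp add: \<epsilon>_def)
  have nn: "EA \<ge> 0" "EB \<ge> 0" "EC \<ge> 0" using e0 L Q D1' D2' by (simp_all add: EA_def EB_def EC_def)
  have "1 * (real k * real P ^ (2 * k - 1)) \<le> real CARD('s) * (real k * real P ^ (2 * k - 1))"
    using s1 by (intro mult_right_mono) auto
  then have kD: "4 * real k * real P ^ (2 * k - 1) \<le> \<Delta>2 / 2" using D2 by linarith
  \<comment> \<open>The excess 1 in \<open>Q + 1\<close> and the open right end of
    \<open>interv\<close> absorb the shift.\<close>
  have pt: "\<bar>shifted z' x $ m\<bar> \<le> real P" "\<bar>shifted z' x $ m\<bar> \<ge> Q" "\<bar>shifted z' x $ m - shifted 0 x $ m\<bar> \<le> 1"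
    if "x \<in> X" "z' \<in> {z, 0}" for x z' m
  proof -
    have x: "- real P \<le> real_of_int (x $ m)" "real_of_int (x $ m) + 1 \<le> real P" "Q + 1 \<le> \<bar>real_of_int (x $ m)\<bar>"
      using that(1) by (auto simp: X_def goodvecs_def vecs_def interv_def) (smt (verit) of_int_less_iff of_int_minus of_int_of_nat_eq of_int_le_iff int_le_real_less)+
    have "0 \<le> z' $ m" "z' $ m \<le> 1" using that(2) z[of m] by auto
    with x show "\<bar>shifted z' x $ m\<bar> \<le> real P" "\<bar>shifted z' x $ m\<bar> \<ge> Q" "\<bar>shifted z' x $ m - shifted 0 x $ m\<bar> \<le> 1"
      by (auto simp: shifted_def)
  qed
  have main: "\<bar>pairm L k \<sigma> (shifted z' x) \<sigma>' (shifted z'' y) - \<sigma> * \<sigma>' * pairm L k 1 (shifted 0 x) 1 (shifted 0 y)\<bar> \<le> E x y"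
    if xy: "x \<in> X" "y \<in> X" and zz: "(z', \<sigma>) \<in> {(z, \<tau>), (0, 1)}" "(z'', \<sigma>') \<in> {(z, \<tau>), (0, 1)}" for x y z' \<sigma> z'' \<sigma>'
  proof -
    define p q p' q' where "p = shifted z' x" and "q = shifted z'' y" and "p' = shifted 0 x" and "q' = shifted 0 y"
    have z': "z' \<in> {z, 0}" "z'' \<in> {z, 0}" and t': "0 < \<sigma>" "\<sigma> \<le> 1" "0 < \<sigma>'" "\<sigma>' \<le> 1" using zz t by auto
    have pq: "\<bar>p $ m\<bar> \<le> real P" "\<bar>p' $ m\<bar> \<le> real P" "\<bar>q $ m\<bar> \<le> real P" "\<bar>q' $ m\<bar> \<le> real P"
      "\<bar>p $ m - p' $ m\<bar> \<le> 1" "\<bar>q $ m - q' $ m\<bar> \<le> 1" "\<bar>p $ m\<bar> \<ge> Q" "\<bar>p' $ m\<bar> \<ge> Q" for m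
      using pt[OF xy(1) z'(1)] pt[OF xy(1), of 0] pt[OF xy(2) z'(2)] pt[OF xy(2), of 0]
      by (simp_all add: p_def q_def p'_def q'_def)
    have pne: "p $ i \<noteq> 0" "p' $ i \<noteq> 0" using pq(7)[of i] pq(8)[of i] Q by auto
    \<comment> \<open>Pairs are sorted by their unshifted points. A unit shift changes a minor by at
      most \<Delta>2 / 2, so a minor above either threshold stays above half of it.\<close>
    have min: "\<bar>minor i j (pw k p) (pw k q)\<bar> \<ge> \<bar>mi x y j\<bar> - \<Delta>2 / 2" for j
    proof -
      have "\<bar>minor i j (pw k p) (pw k q) - minor i j (pw k p') (pw k q')\<bar> \<le> 4 * real k * real P ^ (2 * k - 1)"
        using k by (intro abs_minor_diff_le pq) auto
      then show ?thesis using kD by (simp add: mi_def p'_def[symmetric] q'_def[symmetric])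
    qed
    have diff: "\<bar>pairm L k \<sigma> p \<sigma>' q - \<sigma> * \<sigma>' * pairm L k 1 p' 1 q'\<bar> \<le> B"
      if "pairm L k \<sigma> p \<sigma>' q \<le> B" "pairm L k 1 p' 1 q' \<le> B" for B
    proof -
      have "\<sigma> * \<sigma>' * pairm L k 1 p' 1 q' \<le> 1 * 1 * pairm L k 1 p' 1 q'"
        using t' by (intro mult_right_mono mult_mono) auto
      moreover have "0 \<le> \<sigma> * \<sigma>' * pairm L k 1 p' 1 q'" using t' by simp
      moreover have "0 \<le> pairm L k \<sigma> p \<sigma>' q" by simp
      ultimately show ?thesis using that by linarith
    qed
    consider (A) j where "j \<noteq> i" "\<bar>mi x y j\<bar> > \<Delta>1"
      | (B) j where "j \<noteq> i" "\<bar>mi x y j\<bar> > \<Delta>2" "(x, y) \<in> Bad \<Delta>1"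
      | (C) "(x, y) \<in> Bad \<Delta>2"
      using xy by (fastforce simp: Bad_def not_le)
    then have "\<bar>pairm L k \<sigma> p \<sigma>' q - \<sigma> * \<sigma>' * pairm L k 1 p' 1 q'\<bar> \<le> E x y"
    proof cases
      case A
      have "\<bar>pairm L k \<sigma> p \<sigma>' q - \<sigma> * \<sigma>' * pairm L k 1 p' 1 q'\<bar> \<le> EA"
        unfolding EA_def
      proof (rule pairm_compare_abs[OF L A(1)[symmetric] k _ _ pq(1,2,5) pne pq(3,4,6) _ _ t' \<epsilon>_def e1])
        show "\<Delta>1 / 2 \<le> \<bar>minor i j (pw k p) (pw k q)\<bar>" using min[of j] A(2) D12 by linarith
        show "\<Delta>1 / 2 \<le> \<bar>minor i j (pw k p') (pw k q')\<bar>" using A(2) D1' by (simp add: mi_def p'_def q'_def)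
      qed (use P D1' in auto)
      then show ?thesis using nn unfolding E_def by (auto simp: of_bool_def)
    next
      case B
      have "pairm L k \<sigma> p \<sigma>' q / (\<sigma> * \<sigma>') \<le> EB" unfolding EB_def
        using min[of j] B(2) D2' t' by (intro pairm_le_minor[OF L B(1)[symmetric] pne(1)]) auto
      then have "pairm L k \<sigma> p \<sigma>' q \<le> EB * (\<sigma> * \<sigma>')" using t' by (simp add: pos_divide_le_eq)
      also have "\<dots> \<le> EB * (1 * 1)" using t' nn by (intro mult_left_mono mult_mono) auto
      finally have 1: "pairm L k \<sigma> p \<sigma>' q \<le> EB" by simp
      have "pairm L k 1 p' 1 q' / (1 * 1) \<le> EB" unfolding EB_def
        using B(2) D2' by (intro pairm_le_minor[OF L B(1)[symmetric] pne(2)]) (auto simp: mi_def p'_def q'_def)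
      then have "\<bar>pairm L k \<sigma> p \<sigma>' q - \<sigma> * \<sigma>' * pairm L k 1 p' 1 q'\<bar> \<le> EB" using 1 by (intro diff) auto
      then show ?thesis using nn B(3) unfolding E_def by (auto simp: of_bool_def)
    next
      case C
      have *: "pairm L k \<theta> r \<theta>' r' \<le> EC" if "\<bar>r $ i\<bar> \<ge> Q" "0 < \<theta>" "\<theta> \<le> 1" for r r' :: "real ^ 's" and \<theta> \<theta>'
      proof -
        have "Q ^ k * pairm L k \<theta> r \<theta>' r' \<le> \<bar>r $ i\<bar> ^ k * measure lebesgue (slabk L k \<theta> r)"
          unfolding pairm_def using that Q
          by (intro mult_mono power_mono measure_mono_fmeasurable sets.Int fmeasurableD lmeasurable_slabk) auto
        also have "\<dots> \<le> \<theta> * (2 * L) ^ CARD('s)" by (rule measure_slabk_le) (use L that in auto)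
        also have "\<dots> \<le> 1 * (2 * L) ^ CARD('s)" using that L by (intro mult_right_mono) auto
        finally show ?thesis using Q by (simp add: EC_def pos_le_divide_eq mult.commute)
      qed
      have "\<bar>pairm L k \<sigma> p \<sigma>' q - \<sigma> * \<sigma>' * pairm L k 1 p' 1 q'\<bar> \<le> EC"
        using t' by (intro diff * pq) auto
      then show ?thesis using nn C unfolding E_def by (auto simp: of_bool_def)
    qed
    then show ?thesis by (simp add: p_def q_def p'_def q'_def)
  qed
  show "integrable (lebesgue_on (cube L)) (\<lambda>l. (cnt k X z \<tau> l - \<tau> * cnt k X 0 1 l)\<^sup>2)"
    by (rule second_moment_le(1)[OF t main])
  have finX: "finite X" by (simp add: X_def)
  have "(\<integral>l. (cnt k X z \<tau> l - \<tau> * cnt k X 0 1 l)\<^sup>2 \<partial>lebesgue_on (cube L)) \<le> 3 * (\<Sum>x\<in>X. \<Sum>y\<in>X. E x y)"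
    by (rule second_moment_le(2)[OF t main])
  also have "(\<Sum>x\<in>X. \<Sum>y\<in>X. E x y) = real (card (X \<times> X)) * EA + real (card (Bad \<Delta>1)) * EB + real (card (Bad \<Delta>2)) * EC"
  proof -
    have c: "(\<Sum>p\<in>X \<times> X. of_bool (p \<in> Bad \<Delta>) * e) = real (card (Bad \<Delta>)) * e" for \<Delta> e :: real
    proof -
      have "X \<times> X \<inter> Bad \<Delta> = Bad \<Delta>" by (auto simp: Bad_def)
      then show ?thesis using finX by (simp add: of_bool_def sum_distrib_right[symmetric] sum.If_cases Int_def[symmetric] Collect_mem_eq)
    qed
    have "(\<Sum>x\<in>X. \<Sum>y\<in>X. E x y) = (\<Sum>p\<in>X \<times> X. EA + of_bool (p \<in> Bad \<Delta>1) * EB + of_bool (p \<in> Bad \<Delta>2) * EC)"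
      by (simp add: sum.cartesian_product E_def split_beta')
    then show ?thesis by (simp add: sum.distrib c del: card_cartesian_product)
  qed
  also have "\<dots> \<le> (2 * real P) ^ (2 * CARD('s)) * EA
      + (2 * real P) ^ (CARD('s) + 1) * (6 * h1) ^ (CARD('s) - 1) * EB
      + (2 * real P) ^ (CARD('s) + 1) * (6 * h2) ^ (CARD('s) - 1) * EC"
  proof (intro add_mono mult_right_mono nn)
    have "real (card X) \<le> real ((2 * P) ^ CARD('s))" unfolding X_def by (intro of_nat_mono card_goodvecs_le)
    then have "real (card X) * real (card X) \<le> (2 * real P) ^ CARD('s) * (2 * real P) ^ CARD('s)"
      by (intro mult_mono) auto
    then show "real (card (X \<times> X)) \<le> (2 * real P) ^ (2 * CARD('s))"
      unfolding card_cartesian_product of_nat_mult mult_2[of "CARD('s)"] power_add .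
    have Qp: "Q ^ (2 * k - 1) \<le> (Q + 1) ^ (2 * k - 1)" using Q by (intro power_mono) auto
    have "\<Delta>1 \<le> h1 * (Q + 1) ^ (2 * k - 1)"
      by (rule order.trans[OF h(3) mult_left_mono[OF Qp]]) (use h in simp)
    then show "real (card (Bad \<Delta>1)) \<le> (2 * real P) ^ (CARD('s) + 1) * (6 * h1) ^ (CARD('s) - 1)"
      unfolding Bad_def X_def mi_def using Q k h by (intro card_near_parallel_le) auto
    have "\<Delta>2 \<le> h2 * (Q + 1) ^ (2 * k - 1)"
      by (rule order.trans[OF h(4) mult_left_mono[OF Qp]]) (use h in simp)
    then show "real (card (Bad \<Delta>2)) \<le> (2 * real P) ^ (CARD('s) + 1) * (6 * h2) ^ (CARD('s) - 1)"
      unfolding Bad_def X_def mi_def using Q k h by (intro card_near_parallel_le) auto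
  qed
  also have "3 * \<dots> = 3 * (2 * L) ^ CARD('s) *
        (32 * real CARD('s) * real k * 2 ^ CARD('s) * (2 * real P) ^ (2 * CARD('s)) * real P ^ (2 * k - 1) / (\<Delta>1 * \<Delta>1)
          + 2 * (2 * real P) ^ (CARD('s) + 1) * (6 * h1) ^ (CARD('s) - 1) / \<Delta>2
          + (2 * real P) ^ (CARD('s) + 1) * (6 * h2) ^ (CARD('s) - 1) / Q ^ k)"
  proof -
    have 1: "A * (2 ^ (CARD('s) + 1) * (4 * c * d * p / (D / 2)) * (W / (D / 2))) = W * (32 * c * d * 2 ^ CARD('s) * A * p / (D * D))"
      for A c d p D W :: real by simp
    have 2: "A * B * (W / (D / 2)) = W * (2 * A * B / D)" "A * B * (W / D) = W * (A * B / D)" for A B W D :: real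
      by simp_all
    note e = 1[of "(2 * real P) ^ (2 * CARD('s))" "real CARD('s)" "real k" "real P ^ (2 * k - 1)" \<Delta>1 "(2 * L) ^ CARD('s)",
        folded \<epsilon>_def, folded EA_def]
      2(1)[of "(2 * real P) ^ (CARD('s) + 1)" "(6 * h1) ^ (CARD('s) - 1)" "(2 * L) ^ CARD('s)" \<Delta>2, folded EB_def]
      2(2)[of "(2 * real P) ^ (CARD('s) + 1)" "(6 * h2) ^ (CARD('s) - 1)" "(2 * L) ^ CARD('s)" "Q ^ k", folded EC_def]
    show ?thesis
      unfolding e distrib_left[symmetric] by (simp only: mult.assoc)
  qed
  finally show "(\<integral>l. (cnt k X z \<tau> l - \<tau> * cnt k X 0 1 l)\<^sup>2 \<partial>lebesgue_on (cube L))
      \<le> 3 * (2 * L) ^ CARD('s) *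
        (32 * real CARD('s) * real k * 2 ^ CARD('s) * (2 * real P) ^ (2 * CARD('s)) * real P ^ (2 * k - 1) / (\<Delta>1 * \<Delta>1)
          + 2 * (2 * real P) ^ (CARD('s) + 1) * (6 * h1) ^ (CARD('s) - 1) / \<Delta>2
          + (2 * real P) ^ (CARD('s) + 1) * (6 * h2) ^ (CARD('s) - 1) / Q ^ k)" by simp
qed

section \<open>The mean deviation\<close>

lemma power_frac_le:
  fixes x :: real
  assumes "x \<ge> 1" "a + d \<le> c + b"
  shows "x ^ a / x ^ b \<le> x ^ c / x ^ d"
proof -
  have "x ^ a * x ^ d \<le> x ^ c * x ^ b"
    unfolding power_add[symmetric] using assms by (intro power_increasing)
  then show ?thesis using assms by (simp add: divide_simps)
qed

lemma sum_UN_le: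
  fixes f :: "'a \<Rightarrow> real"
  assumes "finite I" "\<And>i. i \<in> I \<Longrightarrow> finite (A i)" "\<And>x. 0 \<le> f x"
  shows "sum f (\<Union>i\<in>I. A i) \<le> (\<Sum>i\<in>I. sum f (A i))"
  using assms
proof (induction I rule: finite_induct)
  case (insert i I)
  have "sum f (A i \<union> (\<Union>i\<in>I. A i)) \<le> sum f (A i) + sum f (\<Union>i\<in>I. A i)"
    using insert by (intro sum_Un_le) auto
  then show ?case using insert by fastforce
qed simp

lemma good_mean_deviation:
  assumes L: "L \<ge> 1" and k: "k \<ge> 2" and s: "CARD('s::finite) > 2 * k"
  shows "\<exists>C\<ge>0. \<forall>n (z :: real ^ 's) \<tau>. n \<ge> 8 * CARD('s) * k \<longrightarrow> (\<forall>m. 0 \<le> z $ m \<and> z $ m \<le> 1) \<longrightarrow> 0 < \<tau> \<longrightarrow> \<tau> \<le> 1 \<longrightarrow>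
    (\<integral>l. \<bar>cnt k (goodvecs (n ^ (100 * k)) (real n ^ (100 * k - 5) + 1)) z \<tau> l
        - \<tau> * cnt k (goodvecs (n ^ (100 * k)) (real n ^ (100 * k - 5) + 1)) 0 1 l\<bar> \<partial>lebesgue_on (cube L))
      \<le> C * real n ^ (100 * k * (CARD('s) - k)) / real n ^ 5"
proof -
  let ?s = "CARD('s)"
  define CA where "CA = 32 * real ?s * real k * 2 ^ ?s * 2 ^ (2 * ?s)"
  define CB :: real where "CB = 2 * 2 ^ (?s + 1) * 6 ^ (?s - 1)"
  define CC :: real where "CC = 2 ^ (?s + 1) * 6 ^ (?s - 1)"
  define C2 where "C2 = 3 * (2 * L) ^ ?s * (CA + CB + CC)"
  have C0: "CA \<ge> 0" "CB \<ge> 0" "CC \<ge> 0" by (simp_all add: CA_def CB_def CC_def)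
  then have C20: "C2 \<ge> 0" using L by (simp add: C2_def)
  define C where "C = C2 + (2 * L) ^ ?s"
  have "(\<integral>l. \<bar>cnt k (goodvecs (n ^ (100 * k)) (real n ^ (100 * k - 5) + 1)) z \<tau> l
        - \<tau> * cnt k (goodvecs (n ^ (100 * k)) (real n ^ (100 * k - 5) + 1)) 0 1 l\<bar> \<partial>lebesgue_on (cube L))
      \<le> C * real n ^ (100 * k * (?s - k)) / real n ^ 5"
    if n: "n \<ge> 8 * ?s * k" and z: "\<And>m. 0 \<le> z $ m \<and> z $ m \<le> 1" and t: "0 < \<tau>" "\<tau> \<le> 1" for n \<tau> and z :: "real ^ 's"
  proof -
    define x where "x = real n"
    have "8 * ?s * k \<ge> 1" using k s by (simp add: Suc_leI)
    then have n1: "n \<ge> 1" using n by linarith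
    then have x1: "x \<ge> 1" by (simp add: x_def)
    define P where "P = n ^ (100 * k)"
    define Q where "Q = x ^ (100 * k - 5)"
    define D1 where "D1 = x ^ (k * (200 * k - 40))"
    define D2 where "D2 = x ^ (k * (200 * k - 70))"
    \<comment> \<open>Slightly more than \<open>D1\<close> and \<open>D2\<close> divided by
      Q^(2k-1), which are n^(70k - 5) and n^(40k - 5).\<close>
    define h1 where "h1 = x ^ (70 * k)"
    define h2 where "h2 = x ^ (40 * k)"
    have rP: "real P = x ^ (100 * k)" by (simp add: P_def x_def)
    note ex = exponent_bounds[OF k s]
    define X where "X = (goodvecs P (Q + 1) :: (int ^ 's) set)"
    define f where "f l = cnt k X z \<tau> l - \<tau> * cnt k X 0 1 l" for l
    have c1: "k \<ge> 1" "P \<ge> 1" "Q \<ge> 1" "h1 \<ge> 1" "h2 \<ge> 1" "D2 \<le> D1"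
      using k n1 x1 ex(7) unfolding P_def Q_def h1_def h2_def D1_def D2_def
      by (auto intro: power_increasing)
    have c2: "D1 \<le> h1 * Q ^ (2 * k - 1)" "D2 \<le> h2 * Q ^ (2 * k - 1)"
      unfolding D1_def D2_def h1_def h2_def Q_def power_mult[symmetric] power_add[symmetric]
      using ex(4,5) x1 by (auto intro: power_increasing)
    have "8 * real ?s * real k \<le> x" using of_nat_mono[OF n, where 'a = real] by (simp add: x_def)
    then have "8 * real ?s * real k * real P ^ (2 * k - 1) \<le> x * real P ^ (2 * k - 1)"
      by (intro mult_right_mono) auto
    also have "\<dots> = x ^ (1 + 100 * k * (2 * k - 1))" by (simp add: rP power_mult[symmetric])
    also have "\<dots> \<le> D2" unfolding D2_def using x1 ex(6) by (intro power_increasing)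
    finally have c3: "8 * real ?s * real k * real P ^ (2 * k - 1) \<le> D2" .
    note gs = good_second_moment_gen[OF L c1(1,2,3) z t c1(6) c3 c1(4,5) c2, folded X_def, folded f_def]
    \<comment> \<open>The square of the expected size P^(s-k), with a saving of n^10.\<close>
    define T where "T = x ^ (100 * k * (2 * ?s - 2 * k)) / x ^ 10"
    have "(\<integral>l. (f l)\<^sup>2 \<partial>lebesgue_on (cube L)) \<le> 3 * (2 * L) ^ ?s *
        (CA * (x ^ (100 * k * (2 * ?s) + 100 * k * (2 * k - 1)) / x ^ (2 * (k * (200 * k - 40))))
          + CB * (x ^ (100 * k * (?s + 1) + 70 * k * (?s - 1)) / x ^ (k * (200 * k - 70)))
          + CC * (x ^ (100 * k * (?s + 1) + 40 * k * (?s - 1)) / x ^ ((100 * k - 5) * k)))"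
    proof -
      have DD: "D1 * D1 = x ^ (2 * (k * (200 * k - 40)))"
        unfolding D1_def power_add[symmetric] mult_2 ..
      have 1: "32 * real ?s * real k * 2 ^ ?s * (2 * real P) ^ (2 * ?s) * real P ^ (2 * k - 1) / (D1 * D1)
          = CA * (x ^ (100 * k * (2 * ?s) + 100 * k * (2 * k - 1)) / x ^ (2 * (k * (200 * k - 40))))"
        unfolding CA_def DD rP power_mult_distrib power_mult[symmetric] power_add by (simp add: power_add)
      have 2: "2 * (2 * real P) ^ (?s + 1) * (6 * h1) ^ (?s - 1) / D2
          = CB * (x ^ (100 * k * (?s + 1) + 70 * k * (?s - 1)) / x ^ (k * (200 * k - 70)))"
        unfolding CB_def D2_def h1_def rP power_mult_distrib power_mult[symmetric] power_add by (simp add: power_add)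
      have 3: "(2 * real P) ^ (?s + 1) * (6 * h2) ^ (?s - 1) / Q ^ k
          = CC * (x ^ (100 * k * (?s + 1) + 40 * k * (?s - 1)) / x ^ ((100 * k - 5) * k))"
        unfolding CC_def Q_def h2_def rP power_mult_distrib power_mult[symmetric] power_add by (simp add: power_add)
      show ?thesis using gs(2) unfolding 1 2 3 .
    qed
    also have "\<dots> \<le> 3 * (2 * L) ^ ?s * (CA * T + CB * T + CC * T)"
      unfolding T_def using C0 L
      by (intro mult_left_mono add_mono power_frac_le[OF x1 ex(1)] power_frac_le[OF x1 ex(2)]
          power_frac_le[OF x1 ex(3)]) auto
    also have "\<dots> = C2 * T" by (simp add: C2_def algebra_simps)
    finally have sq: "(\<integral>l. (f l)\<^sup>2 \<partial>lebesgue_on (cube L)) \<le> C2 * T" .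
    \<comment> \<open>The square root of T. At this scale |f| <= f^2 / a + a, used in place of the
      Cauchy-Schwarz inequality, is balanced.\<close>
    define a where "a = x ^ (100 * k * (?s - k)) / x ^ 5"
    have a0: "a > 0" using x1 by (simp add: a_def)
    have "2 * ?s - 2 * k = 2 * (?s - k)" by simp
    then have Ta: "T = a * a"
      by (simp add: T_def a_def power_add[symmetric] mult_2 distrib_left)
    have meas: "f \<in> borel_measurable (lebesgue_on (cube L))"
      unfolding f_def using integral_cnt(1)[of \<tau> L k X z] integral_cnt(1)[of 1 L k X 0] t
      by (intro borel_measurable_diff borel_measurable_times borel_measurable_const borel_measurable_integrable) auto
    interpret finite_measure "lebesgue_on (cube L) :: (real ^ 's) measure"
      by (rule finite_measure_lebesgue_on) simp
    have intb: "integrable (lebesgue_on (cube L)) (\<lambda>l. (f l)\<^sup>2 / a + a)"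
      using gs(1) by simp
    have ptw: "\<bar>f l\<bar> \<le> (f l)\<^sup>2 / a + a" for l
    proof (cases "\<bar>f l\<bar> \<le> a")
      case True then show ?thesis using a0 by (smt (verit) divide_nonneg_pos zero_le_power2)
    next
      case False
      then have "a * \<bar>f l\<bar> \<le> \<bar>f l\<bar> * \<bar>f l\<bar>" by (intro mult_right_mono) auto
      then have "\<bar>f l\<bar> \<le> (f l)\<^sup>2 / a" using a0 by (simp add: pos_le_divide_eq power2_eq_square mult.commute)
      then show ?thesis using a0 by linarith
    qed
    have intf: "integrable (lebesgue_on (cube L)) (\<lambda>l. \<bar>f l\<bar>)"
      by (rule Bochner_Integration.integrable_bound[OF intb]) (use meas ptw in \<open>auto intro: order.trans[OF ptw abs_ge_self]\<close>)
    have mc: "measure (lebesgue_on (cube L)) (cube L :: (real ^ 's) set) = measure lebesgue (cube L :: (real ^ 's) set)"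
      by (rule measure_restrict_space) (auto simp: fmeasurableD)
    have "(\<integral>l. \<bar>f l\<bar> \<partial>lebesgue_on (cube L)) \<le> (\<integral>l. (f l)\<^sup>2 / a + a \<partial>lebesgue_on (cube L))"
      by (intro integral_mono intf intb ptw)
    also have "\<dots> = (\<integral>l. (f l)\<^sup>2 \<partial>lebesgue_on (cube L)) / a + measure lebesgue (cube L :: (real ^ 's) set) * a"
      using gs(1) by (simp add: mc)
    also have "\<dots> \<le> (C2 * T) / a + (2 * L) ^ ?s * a"
      using sq a0 L by (intro add_mono divide_right_mono mult_right_mono measure_le_of_bounded) (auto simp: in_cube)
    also have "\<dots> = C * a" using a0 by (simp add: Ta C_def algebra_simps)
    finally show ?thesis by (simp add: f_def X_def P_def Q_def x_def a_def)
  qed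
  moreover have "C \<ge> 0" using C20 L by (simp add: C_def)
  ultimately show ?thesis by blast
qed

section \<open>Vectors with a small coordinate\<close>

lemma cnt_nonneg [simp]: "cnt k X z \<tau> l \<ge> 0"
  by (simp add: cnt_def sum_nonneg)

text \<open>A coordinate with |x_i| <= q takes O(q) values in place of 2P, and
  \<open>first_moment\<close> turns this into the saving q / P = n^-5, the same as for the other
  vectors.\<close>

lemma mean_bad_vectors:
  fixes z :: "real ^ 's::finite"
  assumes L: "L \<ge> 1" and k: "k \<ge> 2" and s: "CARD('s) > 2 * k" and n: "n \<ge> 1"
    and z: "\<And>m. 0 \<le> z $ m \<and> z $ m \<le> 1" and t: "0 < \<tau>" "\<tau> \<le> 1"
  shows "(\<integral>l. cnt k (vecs (\<lambda>_. interv (n ^ (100 * k))) - goodvecs (n ^ (100 * k)) (real n ^ (100 * k - 5) + 1)) z \<tau> l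
      \<partial>lebesgue_on (cube L))
    \<le> real CARD('s) * (2 * L) ^ CARD('s) * 2 ^ k * 5 ^ CARD('s) * real n ^ (100 * k * (CARD('s) - k)) / real n ^ 5"
proof -
  let ?s = "CARD('s)"
  define P where "P = n ^ (100 * k)"
  define q where "q = n ^ (100 * k - 5)"
  have q1: "q \<ge> 1" "P \<ge> 1" using n by (simp_all add: q_def P_def)
  define S where "S = {a \<in> interv P. \<bar>real_of_int a\<bar> < real q + 1}"
  define V where "V = (\<lambda>i::'s. vecs (\<lambda>m. if m = i then S else interv P))"
  have finS: "finite S" by (simp add: S_def)
  have "S \<subseteq> {- int q..int q}"
  proof
    fix a assume "a \<in> S"
    then have "real_of_int \<bar>a\<bar> < real_of_int (int q + 1)" by (simp add: S_def)
    then show "a \<in> {- int q..int q}" unfolding of_int_less_iff by auto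
  qed
  then have "card S \<le> card {- int q..int q}" by (intro card_mono) auto
  \<comment> \<open>More generous than 2q + 1 demands, so that it merges with 5^(s-1) from
    \<open>first_moment\<close>.\<close>
  also have "\<dots> \<le> 5 * q" using q1 by simp
  finally have cS: "real (card S) \<le> 5 * real q" by linarith
  have finV: "finite (V i)" for i unfolding V_def by (intro finite_vecs) (auto simp: finS)
  let ?B = "vecs (\<lambda>_. interv P) - goodvecs P (real q + 1) :: (int ^ 's) set"
  have sub: "?B \<subseteq> (\<Union>i\<in>UNIV. V i)"
    by (auto simp: vecs_def goodvecs_def V_def S_def not_le)
  have "(\<integral>l. cnt k ?B z \<tau> l \<partial>lebesgue_on (cube L)) = (\<Sum>x\<in>?B. measure lebesgue (slabk L k \<tau> (shifted z x)))"
    by (rule integral_cnt[OF t(1)])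
  also have "\<dots> \<le> (\<Sum>x\<in>(\<Union>i\<in>UNIV. V i). measure lebesgue (slabk L k \<tau> (shifted z x)))"
    using finV by (intro sum_mono2 sub) auto
  also have "\<dots> \<le> (\<Sum>i\<in>UNIV. \<Sum>x\<in>V i. measure lebesgue (slabk L k \<tau> (shifted z x)))"
    using finV by (intro sum_UN_le) auto
  also have "\<dots> \<le> (\<Sum>i\<in>(UNIV :: 's set). (2 * L) ^ ?s * 2 ^ k * 5 ^ (?s - 1) * (5 * real q) * real P ^ (?s - 1 - k))"
  proof (intro sum_mono)
    fix i :: 's
    have "(\<Sum>x\<in>V i. measure lebesgue (slabk L k \<tau> (shifted z x)))
      \<le> (2 * L) ^ ?s * 2 ^ k * 5 ^ (?s - 1) * real (card S) * real P ^ (?s - 1 - k)"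
      unfolding V_def using k by (intro first_moment L t z s q1 finS) auto
    also have "\<dots> \<le> (2 * L) ^ ?s * 2 ^ k * 5 ^ (?s - 1) * (5 * real q) * real P ^ (?s - 1 - k)"
      using cS L by (intro mult_right_mono mult_left_mono) auto
    finally show "(\<Sum>x\<in>V i. measure lebesgue (slabk L k \<tau> (shifted z x)))
      \<le> (2 * L) ^ ?s * 2 ^ k * 5 ^ (?s - 1) * (5 * real q) * real P ^ (?s - 1 - k)" .
  qed
  also have "\<dots> = real ?s * (2 * L) ^ ?s * 2 ^ k * (5 * 5 ^ (?s - 1)) * (real q * real P ^ (?s - 1 - k))"
    by simp
  also have "5 * 5 ^ (?s - 1) = (5::real) ^ ?s" by (simp add: power_eq_if)
  also have "real q * real P ^ (?s - 1 - k) = real n ^ (100 * k * (?s - k)) / real n ^ 5"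
  proof -
    obtain r where r: "?s = 2 * k + 1 + r" using s less_iff_Suc_add by auto
    obtain j where j: "k = 2 + j" using k le_Suc_ex by blast
    have "5 + (100 * k - 5 + 100 * k * (?s - 1 - k)) = 100 * k * (?s - k)"
      unfolding r j by (simp add: algebra_simps)
    then have "real n ^ 5 * (real q * real P ^ (?s - 1 - k)) = real n ^ (100 * k * (?s - k))"
      unfolding q_def P_def of_nat_power power_mult[symmetric] power_add[symmetric] by simp
    then show ?thesis using n by (simp add: field_simps)
  qed
  finally show ?thesis by (simp add: P_def q_def)
qed

lemma mean_deviation:
  assumes L: "L \<ge> 1" and k: "k \<ge> 2" and s: "CARD('s::finite) > 2 * k"
  shows "\<exists>C\<ge>0. \<forall>n (z :: real ^ 's) \<tau>. n \<ge> 8 * CARD('s) * k \<longrightarrow> (\<forall>m. 0 \<le> z $ m \<and> z $ m \<le> 1) \<longrightarrow> 0 < \<tau> \<longrightarrow> \<tau> \<le> 1 \<longrightarrow>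
    (\<integral>l. \<bar>cnt k (vecs (\<lambda>_. interv (n ^ (100 * k)))) z \<tau> l
        - \<tau> * cnt k (vecs (\<lambda>_. interv (n ^ (100 * k)))) 0 1 l\<bar> \<partial>lebesgue_on (cube L))
      \<le> C * real n ^ (100 * k * (CARD('s) - k)) / real n ^ 5"
proof -
  let ?s = "CARD('s)"
  obtain C1 where C1: "C1 \<ge> 0" and good: "\<And>n (z :: real ^ 's) \<tau>. n \<ge> 8 * CARD('s) * k \<Longrightarrow> (\<forall>m. 0 \<le> z $ m \<and> z $ m \<le> 1) \<Longrightarrow> 0 < \<tau> \<Longrightarrow> \<tau> \<le> 1 \<Longrightarrow>
    (\<integral>l. \<bar>cnt k (goodvecs (n ^ (100 * k)) (real n ^ (100 * k - 5) + 1)) z \<tau> l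
        - \<tau> * cnt k (goodvecs (n ^ (100 * k)) (real n ^ (100 * k - 5) + 1)) 0 1 l\<bar> \<partial>lebesgue_on (cube L))
      \<le> C1 * real n ^ (100 * k * (CARD('s) - k)) / real n ^ 5"
    using good_mean_deviation[OF L k s] by blast
  define C2 where "C2 = real ?s * (2 * L) ^ ?s * 2 ^ k * 5 ^ ?s"
  have C2: "C2 \<ge> 0" using L by (simp add: C2_def)
  have "(\<integral>l. \<bar>cnt k (vecs (\<lambda>_. interv (n ^ (100 * k)))) z \<tau> l
        - \<tau> * cnt k (vecs (\<lambda>_. interv (n ^ (100 * k)))) 0 1 l\<bar> \<partial>lebesgue_on (cube L))
      \<le> (C1 + 2 * C2) * real n ^ (100 * k * (?s - k)) / real n ^ 5"
    if n: "n \<ge> 8 * ?s * k" and z: "\<And>m. 0 \<le> z $ m \<and> z $ m \<le> 1" and t: "0 < \<tau>" "\<tau> \<le> 1" for n \<tau> and z :: "real ^ 's"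
  proof -
    have "8 * ?s * k \<ge> 1" using k s by (simp add: Suc_leI)
    then have n1: "n \<ge> 1" using n by linarith
    define F where "F = (vecs (\<lambda>_. interv (n ^ (100 * k))) :: (int ^ 's) set)"
    define X where "X = (goodvecs (n ^ (100 * k)) (real n ^ (100 * k - 5) + 1) :: (int ^ 's) set)"
    define T where "T = real n ^ (100 * k * (?s - k)) / real n ^ 5"
    let ?M = "lebesgue_on (cube L) :: (real ^ 's) measure"
    have XF: "X \<subseteq> F" by (auto simp: X_def F_def goodvecs_def)
    have finF: "finite F" unfolding F_def by (intro finite_vecs) auto
    have split: "cnt k F w \<sigma> l = cnt k X w \<sigma> l + cnt k (F - X) w \<sigma> l" for w \<sigma> l
      unfolding cnt_def using XF finF by (metis add.commute sum.subset_diff)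
    have bad: "(\<integral>l. cnt k (F - X) w \<sigma> l \<partial>?M) \<le> C2 * T"
      if "\<And>m. 0 \<le> w $ m \<and> w $ m \<le> 1" "0 < \<sigma>" "\<sigma> \<le> 1" for w \<sigma>
      using mean_bad_vectors[OF L k s n1 that] by (simp add: F_def X_def C2_def T_def)
    note int = integral_cnt(1)[of _ L k]
    have "(\<integral>l. \<bar>cnt k F z \<tau> l - \<tau> * cnt k F 0 1 l\<bar> \<partial>?M)
      \<le> (\<integral>l. \<bar>cnt k X z \<tau> l - \<tau> * cnt k X 0 1 l\<bar> + cnt k (F - X) z \<tau> l + cnt k (F - X) 0 1 l \<partial>?M)"
    proof (intro integral_mono)
      show "integrable ?M (\<lambda>l. \<bar>cnt k F z \<tau> l - \<tau> * cnt k F 0 1 l\<bar>)"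
        using int t by (intro integrable_abs Bochner_Integration.integrable_diff integrable_mult_right) auto
      show "integrable ?M (\<lambda>l. \<bar>cnt k X z \<tau> l - \<tau> * cnt k X 0 1 l\<bar> + cnt k (F - X) z \<tau> l + cnt k (F - X) 0 1 l)"
        using int t by (intro Bochner_Integration.integrable_add integrable_abs Bochner_Integration.integrable_diff integrable_mult_right) auto
      fix l
      have "\<tau> * cnt k (F - X) 0 1 l \<le> 1 * cnt k (F - X) 0 1 l"
        using t by (intro mult_right_mono) auto
      moreover have "0 \<le> \<tau> * cnt k (F - X) 0 1 l" "0 \<le> cnt k (F - X) z \<tau> l" using t by simp_all
      ultimately show "\<bar>cnt k F z \<tau> l - \<tau> * cnt k F 0 1 l\<bar>
        \<le> \<bar>cnt k X z \<tau> l - \<tau> * cnt k X 0 1 l\<bar> + cnt k (F - X) z \<tau> l + cnt k (F - X) 0 1 l"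
        unfolding split distrib_left by linarith
    qed
    also have "\<dots> = (\<integral>l. \<bar>cnt k X z \<tau> l - \<tau> * cnt k X 0 1 l\<bar> \<partial>?M) + (\<integral>l. cnt k (F - X) z \<tau> l \<partial>?M)
        + (\<integral>l. cnt k (F - X) 0 1 l \<partial>?M)"
      using int[of \<tau> X z] int[of 1 X 0] int[of \<tau> "F - X" z] int[of 1 "F - X" 0] t by simp
    also have "\<dots> \<le> C1 * T + C2 * T + C2 * T"
      using good[OF n _ t, of z] z t unfolding X_def[symmetric]
      by (intro add_mono bad) (auto simp: T_def)
    also have "\<dots> = (C1 + 2 * C2) * T" by (simp add: algebra_simps)
    finally show ?thesis by (simp add: F_def T_def)
  qed
  moreover have "C1 + 2 * C2 \<ge> 0" using C1 C2 by simp
  ultimately show ?thesis by blast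
qed

section \<open>Refinement of the lattice and almost sure bounds\<close>

definition boxcnt :: "nat \<Rightarrow> nat \<Rightarrow> real \<Rightarrow> real ^ 's::finite \<Rightarrow> real" where
  "boxcnt k P \<tau> l = cnt k (vecs (\<lambda>_. interv P)) 0 \<tau> l"

lemma integrable_boxcnt: "\<tau> > 0 \<Longrightarrow> integrable (lebesgue_on (cube L)) (boxcnt k P \<tau>)"
  unfolding boxcnt_def[abs_def] by (rule integral_cnt)

text \<open>Division with remainder in each coordinate, x = m y + e; homogeneity of degree k turns
  the tolerance \<tau> at y + e / m into m^k \<tau> at x.\<close>

lemma boxcnt_refine:
  fixes l :: "real ^ 's::finite"
  assumes m: "m \<ge> 1"
  shows "boxcnt k (m * P) (real m ^ k * \<tau>) l
    = (\<Sum>e\<in>vecs (\<lambda>_. {0..<int m}). cnt k (vecs (\<lambda>_. interv P)) (\<chi> i. real_of_int (e $ i) / real m) \<tau> l)"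
proof -
  let ?g = "\<lambda>(e :: int ^ 's, x). (\<chi> i. int m * x $ i + e $ i)"
  let ?h = "\<lambda>x :: int ^ 's. ((\<chi> i. x $ i mod int m), (\<chi> i. x $ i div int m))"
  have "(\<Sum>e\<in>vecs (\<lambda>_. {0..<int m}). cnt k (vecs (\<lambda>_. interv P)) (\<chi> i. real_of_int (e $ i) / real m) \<tau> l)
    = (\<Sum>(e, x)\<in>vecs (\<lambda>_. {0..<int m}) \<times> vecs (\<lambda>_. interv P).
        of_bool (\<bar>l \<bullet> pw k (shifted (\<chi> i. real_of_int (e $ i) / real m) x)\<bar> < \<tau>))"
    unfolding cnt_def by (rule sum.cartesian_product)
  also have "\<dots> = (\<Sum>x\<in>vecs (\<lambda>_. interv (m * P)). of_bool (\<bar>l \<bullet> pw k (shifted 0 x)\<bar> < real m ^ k * \<tau>))"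
  proof (rule sum.reindex_bij_witness[of _ ?h ?g])
    fix p :: "(int ^ 's) \<times> (int ^ 's)" assume p: "p \<in> vecs (\<lambda>_. {0..<int m}) \<times> vecs (\<lambda>_. interv P)"
    then obtain e x where ex: "p = (e, x)" and e: "\<And>i. 0 \<le> e $ i \<and> e $ i < int m"
      and x: "\<And>i. - int P \<le> x $ i \<and> x $ i < int P"
      by (cases p) (auto simp: vecs_def interv_def)
    show "?h (?g p) = p" using e m by (simp add: ex vec_eq_iff)
    have "- int (m * P) \<le> int m * x $ i + e $ i \<and> int m * x $ i + e $ i < int (m * P)" for i
    proof
      have "int m * (- int P) \<le> int m * x $ i" using x[of i] by (intro mult_left_mono) auto
      then show "- int (m * P) \<le> int m * x $ i + e $ i" using e[of i] by simp
      have "int m * (x $ i + 1) \<le> int m * int P" using x[of i] by (intro mult_left_mono) auto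
      then show "int m * x $ i + e $ i < int (m * P)" using e[of i] by (simp add: distrib_left)
    qed
    then show "?g p \<in> vecs (\<lambda>_. interv (m * P))" by (simp add: ex vecs_def interv_def)
    have "pw k (shifted 0 (?g p)) = real m ^ k *\<^sub>R pw k (shifted (\<chi> i. real_of_int (e $ i) / real m) x)"
      using m by (simp add: ex pw_def shifted_def vec_eq_iff power_mult_distrib[symmetric] distrib_left)
    then have "\<bar>l \<bullet> pw k (shifted 0 (?g p))\<bar> = real m ^ k * \<bar>l \<bullet> pw k (shifted (\<chi> i. real_of_int (e $ i) / real m) x)\<bar>"
      by (simp add: abs_mult)
    then show "of_bool (\<bar>l \<bullet> pw k (shifted 0 (?g p))\<bar> < real m ^ k * \<tau>)
      = (case p of (e, x) \<Rightarrow> (of_bool (\<bar>l \<bullet> pw k (shifted (\<chi> i. real_of_int (e $ i) / real m) x)\<bar> < \<tau>) :: real))"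
      using m by (simp add: ex)
  next
    fix x assume "x \<in> vecs (\<lambda>_::'s. interv (m * P))"
    then have x: "- (int m * int P) \<le> x $ i" "x $ i < int m * int P" for i by (auto simp: vecs_def interv_def)
    show "?g (?h x) = x" by (simp add: vec_eq_iff)
    have "- int P \<le> x $ i div int m" for i
    proof -
      have "- int P * int m div int m = - int P" using m by (intro nonzero_mult_div_cancel_right) auto
      then show ?thesis using x(1)[of i] m zdiv_mono1[of "- int P * int m" "x $ i" "int m"] by (simp add: mult.commute)
    qed
    moreover have "x $ i div int m < int P" for i
    proof (rule ccontr)
      assume "\<not> x $ i div int m < int P"
      then have "int m * int P \<le> int m * (x $ i div int m)" by (intro mult_left_mono) auto
      also have "\<dots> \<le> x $ i" using m mult_div_mod_eq[of "int m" "x $ i"] pos_mod_sign[of "int m" "x $ i"] by linarith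
      finally show False using x(2)[of i] by linarith
    qed
    ultimately show "?h x \<in> vecs (\<lambda>_. {0..<int m}) \<times> vecs (\<lambda>_. interv P)"
      using m by (auto simp: vecs_def interv_def)
  qed
  finally show ?thesis unfolding boxcnt_def cnt_def by simp
qed

text \<open>All m^s classes obey one error bound, uniform in the shift, so m may be arbitrarily
  large: later it is another height, or the k-th power of the height itself.\<close>

lemma mean_boxcnt:
  assumes L: "L \<ge> 1" and k: "k \<ge> 2" and s: "CARD('s::finite) > 2 * k"
  shows "\<exists>C\<ge>0. \<forall>n m \<tau>. n \<ge> 8 * CARD('s) * k \<longrightarrow> m \<ge> 1 \<longrightarrow> 0 < \<tau> \<longrightarrow> \<tau> \<le> 1 \<longrightarrow>
    (\<integral>l. \<bar>boxcnt k (m * n ^ (100 * k)) (real m ^ k * \<tau>) l - real m ^ CARD('s) * \<tau> * boxcnt k (n ^ (100 * k)) 1 l\<bar>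
      \<partial>lebesgue_on (cube L :: (real ^ 's) set))
      \<le> real m ^ CARD('s) * (C * real n ^ (100 * k * (CARD('s) - k)) / real n ^ 5)"
proof -
  obtain C where C: "C \<ge> 0" and dev: "\<And>n (z :: real ^ 's) \<tau>. n \<ge> 8 * CARD('s) * k \<Longrightarrow> (\<forall>m. 0 \<le> z $ m \<and> z $ m \<le> 1) \<Longrightarrow> 0 < \<tau> \<Longrightarrow> \<tau> \<le> 1 \<Longrightarrow>
    (\<integral>l. \<bar>cnt k (vecs (\<lambda>_. interv (n ^ (100 * k)))) z \<tau> l
        - \<tau> * cnt k (vecs (\<lambda>_. interv (n ^ (100 * k)))) 0 1 l\<bar> \<partial>lebesgue_on (cube L))
      \<le> C * real n ^ (100 * k * (CARD('s) - k)) / real n ^ 5"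
    using mean_deviation[OF L k s] by blast
  show ?thesis
  proof (intro exI[of _ C] conjI C allI impI)
    fix n m :: nat and \<tau> :: real
    assume n: "n \<ge> 8 * CARD('s) * k" and m: "m \<ge> 1" and t: "0 < \<tau>" "\<tau> \<le> 1"
    let ?M = "lebesgue_on (cube L) :: (real ^ 's) measure"
    let ?E = "vecs (\<lambda>_::'s. {0..<int m})"
    let ?F = "vecs (\<lambda>_::'s. interv (n ^ (100 * k)))"
    let ?z = "\<lambda>e :: int ^ 's. (\<chi> i. real_of_int (e $ i) / real m) :: real ^ 's"
    let ?d = "\<lambda>e l. cnt k ?F (?z e) \<tau> l - \<tau> * cnt k ?F 0 1 l"
    let ?B = "C * real n ^ (100 * k * (CARD('s) - k)) / real n ^ 5"
    have cardE: "card ?E = m ^ CARD('s)" by (simp add: card_vecs)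
    have eq: "boxcnt k (m * n ^ (100 * k)) (real m ^ k * \<tau>) l - real m ^ CARD('s) * \<tau> * boxcnt k (n ^ (100 * k)) 1 l
      = (\<Sum>e\<in>?E. ?d e l)" for l :: "real ^ 's"
      unfolding boxcnt_refine[OF m] sum_subtractf by (simp add: cardE boxcnt_def)
    have int: "integrable ?M (\<lambda>l. \<bar>?d e l\<bar>)" for e
      using integral_cnt(1)[of \<tau> L k ?F "?z e"] integral_cnt(1)[of 1 L k ?F 0] t by simp
    have intl: "integrable ?M (\<lambda>l. \<bar>\<Sum>e\<in>?E. ?d e l\<bar>)"
      using integral_cnt(1)[of \<tau> L k ?F] integral_cnt(1)[of 1 L k ?F 0] t by simp
    have "(\<integral>l. \<bar>\<Sum>e\<in>?E. ?d e l\<bar> \<partial>?M) \<le> (\<integral>l. (\<Sum>e\<in>?E. \<bar>?d e l\<bar>) \<partial>?M)"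
      by (intro integral_mono intl Bochner_Integration.integrable_sum int sum_abs)
    also have "\<dots> = (\<Sum>e\<in>?E. \<integral>l. \<bar>?d e l\<bar> \<partial>?M)"
      by (intro Bochner_Integration.integral_sum int)
    also have "\<dots> \<le> (\<Sum>e\<in>?E. ?B)"
    proof (intro sum_mono dev n t allI)
      fix e i assume "e \<in> ?E"
      then have "0 \<le> e $ i" "e $ i < int m" by (auto simp: vecs_def)
      then have "0 \<le> e $ i" "e $ i \<le> int m" by auto
      then have "0 \<le> real_of_int (e $ i)" "real_of_int (e $ i) \<le> real_of_int (int m)" unfolding of_int_le_iff by simp_all
      then show "0 \<le> ?z e $ i \<and> ?z e $ i \<le> 1" using m by simp
    qed
    also have "\<dots> = real m ^ CARD('s) * ?B" by (simp add: cardE)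
    finally show "(\<integral>l. \<bar>boxcnt k (m * n ^ (100 * k)) (real m ^ k * \<tau>) l - real m ^ CARD('s) * \<tau> * boxcnt k (n ^ (100 * k)) 1 l\<bar> \<partial>?M)
      \<le> real m ^ CARD('s) * ?B"
      unfolding eq .
  qed
qed

text \<open>Borel-Cantelli in mean form: the sum of all f n has finite integral by monotone
  convergence, so it is finite almost everywhere and bounds each of its terms.\<close>

lemma AE_bounded_of_summable:
  fixes f :: "nat \<Rightarrow> 'a \<Rightarrow> real"
  assumes int: "\<And>n. integrable M (f n)" and nn: "\<And>n x. f n x \<ge> 0"
    and le: "\<And>n. (\<integral>x. f n x \<partial>M) \<le> a n" and sm: "summable a"
  shows "AE x in M. \<exists>B. \<forall>n. f n x \<le> B"
proof -
  have a0: "a n \<ge> 0" for n 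
    by (rule order.trans[OF Bochner_Integration.integral_nonneg le]) (rule nn)
  have m: "(\<lambda>x. ennreal (f n x)) \<in> borel_measurable M" for n
    using int[of n] by (intro measurable_compose[OF borel_measurable_integrable measurable_ennreal])
  have "(\<integral>\<^sup>+x. (\<Sum>n. ennreal (f n x)) \<partial>M) = (\<Sum>n. \<integral>\<^sup>+x. ennreal (f n x) \<partial>M)"
    by (rule nn_integral_suminf[OF m])
  also have "\<dots> = (\<Sum>n. ennreal (\<integral>x. f n x \<partial>M))"
    using int nn by (intro suminf_cong nn_integral_eq_integral) auto
  also have "\<dots> \<le> (\<Sum>n. ennreal (a n))" by (intro suminf_le ennreal_leI le) auto
  also have "\<dots> = ennreal (\<Sum>n. a n)" by (rule suminf_ennreal2[OF a0 sm])
  finally have "(\<integral>\<^sup>+x. (\<Sum>n. ennreal (f n x)) \<partial>M) \<noteq> \<infinity>" by (auto simp: top_unique)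
  then have "AE x in M. (\<Sum>n. ennreal (f n x)) \<noteq> \<infinity>"
    by (intro nn_integral_noteq_infinite borel_measurable_suminf_order m)
  then show ?thesis
  proof (rule AE_mp, intro AE_I2 impI)
    fix x assume fin: "(\<Sum>n. ennreal (f n x)) \<noteq> \<infinity>"
    show "\<exists>B. \<forall>n. f n x \<le> B"
    proof (intro exI allI)
      fix n
      have "ennreal (f n x) \<le> (\<Sum>n. ennreal (f n x))"
        using sum_le_suminf[of "\<lambda>n. ennreal (f n x)" "{n}"] by auto
      then show "f n x \<le> enn2real (\<Sum>n. ennreal (f n x))"
        using fin nn[of n x] by (metis enn2real_ennreal enn2real_mono infinity_ennreal_def less_top)
    qed
  qed
qed

section \<open>A lower bound for indefinite forms\<close>

text \<open>For odd k the substitution x_j -> -x_j reverses the sign of a term, so coefficients of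
  equal sign do no harm; \<sigma> records whether it is made.\<close>

lemma obtain_opposite_signs:
  fixes l :: "real ^ 's::finite"
  assumes l: "l \<in> Lambda_k k" and s: "CARD('s) \<ge> 2"
  obtains i j and \<sigma> :: int where "i \<noteq> j" "l $ i \<noteq> 0" "\<sigma> = 1 \<or> \<sigma> = - 1" "l $ i * (l $ j * of_int \<sigma> ^ k) < 0"
proof (cases "\<exists>i j. l $ i * l $ j < 0")
  case True
  then obtain i j where "l $ i * l $ j < 0" by blast
  moreover from this have "i \<noteq> j" "l $ i \<noteq> 0" by (auto simp: not_less[symmetric])
  ultimately show ?thesis using that[of i j 1] by simp
next
  case False
  then have k: "odd k" and nz: "\<And>i. l $ i \<noteq> 0"
    using l by (auto simp: Lambda_k_def Lambda_def split: if_splits)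
  obtain i j :: 's where ij: "i \<noteq> j"
    using s by (metis UNIV_I card_1_singletonE card_le_Suc0_iff_eq finite not_less_eq_eq numeral_2_eq_2)
  have "l $ i * l $ j > 0" using False nz by (metis linorder_neqE_linordered_idom mult_eq_0_iff)
  then show ?thesis using that[of i j "- 1"] ij nz k by simp
qed

text \<open>At tolerance 1, solving for x_i at height M leaves a window of length about M^(1-k), too
  short to be sure of an integer. With M = P^(k+1) and tolerance P^(k^2) = P M^(k-1) the window has
  length about P, so each admissible choice of the other coordinates yields about P
  solutions.\<close>

lemma boxcnt_lower:
  fixes l :: "real ^ 's::finite"
  assumes l: "l \<in> Lambda_k k" and k: "k \<ge> 2" and s: "CARD('s) \<ge> k" "CARD('s) \<ge> 2"
  shows "\<exists>c>0. \<exists>P0. \<forall>P\<ge>P0. c * real (P ^ k) ^ CARD('s) * real P ^ (CARD('s) - k)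
    \<le> boxcnt k (P ^ k * P) (real (P ^ k) ^ k) l"
proof -
  obtain i j and \<sigma> :: int where ij: "i \<noteq> j" and li: "l $ i \<noteq> 0" and sg: "\<sigma> = 1 \<or> \<sigma> = - 1"
    and neg: "l $ i * (l $ j * of_int \<sigma> ^ k) < 0"
    using obtain_opposite_signs[OF l s(2)] by blast
  define g where "g = - (l $ j * of_int \<sigma> ^ k) / l $ i"
  have g0: "g > 0"
    using neg li by (auto simp: g_def mult_less_0_iff divide_less_0_iff zero_less_divide_iff)
  let ?R = "UNIV - {i, j}"
  define A where "A = (\<Sum>m\<in>?R. \<bar>l $ m / l $ i\<bar>)"
  have A0: "A \<ge> 0" by (simp add: A_def sum_nonneg)
  \<comment> \<open>Coordinate j dominates, with |x_j| in [\<alpha> M / 2, \<alpha> M]. The bound on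
    \<alpha> keeps g |x_j|^k below half of (M / 2)^k; \<beta> M bounds the remaining coordinates,
    whose total effect is at most half of the least value of g |x_j|^k. Thus the k-th root to be
    taken is real and at most M / 2. A common lower density of these ranges is \<gamma>.\<close>
  define \<alpha> where "\<alpha> = min (1 / 2) ((1 / 2) ^ k / (2 * g))"
  define \<beta> where "\<beta> = min (1 / 2) (g * (\<alpha> / 2) ^ k / (2 * (1 + A)))"
  define \<gamma> where "\<gamma> = min (\<alpha> / 4) \<beta>"
  define c where "c = \<gamma> ^ (CARD('s) - 1) / (4 * real k * \<bar>l $ i\<bar>)"
  have \<alpha>: "0 < \<alpha>" "\<alpha> \<le> 1 / 2" "\<alpha> \<le> (1 / 2) ^ k / (2 * g)" using g0 by (auto simp: \<alpha>_def)
  have \<beta>: "0 < \<beta>" "\<beta> \<le> 1 / 2" "\<beta> \<le> g * (\<alpha> / 2) ^ k / (2 * (1 + A))"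
    using g0 A0 \<alpha> unfolding \<beta>_def by (simp, simp only: min.cobounded1, simp only: min.cobounded2)
  have \<gamma>: "0 < \<gamma>" using \<alpha> \<beta> by (simp add: \<gamma>_def)
  have c0: "c > 0" using \<gamma> li k by (simp add: c_def)
  have pk: "x ^ k \<le> x" if "0 \<le> x" "x \<le> 1" for x :: real
    using power_decreasing[of 1 k x] that k by simp
  have "g * \<alpha> ^ k \<le> g * \<alpha>" using \<alpha> g0 by (intro mult_left_mono pk) auto
  also have "\<dots> \<le> (1 / 2) ^ k / 2" using \<alpha>(3) g0 by (simp add: field_simps)
  finally have ga: "g * \<alpha> ^ k \<le> (1 / 2) ^ k / 2" .
  have A1: "0 < 2 * (1 + A)" using A0 by simp
  have "A * \<beta> ^ k \<le> (1 + A) * \<beta>" using \<beta> A0 by (intro mult_mono pk) auto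
  also have "\<dots> = \<beta> * (2 * (1 + A)) / 2" by simp
  also have "\<dots> \<le> g * (\<alpha> / 2) ^ k / 2"
    using \<beta>(3) unfolding pos_le_divide_eq[OF A1] by (rule divide_right_mono) simp
  finally have Ab: "A * \<beta> ^ k \<le> g * (\<alpha> / 2) ^ k / 2" .
  have "g * (\<alpha> / 2) ^ k \<le> g * \<alpha> ^ k" using \<alpha> g0 by (intro mult_left_mono power_mono) auto
  then have Ab2: "A * \<beta> ^ k \<le> (1 / 2) ^ k / 2" using Ab ga A0 \<beta> g0 \<alpha> by (smt (verit) field_sum_of_halves zero_le_power mult_nonneg_nonneg)
  \<comment> \<open>In order, the summands ensure \<open>H\<close> < \<open>M\<close> / 2, a window
    length of at least 2 so that rounding it down loses at most half, \<alpha> M >= 4, and P >=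
    1.\<close>
  define P0 where "P0 = nat \<lceil>1 / (real k * \<bar>l $ i\<bar>) + 4 * real k * \<bar>l $ i\<bar> + 4 / \<alpha> + 1\<rceil>"
  have "c * real (P ^ k) ^ CARD('s) * real P ^ (CARD('s) - k) \<le> boxcnt k (P ^ k * P) (real (P ^ k) ^ k) l"
    if P: "P \<ge> P0" for P
  proof -
    define M where "M = P ^ k * P"
    define T where "T = real (P ^ k) ^ k"
    \<comment> \<open>Moving x_i by at most H from the root changes the form by at most |l_i| k H
      M^(k-1) <= T / 2.\<close>
    define H where "H = nat \<lfloor>real P / (2 * real k * \<bar>l $ i\<bar>)\<rfloor>"
    have kl: "real k * \<bar>l $ i\<bar> > 0" using k li by simp
    have "1 / (real k * \<bar>l $ i\<bar>) + 4 * real k * \<bar>l $ i\<bar> + 4 / \<alpha> + 1 \<le> real P"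
      using P unfolding P0_def by linarith
    moreover have "1 / (real k * \<bar>l $ i\<bar>) > 0" "4 * real k * \<bar>l $ i\<bar> > 0" "4 / \<alpha> > 0" using kl \<alpha> by auto
    ultimately have P1: "real P > 1 / (real k * \<bar>l $ i\<bar>)" "real P \<ge> 4 * real k * \<bar>l $ i\<bar>" "real P \<ge> 4 / \<alpha>" "real P \<ge> 1"
      by linarith+
    have P1': "P \<ge> 1" using P1(4) by simp
    have MP: "real M \<ge> real P * real P"
    proof -
      have "real P ^ 2 \<le> real P ^ (k + 1)" using P1 k by (intro power_increasing) auto
      then show ?thesis by (simp add: M_def power2_eq_square mult.commute)
    qed
    have "real P * 1 \<le> real P * real P" using P1 by (intro mult_left_mono) auto
    then have MP': "real M \<ge> real P" using MP by linarith
    have M1: "real M \<ge> 1" using MP' P1 by linarith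
    have T: "real P * real M ^ (k - 1) = T"
    proof -
      have "k * k = 1 + (k + 1) * (k - 1)" using k by (cases k) auto
      then have "real P ^ (k * k) = real P * (real P ^ (k + 1)) ^ (k - 1)"
        by (simp only: power_add power_one_right power_mult)
      moreover have "real M = real P ^ (k + 1)" by (simp add: M_def)
      ultimately show ?thesis unfolding T_def by (simp add: power_mult)
    qed
    have T0: "T > 0" using P1' by (simp add: T_def)
    have H: "real H \<le> real P / (2 * real k * \<bar>l $ i\<bar>)" "real H \<ge> real P / (4 * real k * \<bar>l $ i\<bar>)"
    proof -
      let ?h = "real P / (2 * real k * \<bar>l $ i\<bar>)"
      have h2: "?h \<ge> 2" using P1(2) kl by (simp add: pos_le_divide_eq mult.assoc)
      show "real H \<le> ?h" using h2 unfolding H_def by linarith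
      have "real H \<ge> ?h - 1" using h2 unfolding H_def by linarith
      moreover have "real P / (4 * real k * \<bar>l $ i\<bar>) = ?h / 2" by simp
      ultimately show "real H \<ge> real P / (4 * real k * \<bar>l $ i\<bar>)" using h2 by linarith
    qed
    have HM: "real H < real M / 2"
    proof -
      have "real P / (2 * real k * \<bar>l $ i\<bar>) = real P * (1 / (real k * \<bar>l $ i\<bar>)) / 2" by simp
      also have "\<dots> < real P * real P / 2" using P1 by (intro divide_strict_right_mono mult_strict_left_mono) auto
      finally show ?thesis using H(1) MP by linarith
    qed
    define Sj where "Sj = {t::int. \<alpha> * real M / 2 \<le> of_int t \<and> of_int t \<le> \<alpha> * real M}"
    define Sm where "Sm = {0..\<lfloor>\<beta> * real M\<rfloor>}"
    \<comment> \<open>The entry 0 at i is a placeholder: \<open>\<phi>\<close> overwrites it with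
      one of H consecutive integers starting at the rounded root, and stays injective because i
      carries no information.\<close>
    define S where "S m = (if m = i then {0} else if m = j then (\<lambda>t. \<sigma> * t) ` Sj else Sm)" for m
    define w where "w x = - (\<Sum>m\<in>UNIV - {i}. l $ m * of_int (x $ m) ^ k) / l $ i" for x :: "int ^ 's"
    define \<phi> where "\<phi> p = (\<chi> m. if m = i then \<lceil>root k (w (fst p))\<rceil> + snd p else fst p $ m)" for p :: "(int ^ 's) \<times> int"
    define G where "G = {x \<in> vecs (\<lambda>_. interv M). \<bar>l \<bullet> pw k (shifted 0 x)\<bar> < T}"
    have Sj_eq: "Sj = {\<lceil>\<alpha> * real M / 2\<rceil>..\<lfloor>\<alpha> * real M\<rfloor>}"
      by (auto simp: Sj_def le_floor_iff ceiling_le_iff)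
    have finS: "finite (S m)" for m by (simp add: S_def Sj_eq Sm_def)
    have injs: "inj ((*) \<sigma>)" using sg by (auto simp: inj_on_def)
    have cardS: "real (card (S m)) \<ge> \<gamma> * real M" if "m \<noteq> i" for m
    proof (cases "m = j")
      case True
      have "4 / \<alpha> \<le> real M" using P1(3) MP' by linarith
      then have aM: "\<alpha> * real M \<ge> 4" using \<alpha> by (simp add: field_simps)
      have "card (S m) = card Sj" using True ij card_image[OF inj_on_subset[OF injs subset_UNIV]] by (auto simp: S_def)
      also have "real (card Sj) \<ge> \<alpha> * real M / 2 - 1" unfolding Sj_eq by simp linarith
      finally have "real (card (S m)) \<ge> \<alpha> / 4 * real M" using aM by linarith
      moreover have "\<gamma> * real M \<le> \<alpha> / 4 * real M" by (intro mult_right_mono) (auto simp: \<gamma>_def)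
      ultimately show ?thesis by linarith
    next
      case False
      have "\<beta> * real M \<ge> 0" using \<beta> by simp
      then have "real (card (S m)) \<ge> \<beta> * real M" using False that by (simp add: S_def Sm_def)
      moreover have "\<gamma> * real M \<le> \<beta> * real M" by (intro mult_right_mono) (auto simp: \<gamma>_def)
      ultimately show ?thesis by linarith
    qed
    have w: "0 \<le> root k (w x)" "root k (w x) \<le> real M / 2" "root k (w x) ^ k = w x" if x: "x \<in> vecs S" for x
    proof -
      obtain t where t: "t \<in> Sj" "x $ j = \<sigma> * t" using x ij by (auto simp: vecs_def S_def split: if_splits)
      let ?B = "\<Sum>m\<in>?R. l $ m / l $ i * of_int (x $ m) ^ k"
      have "\<bar>?B\<bar> \<le> (\<Sum>m\<in>?R. \<bar>l $ m / l $ i\<bar> * (\<beta> * real M) ^ k)"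
      proof (rule order.trans[OF sum_abs], rule sum_mono)
        fix m assume m: "m \<in> ?R"
        then have "x $ m \<in> Sm" using x by (auto simp: vecs_def S_def split: if_splits)
        then have "0 \<le> x $ m" "of_int (x $ m) \<le> \<beta> * real M" by (auto simp: Sm_def le_floor_iff)
        then have "\<bar>of_int (x $ m) ^ k :: real\<bar> \<le> (\<beta> * real M) ^ k" by (auto simp: power_abs intro!: power_mono)
        then show "\<bar>l $ m / l $ i * of_int (x $ m) ^ k\<bar> \<le> \<bar>l $ m / l $ i\<bar> * (\<beta> * real M) ^ k"
          unfolding abs_mult by (intro mult_left_mono) auto
      qed
      also have "\<dots> = A * \<beta> ^ k * real M ^ k"
        by (simp add: A_def sum_distrib_right power_mult_distrib mult.assoc)
      finally have B: "\<bar>?B\<bar> \<le> A * \<beta> ^ k * real M ^ k" .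
      have "(\<Sum>m\<in>UNIV - {i}. l $ m * of_int (x $ m) ^ k)
          = l $ j * of_int (x $ j) ^ k + (\<Sum>m\<in>?R. l $ m * of_int (x $ m) ^ k)"
        using ij by (subst sum.remove[of _ j]) (auto intro!: sum.cong)
      then have wx: "w x = g * of_int t ^ k - ?B"
        using li by (simp add: w_def g_def t(2) power_mult_distrib sum_divide_distrib diff_divide_distrib add_divide_distrib mult.assoc)
      have tk: "(\<alpha> / 2) ^ k * real M ^ k \<le> of_int t ^ k" "of_int t ^ k \<le> \<alpha> ^ k * real M ^ k"
        unfolding power_mult_distrib[symmetric] using t(1) \<alpha> by (auto simp: Sj_def intro!: power_mono)
      define u where "u = g * (\<alpha> / 2) ^ k"
      define v where "v = g * \<alpha> ^ k"
      define y where "y = real M ^ k"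
      have y0: "y \<ge> 0" and u0: "u \<ge> 0" using g0 \<alpha> by (simp_all add: y_def u_def)
      have "u * y \<le> g * of_int t ^ k" "g * of_int t ^ k \<le> v * y"
        using mult_left_mono[OF tk(1), of g] mult_left_mono[OF tk(2), of g] g0
        by (simp_all add: u_def v_def y_def mult.assoc)
      moreover note mult_right_mono[OF Ab[folded u_def] y0] mult_right_mono[OF Ab2 y0]
        mult_right_mono[OF ga[folded v_def] y0] mult_nonneg_nonneg[OF u0 y0]
      moreover have "- (A * \<beta> ^ k * y) \<le> - ?B" "- ?B \<le> A * \<beta> ^ k * y" using B by (auto simp: y_def)
      moreover have "u / 2 * y = u * y / 2" "(1 / 2) ^ k / 2 * y = (1 / 2) ^ k * y / 2" by simp_all
      ultimately have w1: "w x \<ge> 0" "w x \<le> (1 / 2) ^ k * real M ^ k"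
        unfolding wx y_def[symmetric] by linarith+
      show "0 \<le> root k (w x)" "root k (w x) ^ k = w x" using w1 k by auto
      have "root k (w x) \<le> root k ((real M / 2) ^ k)"
        using w1 k by (subst real_root_le_iff) (auto simp: power_divide)
      then show "root k (w x) \<le> real M / 2" using k by (simp add: real_root_power_cancel)
    qed
    have inj: "inj_on \<phi> (vecs S \<times> {0..<int H})"
    proof (rule inj_onI, clarify)
      fix x b y d assume xy: "x \<in> vecs S" "y \<in> vecs S" and eq: "\<phi> (x, b) = \<phi> (y, d)"
      have "x $ m = y $ m" if "m \<noteq> i" for m
        using arg_cong[OF eq, of "\<lambda>v. v $ m"] that by (simp add: \<phi>_def)
      moreover have "x $ i = 0" "y $ i = 0" using xy by (auto simp: vecs_def S_def dest!: spec[of _ i])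
      ultimately have "x = y" by (metis vec_eq_iff)
      moreover from this have "b = d" using arg_cong[OF eq, of "\<lambda>v. v $ i"] by (simp add: \<phi>_def)
      ultimately show "x = y \<and> b = d" ..
    qed
    have img: "\<phi> ` (vecs S \<times> {0..<int H}) \<subseteq> G"
    proof clarify
      fix x b assume x: "x \<in> vecs S" and b: "b \<in> {0..<int H}"
      define r where "r = root k (w x)"
      define y where "y = \<phi> (x, b)"
      note w = w[OF x, folded r_def]
      have yi: "y $ i = \<lceil>r\<rceil> + b" by (simp add: y_def \<phi>_def r_def)
      \<comment> \<open>Rounding the root up costs less than 1, which b + 1 <= H makes good.\<close>
      have b': "0 \<le> b" "b + 1 \<le> int H" using b by auto
      then have "real_of_int (b + 1) \<le> real H" by (metis of_int_le_iff of_int_of_nat_eq)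
      then have yb: "r \<le> of_int (y $ i)" "of_int (y $ i) \<le> r + real H"
        using b' unfolding yi by (auto, linarith+)
      have yM: "\<bar>of_int (y $ m)\<bar> < real M" for m
      proof -
        consider "m = i" | "m = j" | "m \<in> ?R" by blast
        then show ?thesis
        proof cases
          case 1 then show ?thesis using yb w HM by auto
        next
          case 2
          then obtain t where t: "t \<in> Sj" "y $ m = \<sigma> * t"
            using x ij by (auto simp: y_def \<phi>_def vecs_def S_def split: if_splits)
          have "0 \<le> \<alpha> * real M / 2" using \<alpha> by simp
          then have "0 \<le> real_of_int t" "real_of_int t \<le> \<alpha> * real M" using t by (auto simp: Sj_def)
          moreover have "\<alpha> * real M \<le> 1 / 2 * real M" using \<alpha> by (intro mult_right_mono) auto
          moreover have "\<bar>of_int (y $ m)\<bar> = real_of_int t"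
            using t(2) sg calculation(1) by auto
          ultimately show ?thesis using M1 by linarith
        next
          case 3
          then have "y $ m \<in> Sm" using x by (auto simp: y_def \<phi>_def vecs_def S_def split: if_splits)
          then have "0 \<le> real_of_int (y $ m)" "of_int (y $ m) \<le> \<beta> * real M" by (auto simp: Sm_def le_floor_iff)
          moreover have "\<beta> * real M \<le> 1 / 2 * real M" using \<beta> by (intro mult_right_mono) auto
          ultimately show ?thesis using M1 by linarith
        qed
      qed
      have "y $ m \<in> interv M" for m using yM[of m] by (simp add: interv_def abs_if split: if_splits; linarith)
      then have 1: "y \<in> vecs (\<lambda>_. interv M)" by (simp add: vecs_def)
      have "l \<bullet> pw k (shifted 0 y) = l $ i * of_int (y $ i) ^ k + (\<Sum>m\<in>UNIV - {i}. l $ m * of_int (y $ m) ^ k)"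
        unfolding inner_vec_def by (subst sum.remove[of _ i]) (auto simp: pw_def shifted_def)
      also have "(\<Sum>m\<in>UNIV - {i}. l $ m * of_int (y $ m) ^ k) = (\<Sum>m\<in>UNIV - {i}. l $ m * of_int (x $ m) ^ k)"
        by (intro sum.cong) (auto simp: y_def \<phi>_def)
      also have "\<dots> = - l $ i * r ^ k" using li unfolding w(3) w_def by simp
      finally have "\<bar>l \<bullet> pw k (shifted 0 y)\<bar> = \<bar>l $ i\<bar> * \<bar>of_int (y $ i) ^ k - r ^ k\<bar>"
        by (simp add: abs_mult[symmetric] right_diff_distrib)
      also have "\<dots> \<le> \<bar>l $ i\<bar> * (real k * \<bar>of_int (y $ i) - r\<bar> * real M ^ (k - 1))"
        using yM[of i] w by (intro mult_left_mono abs_power_diff_le) auto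
      also have "\<dots> \<le> \<bar>l $ i\<bar> * (real k * (real P / (2 * real k * \<bar>l $ i\<bar>)) * real M ^ (k - 1))"
        using yb H(1) by (intro mult_left_mono mult_right_mono) auto
      also have "\<dots> = (real P * real M ^ (k - 1)) / 2" using li k by simp
      also have "\<dots> < T" unfolding T using T0 by simp
      finally show "\<phi> (x, b) \<in> G" using 1 by (simp add: G_def y_def)
    qed
    have finG: "finite G" by (auto simp: G_def intro: finite_subset[OF _ finite_vecs[of "\<lambda>_. interv M"]])
    have "card (vecs S \<times> {0..<int H}) \<le> card G"
      by (rule card_inj_on_le[OF inj img finG])
    then have "real (card (vecs S) * H) \<le> real (card G)" by (simp only: of_nat_le_iff card_cartesian_product) simp
    also have "real (card G) = boxcnt k M T l"
    proof -
      have "finite (vecs (\<lambda>_::'s. interv M))" by (intro finite_vecs) simp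
      then show ?thesis unfolding boxcnt_def cnt_def G_def
        by (simp add: of_bool_def sum.If_cases Int_def)
    qed
    finally have 1: "real (card (vecs S)) * real H \<le> boxcnt k M T l" by simp
    have "(\<gamma> * real M) ^ (CARD('s) - 1) = (\<Prod>m\<in>UNIV - {i}. \<gamma> * real M)"
      by (simp add: card_Diff_singleton)
    also have "\<dots> \<le> (\<Prod>m\<in>UNIV - {i}. real (card (S m)))"
      using \<gamma> by (intro prod_mono conjI cardS) auto
    also have "\<dots> = real (card (vecs S))"
      unfolding card_vecs of_nat_prod by (subst (2) prod.remove[of _ i]) (auto simp: S_def)
    finally have 2: "(\<gamma> * real M) ^ (CARD('s) - 1) \<le> real (card (vecs S))" .
    have "c * (real M ^ (CARD('s) - 1) * real P) = (\<gamma> * real M) ^ (CARD('s) - 1) * (real P / (4 * real k * \<bar>l $ i\<bar>))"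
      by (simp add: c_def power_mult_distrib)
    also have "\<dots> \<le> real (card (vecs S)) * real H"
      using 2 H(2) \<gamma> by (intro mult_mono) auto
    also note 1
    also have "real M ^ (CARD('s) - 1) * real P = real (P ^ k) ^ CARD('s) * real P ^ (CARD('s) - k)"
    proof -
      obtain r where r: "CARD('s) = k + r" using s(1) le_Suc_ex by blast
      have "(k + 1) * (CARD('s) - 1) + 1 = k * CARD('s) + (CARD('s) - k)"
        using k unfolding r by (cases k) (auto simp: algebra_simps)
      moreover have "real M = real P ^ (k + 1)" by (simp add: M_def)
      then have "real M ^ (CARD('s) - 1) * real P = real P ^ ((k + 1) * (CARD('s) - 1) + 1)"
        by (simp only: power_add power_mult power_one_right)
      ultimately have "real M ^ (CARD('s) - 1) * real P = real P ^ (k * CARD('s) + (CARD('s) - k))"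
        by (simp only:)
      then show ?thesis by (simp only: power_add power_mult of_nat_power)
    qed
    finally show ?thesis by (simp add: M_def T_def mult.assoc)
  qed
  then show ?thesis using c0 by blast
qed

section \<open>Almost every coefficient vector\<close>

definition gridcnt :: "nat \<Rightarrow> nat \<Rightarrow> real \<Rightarrow> real ^ 's::finite \<Rightarrow> real" where
  "gridcnt k n \<tau> l = boxcnt k (n ^ (100 * k)) \<tau> l / real n ^ (100 * k * (CARD('s) - k))"

text \<open>The case m = P^k, \<tau> = 1 of the refinement, normalized to be close to
  \<open>gridcnt\<close> at tolerance 1; it carries the lower bound of \<open>boxcnt_lower\<close>
  over to that tolerance.\<close>

definition finecnt :: "nat \<Rightarrow> nat \<Rightarrow> real ^ 's::finite \<Rightarrow> real" where
  "finecnt k n l = (let P = n ^ (100 * k) in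
    boxcnt k (P ^ k * P) (real (P ^ k) ^ k) l / (real (P ^ k) ^ CARD('s) * real P ^ (CARD('s) - k)))"

text \<open>Three errors in one function, so that a single almost sure bound gives linearity in the
  tolerance, convergence along the heights and positivity of the limit.\<close>

definition defect :: "nat \<Rightarrow> nat \<Rightarrow> real ^ 's::finite \<Rightarrow> real" where
  "defect k n l = (\<Sum>i=1..n. \<bar>gridcnt k n (real i / real n) l - real i / real n * gridcnt k n 1 l\<bar>)
    + \<bar>gridcnt k n 1 l - gridcnt k (n + 1) 1 l\<bar> + \<bar>finecnt k n l - gridcnt k n 1 l\<bar>"

lemma integrable_gridcnt: "\<tau> > 0 \<Longrightarrow> integrable (lebesgue_on (cube L)) (gridcnt k n \<tau>)"
  unfolding gridcnt_def[abs_def] by (intro integrable_divide_zero integrable_boxcnt)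

lemma integrable_finecnt:
  assumes "n \<ge> 1"
  shows "integrable (lebesgue_on (cube L)) (finecnt k n)"
  unfolding finecnt_def[abs_def] Let_def using assms by (intro integrable_divide_zero integrable_boxcnt) auto

text \<open>Each of the n tolerances i / n costs O(n^-5), and their sum sets the rate n^-4; the
  other two errors are O(n^-5).\<close>

lemma mean_defect:
  assumes L: "L \<ge> 1" and k: "k \<ge> 2" and s: "CARD('s::finite) > 2 * k"
  shows "\<exists>C. \<forall>n \<ge> 8 * CARD('s) * k. (\<integral>l. defect k n l \<partial>lebesgue_on (cube L :: (real ^ 's) set)) \<le> C / real n ^ 4"
proof -
  let ?s = "CARD('s)" and ?M = "lebesgue_on (cube L) :: (real ^ 's) measure"
  let ?W = "\<lambda>n. real n ^ (100 * k * (?s - k))"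
  let ?P = "\<lambda>n. n ^ (100 * k) :: nat"
  obtain C where C: "C \<ge> 0" and dev: "\<And>n m \<tau>. n \<ge> 8 * ?s * k \<Longrightarrow> m \<ge> 1 \<Longrightarrow> 0 < \<tau> \<Longrightarrow> \<tau> \<le> 1 \<Longrightarrow>
    (\<integral>l. \<bar>boxcnt k (m * ?P n) (real m ^ k * \<tau>) l - real m ^ ?s * \<tau> * boxcnt k (?P n) 1 l\<bar> \<partial>?M)
      \<le> real m ^ ?s * (C * ?W n / real n ^ 5)"
    using mean_boxcnt[OF L k s] by blast
  define K where "K = (2 :: real) ^ (100 * k * k)"
  have "(\<integral>l. defect k n l \<partial>?M) \<le> (C * (K + 3)) / real n ^ 4" if n: "n \<ge> 8 * ?s * k" for n
  proof -
    have "8 * ?s * k \<ge> 1" using k s by (simp add: Suc_leI)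
    then have n1: "n \<ge> 1" using n by linarith
    have W0: "?W n > 0" "?W (n + 1) > 0" using n1 by simp_all
    have dev': "(\<integral>l. \<bar>boxcnt k (m * ?P n) (real m ^ k * \<tau>) l / (real m ^ ?s * ?W n) - \<tau> * gridcnt k n 1 l\<bar> \<partial>?M) \<le> C / real n ^ 5"
      if "n \<ge> 8 * ?s * k" "m \<ge> 1" "0 < \<tau>" "\<tau> \<le> 1" for n m \<tau>
    proof -
      have "n \<ge> 1" using that(1) \<open>8 * ?s * k \<ge> 1\<close> by linarith
      then have pos: "real m ^ ?s * ?W n > 0" using that by simp
      have "\<bar>boxcnt k (m * ?P n) (real m ^ k * \<tau>) l / (real m ^ ?s * ?W n) - \<tau> * gridcnt k n 1 l\<bar>
        = \<bar>boxcnt k (m * ?P n) (real m ^ k * \<tau>) l - real m ^ ?s * \<tau> * boxcnt k (?P n) 1 l\<bar> / (real m ^ ?s * ?W n)" for l :: "real ^ 's"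
      proof -
        have "boxcnt k (m * ?P n) (real m ^ k * \<tau>) l / (real m ^ ?s * ?W n) - \<tau> * gridcnt k n 1 l
          = (boxcnt k (m * ?P n) (real m ^ k * \<tau>) l - real m ^ ?s * \<tau> * boxcnt k (?P n) 1 l) / (real m ^ ?s * ?W n)"
          using pos that by (simp add: gridcnt_def diff_divide_distrib)
        then show ?thesis using pos by (metis abs_divide abs_of_pos)
      qed
      then have "(\<integral>l. \<bar>boxcnt k (m * ?P n) (real m ^ k * \<tau>) l / (real m ^ ?s * ?W n) - \<tau> * gridcnt k n 1 l\<bar> \<partial>?M)
        = (\<integral>l. \<bar>boxcnt k (m * ?P n) (real m ^ k * \<tau>) l - real m ^ ?s * \<tau> * boxcnt k (?P n) 1 l\<bar> \<partial>?M) / (real m ^ ?s * ?W n)"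
        by (simp only: integral_divide_zero)
      also have "\<dots> \<le> (real m ^ ?s * (C * ?W n / real n ^ 5)) / (real m ^ ?s * ?W n)"
        using pos by (intro divide_right_mono dev that) auto
      also have "\<dots> = C / real n ^ 5" using that(2) \<open>n \<ge> 1\<close> by simp
      finally show ?thesis .
    qed
    have n5: "C / real n ^ 5 \<le> C / real n ^ 4"
      using n1 C by (intro divide_left_mono power_increasing) auto
    have 1: "(\<integral>l. (\<Sum>i=1..n. \<bar>gridcnt k n (real i / real n) l - real i / real n * gridcnt k n 1 l\<bar>) \<partial>?M) \<le> C / real n ^ 4"
    proof -
      have "(\<integral>l. (\<Sum>i=1..n. \<bar>gridcnt k n (real i / real n) l - real i / real n * gridcnt k n 1 l\<bar>) \<partial>?M)
        = (\<Sum>i=1..n. \<integral>l. \<bar>gridcnt k n (real i / real n) l - real i / real n * gridcnt k n 1 l\<bar> \<partial>?M)"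
        by (intro Bochner_Integration.integral_sum integrable_abs Bochner_Integration.integrable_diff
            integrable_mult_right integrable_gridcnt) auto
      also have "\<dots> \<le> (\<Sum>i=1..n. C / real n ^ 5)"
      proof (rule sum_mono)
        fix i assume "i \<in> {1..n}"
        then have "0 < real i / real n" "real i / real n \<le> 1" using n1 by simp_all
        from dev'[OF n _ this, of 1]
        show "(\<integral>l. \<bar>gridcnt k n (real i / real n) l - real i / real n * gridcnt k n 1 l\<bar> \<partial>?M) \<le> C / real n ^ 5"
          by (simp add: gridcnt_def)
      qed
      also have "\<dots> = C / real n ^ 4" using n1 by (simp add: power_numeral_reduce)
      finally show ?thesis .
    qed
    have 2: "(\<integral>l. \<bar>gridcnt k n 1 l - gridcnt k (n + 1) 1 l\<bar> \<partial>?M) \<le> C * (K + 1) / real n ^ 4"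
    proof -
      define p q where "p = real (?P n)" and "q = real (?P (n + 1))"
      have pq: "0 < p" "p \<le> q" using n1 by (auto simp: p_def q_def intro!: power_mono)
      \<comment> \<open>The common refinement has height pq and tolerance p^k: seen from q it is m =
        p with tolerance 1, seen from p it is m = q with tolerance (p / q)^k. The choice q^k would
        need a tolerance above 1 at height q.\<close>
      define \<tau> where "\<tau> = (p / q) ^ k"
      have t: "0 < \<tau>" "\<tau> \<le> 1" using pq by (auto simp: \<tau>_def intro!: power_le_one)
      have pw: "?W n = p ^ (?s - k)" "?W (n + 1) = q ^ (?s - k)"
        by (simp_all add: p_def q_def power_mult)
      have qt: "q ^ k * \<tau> = p ^ k" using pq by (simp add: \<tau>_def power_mult_distrib[symmetric])
      define h where "h l = boxcnt k (?P n * ?P (n + 1)) (p ^ k) l" for l :: "real ^ 's"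
      have inth: "integrable ?M h" unfolding h_def[abs_def] using pq by (intro integrable_boxcnt) auto
      have int1: "integrable ?M (\<lambda>l. \<bar>h l / (q ^ ?s * ?W n) - \<tau> * gridcnt k n 1 l\<bar>)"
        "integrable ?M (\<lambda>l. \<bar>h l / (p ^ ?s * ?W (n + 1)) - 1 * gridcnt k (n + 1) 1 l\<bar>)"
        by (intro integrable_abs Bochner_Integration.integrable_diff integrable_mult_right integrable_gridcnt
            integrable_divide_zero inth; simp)+
      have e1: "(\<integral>l. \<bar>h l / (q ^ ?s * ?W n) - \<tau> * gridcnt k n 1 l\<bar> \<partial>?M) \<le> C / real n ^ 5"
        using dev'[OF n _ t, of "?P (n + 1)"] n1 qt unfolding q_def[symmetric] h_def by (simp add: mult.commute)
      have "(\<integral>l. \<bar>h l / (p ^ ?s * ?W (n + 1)) - 1 * gridcnt k (n + 1) 1 l\<bar> \<partial>?M) \<le> C / real (n + 1) ^ 5"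
        using dev'[of "n + 1" "?P n" 1] n n1 unfolding p_def[symmetric] h_def by simp
      also have "\<dots> \<le> C / real n ^ 5" using n1 C by (intro divide_left_mono power_mono) auto
      finally have e2: "(\<integral>l. \<bar>h l / (p ^ ?s * ?W (n + 1)) - 1 * gridcnt k (n + 1) 1 l\<bar> \<partial>?M) \<le> C / real n ^ 5" .
      \<comment> \<open>Division by \<tau> costs only a constant, because (n + 1) / n <= 2.\<close>
      have t1: "1 / \<tau> \<le> K"
      proof -
        have "real (n + 1) \<le> 2 * real n" using n1 by simp
        then have "real (n + 1) / real n \<le> 2" using n1 by (simp add: divide_le_eq)
        then have "(real (n + 1) / real n) ^ (100 * k * k) \<le> 2 ^ (100 * k * k)" by (intro power_mono) auto
        moreover have "1 / \<tau> = (real (n + 1) / real n) ^ (100 * k * k)"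
          by (simp add: \<tau>_def p_def q_def power_divide power_mult)
        ultimately show ?thesis by (simp add: K_def)
      qed
      have "h l / (q ^ ?s * ?W n) / \<tau> = h l / (p ^ ?s * ?W (n + 1))" for l
      proof -
        have "q ^ ?s * ?W n * \<tau> = p ^ ?s * ?W (n + 1)"
        proof -
          have sk: "?s = (?s - k) + k" using s by simp
          have "q ^ ?s * p ^ (?s - k) * \<tau> = q ^ (?s - k) * p ^ (?s - k) * (q ^ k * \<tau>)"
            by (subst sk) (simp add: power_add)
          also have "\<dots> = p ^ ((?s - k) + k) * q ^ (?s - k)" unfolding qt power_add by simp
          finally show ?thesis unfolding pw using sk by simp
        qed
        then show ?thesis by (metis divide_divide_eq_left)
      qed
      then have ptw: "\<bar>gridcnt k n 1 l - gridcnt k (n + 1) 1 l\<bar>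
          \<le> (1 / \<tau>) * \<bar>h l / (q ^ ?s * ?W n) - \<tau> * gridcnt k n 1 l\<bar> + \<bar>h l / (p ^ ?s * ?W (n + 1)) - 1 * gridcnt k (n + 1) 1 l\<bar>" for l :: "real ^ 's"
      proof -
        have "(1 / \<tau>) * \<bar>h l / (q ^ ?s * ?W n) - \<tau> * gridcnt k n 1 l\<bar> = \<bar>(h l / (q ^ ?s * ?W n) - \<tau> * gridcnt k n 1 l) / \<tau>\<bar>"
          using t by (simp add: abs_divide)
        also have "(h l / (q ^ ?s * ?W n) - \<tau> * gridcnt k n 1 l) / \<tau> = h l / (p ^ ?s * ?W (n + 1)) - gridcnt k n 1 l"
          using t \<open>\<And>l. h l / (q ^ ?s * ?W n) / \<tau> = h l / (p ^ ?s * ?W (n + 1))\<close> by (simp add: diff_divide_distrib)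
        finally show ?thesis by linarith
      qed
      have "(\<integral>l. \<bar>gridcnt k n 1 l - gridcnt k (n + 1) 1 l\<bar> \<partial>?M)
        \<le> (\<integral>l. (1 / \<tau>) * \<bar>h l / (q ^ ?s * ?W n) - \<tau> * gridcnt k n 1 l\<bar> + \<bar>h l / (p ^ ?s * ?W (n + 1)) - 1 * gridcnt k (n + 1) 1 l\<bar> \<partial>?M)"
        by (intro integral_mono ptw Bochner_Integration.integrable_add integrable_mult_right int1
            integrable_abs Bochner_Integration.integrable_diff integrable_gridcnt) auto
      also have "\<dots> = (1 / \<tau>) * (\<integral>l. \<bar>h l / (q ^ ?s * ?W n) - \<tau> * gridcnt k n 1 l\<bar> \<partial>?M)
          + (\<integral>l. \<bar>h l / (p ^ ?s * ?W (n + 1)) - 1 * gridcnt k (n + 1) 1 l\<bar> \<partial>?M)"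
        by (simp only: Bochner_Integration.integral_add[OF integrable_mult_right[OF int1(1)] int1(2)] integral_mult_right_zero)
      also have "\<dots> \<le> K * (C / real n ^ 5) + C / real n ^ 5"
        using t1 e1 e2 t by (intro add_mono mult_mono) (auto intro: order.trans[OF _ t1])
      also have "\<dots> = (K + 1) * (C / real n ^ 5)" by (simp only: distrib_right mult_1_left)
      also have "\<dots> \<le> (K + 1) * (C / real n ^ 4)" using n5 by (intro mult_left_mono) (auto simp: K_def)
      finally show ?thesis by (simp add: mult.commute)
    qed
    have 3: "(\<integral>l. \<bar>finecnt k n l - gridcnt k n 1 l\<bar> \<partial>?M) \<le> C / real n ^ 4"
    proof -
      have Wp: "real (?P n) ^ (?s - k) = ?W n" by (simp add: power_mult)
      have "(\<integral>l. \<bar>finecnt k n l - gridcnt k n 1 l\<bar> \<partial>?M) \<le> C / real n ^ 5"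
        using dev'[OF n _ zero_less_one order_refl, of "?P n ^ k"] n1 unfolding finecnt_def Let_def Wp by simp
      then show ?thesis using n5 by linarith
    qed
    have i1: "integrable ?M (\<lambda>l. \<Sum>i=1..n. \<bar>gridcnt k n (real i / real n) l - real i / real n * gridcnt k n 1 l\<bar>)"
      by (intro Bochner_Integration.integrable_sum integrable_abs Bochner_Integration.integrable_diff
            integrable_mult_right integrable_gridcnt) auto
    have i2: "integrable ?M (\<lambda>l. \<bar>gridcnt k n 1 l - gridcnt k (n + 1) 1 l\<bar>)"
      by (intro integrable_abs Bochner_Integration.integrable_diff integrable_gridcnt) auto
    have i3: "integrable ?M (\<lambda>l. \<bar>finecnt k n l - gridcnt k n 1 l\<bar>)"
      by (intro integrable_abs Bochner_Integration.integrable_diff integrable_gridcnt integrable_finecnt n1) auto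
    have "(\<integral>l. defect k n l \<partial>?M) \<le> C / real n ^ 4 + C * (K + 1) / real n ^ 4 + C / real n ^ 4"
      unfolding defect_def
        Bochner_Integration.integral_add[OF Bochner_Integration.integrable_add[OF i1 i2] i3]
        Bochner_Integration.integral_add[OF i1 i2]
      by (intro add_mono 1 2 3)
    also have "\<dots> = C * (K + 3) / real n ^ 4" by (simp add: add_divide_distrib[symmetric] algebra_simps)
    finally show ?thesis .
  qed
  then show ?thesis by blast
qed

section \<open>From means to almost every vector\<close>

lemma integrable_defect:
  assumes "n \<ge> 1"
  shows "integrable (lebesgue_on (cube L)) (defect k n)"
  unfolding defect_def[abs_def] using assms
  by (intro Bochner_Integration.integrable_add Bochner_Integration.integrable_sum integrable_abs
      Bochner_Integration.integrable_diff integrable_mult_right integrable_gridcnt integrable_finecnt) auto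

lemma defect_nonneg: "defect k n l \<ge> 0"
  by (simp add: defect_def sum_nonneg)

text \<open>The weight n^2 leaves means of order n^-2, which are summable. The means are taken over
  bounded cubes, and countably many of these exhaust the space.\<close>

lemma AE_defect_bounded:
  assumes k: "k \<ge> 2" and s: "CARD('s::finite) > 2 * k"
  shows "AE l :: real ^ 's in lebesgue. \<exists>B. \<forall>n \<ge> 8 * CARD('s) * k. real n ^ 2 * defect k n l \<le> B"
proof -
  let ?n0 = "8 * CARD('s) * k"
  have n0: "?n0 \<ge> 1" using k s by (simp add: Suc_leI)
  have "AE l :: real ^ 's in lebesgue. l \<in> cube (real L + 1) \<longrightarrow> (\<exists>B. \<forall>n \<ge> ?n0. real n ^ 2 * defect k n l \<le> B)" for L :: nat
  proof -
    let ?M = "lebesgue_on (cube (real L + 1)) :: (real ^ 's) measure"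
    obtain C where C: "\<And>n. n \<ge> ?n0 \<Longrightarrow> (\<integral>l. defect k n l \<partial>?M) \<le> C / real n ^ 4"
      using mean_defect[OF _ k s, of "real L + 1"] by auto
    have "AE l in ?M. \<exists>B. \<forall>n. real (n + ?n0) ^ 2 * defect k (n + ?n0) l \<le> B"
    proof (rule AE_bounded_of_summable)
      fix n
      show "integrable ?M (\<lambda>l. real (n + ?n0) ^ 2 * defect k (n + ?n0) l)"
        using n0 by (intro integrable_mult_right integrable_defect) linarith
      show "0 \<le> real (n + ?n0) ^ 2 * defect k (n + ?n0) l" for l :: "real ^ 's"
        by (simp add: defect_nonneg)
      have pos: "real (n + ?n0) > 0" using n0 by linarith
      have "(\<integral>l. real (n + ?n0) ^ 2 * defect k (n + ?n0) l \<partial>?M) = real (n + ?n0) ^ 2 * (\<integral>l. defect k (n + ?n0) l \<partial>?M)"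
        by simp
      also have "\<dots> \<le> real (n + ?n0) ^ 2 * (C / real (n + ?n0) ^ 4)"
        by (intro mult_left_mono C) auto
      also have "\<dots> = C * inverse (real (n + ?n0) ^ 2)"
        using pos by (simp add: power_numeral_reduce divide_simps)
      finally show "(\<integral>l. real (n + ?n0) ^ 2 * defect k (n + ?n0) l \<partial>?M) \<le> C * inverse (real (n + ?n0) ^ 2)" .
    next
      show "summable (\<lambda>n. C * inverse (real (n + ?n0) ^ 2))"
        using inverse_power_summable[of 2, where 'a = real]
        by (intro summable_mult summable_ignore_initial_segment[of "\<lambda>n. inverse (real n ^ 2)"]) auto
    qed
    then have "AE l :: real ^ 's in lebesgue. l \<in> cube (real L + 1) \<longrightarrow> (\<exists>B. \<forall>n. real (n + ?n0) ^ 2 * defect k (n + ?n0) l \<le> B)"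
      by (subst (asm) AE_restrict_space_iff) (auto simp: fmeasurableD)
    then show ?thesis
    proof (rule AE_mp, intro AE_I2 impI)
      fix l :: "real ^ 's"
      assume "l \<in> cube (real L + 1) \<longrightarrow> (\<exists>B. \<forall>n. real (n + ?n0) ^ 2 * defect k (n + ?n0) l \<le> B)" "l \<in> cube (real L + 1)"
      then obtain B where "\<And>n. real (n + ?n0) ^ 2 * defect k (n + ?n0) l \<le> B" by blast
      then have "real n ^ 2 * defect k n l \<le> B" if "n \<ge> ?n0" for n
        using that by (metis le_add_diff_inverse2)
      then show "\<exists>B. \<forall>n \<ge> ?n0. real n ^ 2 * defect k n l \<le> B" by blast
    qed
  qed
  then have "AE l :: real ^ 's in lebesgue. \<forall>L :: nat. l \<in> cube (real L + 1) \<longrightarrow> (\<exists>B. \<forall>n \<ge> ?n0. real n ^ 2 * defect k n l \<le> B)"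
    by (subst AE_all_countable) auto
  then show ?thesis
  proof (rule AE_mp, intro AE_I2 impI)
    fix l :: "real ^ 's"
    assume *: "\<forall>L :: nat. l \<in> cube (real L + 1) \<longrightarrow> (\<exists>B. \<forall>n \<ge> ?n0. real n ^ 2 * defect k n l \<le> B)"
    have "\<bar>l $ m\<bar> \<le> real (nat \<lceil>norm l\<rceil>) + 1" for m
      using component_le_norm_cart[of l m] by linarith
    then have "l \<in> cube (real (nat \<lceil>norm l\<rceil>) + 1)" by (simp add: in_cube)
    then show "\<exists>B. \<forall>n \<ge> ?n0. real n ^ 2 * defect k n l \<le> B" using * by blast
  qed
qed

section \<open>Interpolation between the grid points\<close>

lemma solutions_eq:
  "solutions k l P \<tau> = {x. (\<forall>m. \<bar>real_of_int (x $ m)\<bar> \<le> P) \<and> \<bar>l \<bullet> pw k (shifted 0 x)\<bar> < \<tau>}"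
proof -
  have "real_of_int (max_norm x) \<le> P \<longleftrightarrow> (\<forall>m. \<bar>real_of_int (x $ m)\<bar> \<le> P)" for x :: "int ^ 'a"
    by (simp only: le_floor_iff[symmetric] max_norm_le_iff of_int_abs[symmetric])
  then show ?thesis by (simp add: solutions_def inner_vec_def pw_def shifted_def)
qed

lemma boxcnt_eq_card: "boxcnt k P \<tau> l = real (card {x \<in> vecs (\<lambda>_. interv P). \<bar>l \<bullet> pw k (shifted 0 x)\<bar> < \<tau>})"
proof -
  have "finite (vecs (\<lambda>_::'a. interv P))" by (intro finite_vecs) simp
  then show ?thesis unfolding boxcnt_def cnt_def by (simp add: of_bool_def sum.If_cases Int_def)
qed

lemma boxcnt_le_N:
  assumes "real P \<le> Q" "\<tau>' \<le> \<tau>"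
  shows "boxcnt k P \<tau>' l \<le> real (N k l Q \<tau>)"
  unfolding N_def solutions_eq boxcnt_eq_card of_nat_le_iff
proof (rule card_mono)
  show "finite {x. (\<forall>m. \<bar>real_of_int (x $ m)\<bar> \<le> Q) \<and> \<bar>l \<bullet> pw k (shifted 0 x)\<bar> < \<tau>}"
    using finite_solutions[of k l Q \<tau>] unfolding solutions_eq .
  have "\<bar>real_of_int (x $ m)\<bar> \<le> Q" if "x \<in> vecs (\<lambda>_. interv P)" for x :: "int ^ 'a" and m
  proof -
    have "\<bar>x $ m\<bar> \<le> int P" using that by (auto simp: vecs_def interv_def abs_le_iff dest!: spec[of _ m])
    then have "real_of_int \<bar>x $ m\<bar> \<le> real_of_int (int P)" by (simp only: of_int_le_iff)
    then show ?thesis using assms by simp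
  qed
  then show "{x \<in> vecs (\<lambda>_. interv P). \<bar>l \<bullet> pw k (shifted 0 x)\<bar> < \<tau>'}
    \<subseteq> {x. (\<forall>m. \<bar>real_of_int (x $ m)\<bar> \<le> Q) \<and> \<bar>l \<bullet> pw k (shifted 0 x)\<bar> < \<tau>}"
    using assms by auto
qed

text \<open>The strict inequality makes up for the end point P missing from \<open>interv P\<close>;
  together with \<open>boxcnt_le_N\<close> it fits the ranges n^(100k) <= P < (n+1)^(100k).\<close>

lemma N_le_boxcnt:
  assumes "Q < real P" "\<tau> \<le> \<tau>'"
  shows "real (N k l Q \<tau>) \<le> boxcnt k P \<tau>' l"
  unfolding N_def solutions_eq boxcnt_eq_card of_nat_le_iff
proof (rule card_mono)
  show "finite {x \<in> vecs (\<lambda>_. interv P). \<bar>l \<bullet> pw k (shifted 0 x)\<bar> < \<tau>'}"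
    using finite_vecs[of "\<lambda>_. interv P"] by auto
  have "x \<in> vecs (\<lambda>_. interv P)" if "\<And>m. \<bar>real_of_int (x $ m)\<bar> \<le> Q" for x :: "int ^ 'a"
  proof -
    have "x $ m \<in> interv P" for m
    proof -
      have "real_of_int \<bar>x $ m\<bar> < real_of_int (int P)" using that[of m] assms(1) by simp
      then have "\<bar>x $ m\<bar> < int P" by (simp only: of_int_less_iff)
      then show ?thesis by (auto simp: interv_def)
    qed
    then show ?thesis by (simp add: vecs_def)
  qed
  then show "{x. (\<forall>m. \<bar>real_of_int (x $ m)\<bar> \<le> Q) \<and> \<bar>l \<bullet> pw k (shifted 0 x)\<bar> < \<tau>}
    \<subseteq> {x \<in> vecs (\<lambda>_. interv P). \<bar>l \<bullet> pw k (shifted 0 x)\<bar> < \<tau>'}"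
    using assms by auto
qed

text \<open>Since 1 / n^2 <= 2 (1 / n - 1 / (n + 1)), the steps telescope; this is the origin of the
  2.\<close>

lemma convergent_of_inverse_square_steps:
  fixes R :: "nat \<Rightarrow> real"
  assumes B: "B \<ge> 0" and n0: "n0 \<ge> 1" and step: "\<And>n. n \<ge> n0 \<Longrightarrow> \<bar>R n - R (n + 1)\<bar> \<le> B / real n ^ 2"
  obtains J where "R \<longlonglongrightarrow> J" "\<And>n. n \<ge> n0 \<Longrightarrow> \<bar>R n - J\<bar> \<le> 2 * B / real n"
proof -
  have tele: "\<bar>R n - R (n + d)\<bar> \<le> 2 * B * (1 / real n - 1 / real (n + d))" if n: "n \<ge> n0" for n d
  proof (induction d)
    case (Suc d)
    define x where "x = real (n + d)"
    have x: "x \<ge> 1" "real (n + Suc d) = x + 1" using n n0 by (auto simp: x_def)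
    have "1 / x ^ 2 \<le> 2 * (1 / x - 1 / (x + 1))"
      using x by (simp add: divide_simps power2_eq_square)
    then have "B * (1 / x ^ 2) \<le> B * (2 * (1 / x - 1 / (x + 1)))" using B by (rule mult_left_mono)
    also have "B * (2 * c) = 2 * B * c" for c by simp
    finally have "B / x ^ 2 \<le> 2 * B * (1 / x - 1 / (x + 1))" by simp
    moreover have "\<bar>R (n + d) - R (n + Suc d)\<bar> \<le> B / x ^ 2" using step[of "n + d"] n by (simp add: x_def)
    ultimately have "\<bar>R n - R (n + Suc d)\<bar> \<le> 2 * B * (1 / real n - 1 / x) + 2 * B * (1 / x - 1 / (x + 1))"
      using Suc unfolding x_def[symmetric] by linarith
    also have "\<dots> = 2 * B * (1 / real n - 1 / (x + 1))" by (simp add: algebra_simps)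
    finally show ?case unfolding x(2) .
  qed simp
  have tail: "\<bar>R n - R m\<bar> \<le> 2 * B / real n" if "n \<ge> n0" "m \<ge> n" for n m
  proof -
    have "\<bar>R n - R m\<bar> \<le> 2 * B * (1 / real n - 1 / real m)"
      using tele[OF that(1), of "m - n"] that(2) by simp
    also have "\<dots> \<le> 2 * B * (1 / real n)" using B by (intro mult_left_mono) auto
    finally show ?thesis by simp
  qed
  have "Cauchy R"
  proof (rule metric_CauchyI)
    fix e :: real assume e: "e > 0"
    obtain n1 :: nat where n1: "real n1 > 4 * B / e" using reals_Archimedean2 by blast
    define n where "n = max n0 n1"
    have n: "n \<ge> n0" "real n \<ge> real n1" by (auto simp: n_def)
    have "real n > 0" using n n0 by simp
    moreover have "4 * B / e < real n" using n1 n(2) by linarith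
    ultimately have s: "2 * (2 * B / real n) < e" using e by (simp add: field_simps)
    show "\<exists>M. \<forall>m\<ge>M. \<forall>p\<ge>M. dist (R m) (R p) < e"
    proof (intro exI allI impI)
      fix m p assume "m \<ge> n" "p \<ge> n"
      then show "dist (R m) (R p) < e"
        using tail[OF n(1), of m] tail[OF n(1), of p] s by (simp add: dist_real_def)
    qed
  qed
  then obtain J where J: "R \<longlonglongrightarrow> J" using Cauchy_convergent_iff convergent_def by blast
  have "\<bar>R n - J\<bar> \<le> 2 * B / real n" if "n \<ge> n0" for n
  proof (rule LIMSEQ_le_const2)
    show "(\<lambda>m. \<bar>R n - R m\<bar>) \<longlonglongrightarrow> \<bar>R n - J\<bar>" by (intro tendsto_intros J)
    show "\<exists>M. \<forall>m\<ge>M. \<bar>R n - R m\<bar> \<le> 2 * B / real n" using tail[OF that] by blast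
  qed
  then show ?thesis using J that by blast
qed

text \<open>Here 8^(-2k) = 64^-k, and 100k < 64^k from k = 2 on. The strict gap between the
  exponents is what absorbs the constant of the error term at the end.\<close>

lemma delta_lt:
  assumes "k \<ge> 2"
  shows "(8 :: real) powr (- 2 * real k) < 1 / real (100 * k)"
proof -
  have "100 * k < (64 :: nat) ^ k" using assms
  proof (induction k rule: nat_induct_at_least)
    case (Suc k) then show ?case by simp
  qed simp
  then have "real (100 * k) < real (64 ^ k)" by (simp only: of_nat_less_iff)
  then have 1: "real (100 * k) < 64 ^ k" by simp
  have "(8 :: real) powr (- 2 * real k) = 1 / 64 ^ k"
  proof -
    have "(8 :: real) powr (- 2 * real k) = (8 powr (- 2)) powr real k" by (simp only: powr_powr)
    also have "(8 :: real) powr (- 2) = 1 / 64" by (simp add: powr_neg_numeral)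
    also have "(1 / 64 :: real) powr real k = (1 / 64) ^ k" by (rule powr_realpow) simp
    also have "\<dots> = 1 / 64 ^ k" by (rule power_one_over)
    finally show ?thesis .
  qed
  also have "\<dots> < 1 / real (100 * k)"
    using 1 assms by (intro divide_strict_left_mono mult_pos_pos) auto
  finally show ?thesis .
qed

text \<open>T stands for P^(s-k), W and W' for its values at neighbouring grid heights with relative
  gap K / x, and E / x for the error of the normalized counts.\<close>

lemma two_sided:
  fixes N T J0 E K x \<tau> p :: real
  assumes x: "x \<ge> 1" and p: "0 \<le> J0" "0 \<le> E" "0 \<le> K" "0 < \<tau>" "\<tau> \<le> 1" "0 \<le> W" "W \<le> T" "T \<le> W'" "W' \<le> (1 + K / x) * W" "0 \<le> N"
    and up: "N \<le> W' * (\<tau> * J0 + E / x)" and lo: "W * (\<tau> * J0 - E / x) \<le> N"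
  shows "\<bar>N - \<tau> * J0 * T\<bar> \<le> (K * (J0 + E) + E) / x * T"
proof -
  have x0: "x > 0" using x by simp
  have T0: "T \<ge> 0" using p by linarith
  have a0: "\<tau> * J0 \<ge> 0" using p by simp
  have a1: "\<tau> * J0 \<le> J0" using p by (simp add: mult_left_le_one_le)
  have e0: "E / x \<ge> 0" "E / x \<le> E" using p x by (simp_all add: divide_le_eq mult_le_cancel_left1)
  have kx: "K / x \<ge> 0" using p x0 by simp
  have W'T: "W' \<le> (1 + K / x) * T"
    using p kx by (intro order.trans[OF p(9)] mult_left_mono) auto
  have "N \<le> ((1 + K / x) * T) * (\<tau> * J0 + E / x)"
    using a0 e0 W'T by (intro order.trans[OF up] mult_right_mono) auto
  also have "\<dots> = \<tau> * J0 * T + (K / x * (\<tau> * J0 + E / x) + E / x) * T" by (simp add: algebra_simps)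
  also have "\<dots> \<le> \<tau> * J0 * T + (K / x * (J0 + E) + E / x) * T"
    using kx a1 e0 T0 by (intro add_left_mono mult_right_mono add_right_mono mult_left_mono) auto
  finally have 1: "N - \<tau> * J0 * T \<le> (K * (J0 + E) + E) / x * T" by (simp add: add_divide_distrib)
  have "\<tau> * J0 * T - (K * (J0 + E) + E) / x * T \<le> N"
  proof (cases "\<tau> * J0 - E / x \<ge> 0")
    case True
    have "T \<le> W + K / x * W" using p(8,9) by (simp add: algebra_simps)
    also have "\<dots> \<le> W + K / x * T" using p kx by (intro add_left_mono mult_left_mono) auto
    finally have "T - K / x * T \<le> W" by simp
    then have "(T - K / x * T) * (\<tau> * J0 - E / x) \<le> W * (\<tau> * J0 - E / x)" using True by (rule mult_right_mono)
    then have "(T - K / x * T) * (\<tau> * J0 - E / x) \<le> N" using lo by linarith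
    moreover have "(T - K / x * T) * (\<tau> * J0 - E / x) = \<tau> * J0 * T - E / x * T - K / x * T * (\<tau> * J0 - E / x)"
      by (simp add: algebra_simps)
    moreover have "K / x * T * (\<tau> * J0 - E / x) \<le> K / x * T * (J0 + E)"
      using a1 e0 p mult_nonneg_nonneg[OF kx T0] by (intro mult_left_mono) linarith+
    moreover have "(K * (J0 + E) + E) / x * T = K / x * T * (J0 + E) + E / x * T"
      by (simp add: add_divide_distrib algebra_simps)
    moreover have "a - r \<le> N" if "X \<le> N" "X = a - b - c" "c \<le> d" "r = d + b" for X a b c d r
      using that by linarith
    ultimately show ?thesis by blast
  next
    case False
    \<comment> \<open>The main term is itself no larger than the permitted error, so N >= 0
      suffices.\<close>
    have "\<tau> * J0 * T \<le> E / x * T" using False T0 by (intro mult_right_mono) auto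
    moreover have "(K * (J0 + E) + E) / x * T = K / x * (J0 + E) * T + E / x * T"
      by (simp add: add_divide_distrib algebra_simps)
    moreover have "K / x * (J0 + E) * T \<ge> 0"
      using kx T0 p by (intro mult_nonneg_nonneg add_nonneg_nonneg)
    ultimately show ?thesis using p by linarith
  qed
  then show ?thesis using 1 by linarith
qed

lemma asymptotic_of_defect_bounded:
  fixes l :: "real ^ 's::finite"
  assumes k: "k \<ge> 2" and s: "CARD('s) > 2 * k" and l: "l \<in> Lambda_k k"
    and bd: "\<And>n. n \<ge> n0 \<Longrightarrow> real n ^ 2 * defect k n l \<le> B" and n0: "n0 \<ge> 1"
  shows "\<exists>J>0. \<exists>D. \<exists>n1 \<ge> 1. \<forall>n \<ge> n1. \<forall>P \<tau>. real n ^ (100 * k) \<le> P \<longrightarrow> P < real (n + 1) ^ (100 * k) \<longrightarrow> 0 < \<tau> \<longrightarrow> \<tau> \<le> 1 \<longrightarrow>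
    \<bar>real (N k l P \<tau>) - \<tau> * J * P ^ (CARD('s) - k)\<bar> \<le> D / real n * P ^ (CARD('s) - k)"
proof -
  let ?s = "CARD('s)"
  let ?W = "\<lambda>n. real n ^ (100 * k * (?s - k))"
  have B: "B \<ge> 0" using bd[of n0] defect_nonneg[of k n0 l] by (meson mult_nonneg_nonneg order.trans order_refl zero_le_power2)
  have def: "defect k n l \<le> B / real n ^ 2" if "n \<ge> n0" for n
    using bd[OF that] that n0 by (simp add: pos_le_divide_eq mult.commute)
  define R where "R n = gridcnt k n 1 l" for n
  have step: "\<bar>R n - R (n + 1)\<bar> \<le> B / real n ^ 2" "\<bar>finecnt k n l - R n\<bar> \<le> B / real n ^ 2"
    "i \<in> {1..n} \<Longrightarrow> \<bar>gridcnt k n (real i / real n) l - real i / real n * R n\<bar> \<le> B / real n ^ 2" if "n \<ge> n0" for n i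
  proof -
    let ?f = "\<lambda>i. \<bar>gridcnt k n (real i / real n) l - real i / real n * R n\<bar>"
    have d: "sum ?f {1..n} + \<bar>R n - R (n + 1)\<bar> + \<bar>finecnt k n l - R n\<bar> \<le> B / real n ^ 2"
      using def[OF that] by (simp add: defect_def R_def)
    have "sum ?f {1..n} \<ge> 0" by (simp add: sum_nonneg)
    then show "\<bar>R n - R (n + 1)\<bar> \<le> B / real n ^ 2" "\<bar>finecnt k n l - R n\<bar> \<le> B / real n ^ 2" using d by linarith+
    assume "i \<in> {1..n}"
    then have "?f i \<le> sum ?f {1..n}" by (intro member_le_sum) auto
    then show "?f i \<le> B / real n ^ 2" using d by linarith
  qed
  obtain J where RJ: "R \<longlonglongrightarrow> J" and J: "\<And>n. n \<ge> n0 \<Longrightarrow> \<bar>R n - J\<bar> \<le> 2 * B / real n"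
    using convergent_of_inverse_square_steps[OF B n0 step(1)] by blast
  have J0: "J > 0"
  proof -
    have s1: "?s \<ge> k" "?s \<ge> 2" using s k by linarith+
    obtain c P0 where c: "c > 0" and low: "\<And>P. P \<ge> P0 \<Longrightarrow> c * real (P ^ k) ^ ?s * real P ^ (?s - k) \<le> boxcnt k (P ^ k * P) (real (P ^ k) ^ k) l"
      using boxcnt_lower[OF l k s1] by blast
    \<comment> \<open>\<open>boxcnt_lower\<close> keeps \<open>finecnt\<close> above c, and
      \<open>finecnt\<close> differs from R n by at most B / n^2, so c <= J.\<close>
    have fine: "c \<le> finecnt k n l" if "n \<ge> P0" "n \<ge> 1" for n
    proof -
      have "n ^ 1 \<le> n ^ (100 * k)" using that k by (intro power_increasing) auto
      then have "n ^ (100 * k) \<ge> P0" using that by simp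
      from low[OF this] show ?thesis
        using that unfolding finecnt_def Let_def by (subst pos_le_divide_eq) (auto simp: mult.assoc)
    qed
    have lim: "(\<lambda>n. R n + B / real n ^ 2) \<longlonglongrightarrow> J + 0"
    proof (intro tendsto_add RJ)
      have "(\<lambda>n. B * (1 / real n) ^ 2) \<longlonglongrightarrow> B * 0 ^ 2"
        by (intro tendsto_intros lim_1_over_n)
      then show "(\<lambda>n. B / real n ^ 2) \<longlonglongrightarrow> 0" by (simp add: power_divide)
    qed
    have "c \<le> J + 0"
    proof (rule LIMSEQ_le_const[OF lim], intro exI allI impI)
      fix n assume n: "n \<ge> max P0 n0"
      then have n': "n \<ge> P0" "n \<ge> n0" "n \<ge> 1" using n0 by auto
      show "c \<le> R n + B / real n ^ 2"
        using fine[OF n'(1,3)] step(2)[OF n'(2)] by linarith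
    qed
    then show ?thesis using c by simp
  qed
  \<comment> \<open>Rounding \<tau> to the grid costs at most J / n and \<open>approx\<close> at
    most 3B / n; E majorizes both together. K / n bounds the relative growth of \<open>?W\<close>
    from n to n + 1.\<close>
  define E where "E = J + 5 * B"
  define K where "K = (2 :: real) ^ (100 * k * (?s - k))"
  define D where "D = K * (J + E) + E"
  have "\<bar>real (N k l P \<tau>) - \<tau> * J * P ^ (?s - k)\<bar> \<le> D / real n * P ^ (?s - k)"
    if n: "n \<ge> n0" and P: "real n ^ (100 * k) \<le> P" "P < real (n + 1) ^ (100 * k)" and t: "0 < \<tau>" "\<tau> \<le> 1" for n P \<tau>
  proof -
    define x where "x = real n"
    have x1: "x \<ge> 1" using n n0 by (simp add: x_def)
    have approx: "\<bar>gridcnt k m (real i / real m) l - real i / real m * J\<bar> \<le> 3 * B / real m"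
      if m: "m \<ge> n0" and i: "i \<in> {1..m}" for m i
    proof -
      have m1: "real m \<ge> 1" using m n0 by simp
      have "real m * 1 \<le> real m ^ 2" unfolding power2_eq_square using m1 by (intro mult_left_mono) auto
      then have "B / real m ^ 2 \<le> B / real m" using B m1 by (intro divide_left_mono) auto
      moreover have "\<bar>real i / real m * (R m - J)\<bar> \<le> 1 * (2 * B / real m)"
        unfolding abs_mult using J[OF m] i m1 by (intro mult_mono) auto
      moreover have "\<bar>u - w\<bar> \<le> 3 * b" if "\<bar>u - v\<bar> \<le> b'" "b' \<le> b" "\<bar>v - w\<bar> \<le> 1 * (2 * b)" for u v w b b' :: real
        using that by linarith
      ultimately show ?thesis using step(3)[OF m i] unfolding right_diff_distrib times_divide_eq_right[symmetric] by blast
    qed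
    have gb: "gridcnt k m \<theta> l * ?W m = boxcnt k (m ^ (100 * k)) \<theta> l" if "m \<ge> 1" for m \<theta>
      using that by (simp add: gridcnt_def)
    have W: "?W m = (real m ^ (100 * k)) ^ (?s - k)" for m by (simp add: power_mult)
    have P0: "P \<ge> 0" by (rule order.trans[OF _ P(1)]) simp
    have "x ^ (100 * k) \<le> P" using P by (simp add: x_def)
    have lo: "?W n * (\<tau> * J - E / x) \<le> real (N k l P \<tau>)"
    proof (cases "\<tau> * x < 1")
      \<comment> \<open>\<tau> lies below the smallest grid tolerance 1 / n, where the claimed lower
        bound is not positive.\<close>
      case True
      then have "\<tau> \<le> 1 / x" using x1 by (simp add: pos_le_divide_eq)
      then have "\<tau> * J \<le> 1 / x * J" using J0 by (intro mult_right_mono) auto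
      also have "\<dots> \<le> E / x" using B x1 by (simp add: E_def divide_right_mono)
      finally have "?W n * (\<tau> * J - E / x) \<le> 0" by (intro mult_nonneg_nonpos) auto
      then show ?thesis by (rule order.trans) simp
    next
      case False
      define i where "i = nat \<lfloor>\<tau> * x\<rfloor>"
      have ri: "real i \<le> \<tau> * x" "\<tau> * x - 1 \<le> real i" "i \<ge> 1"
        using False unfolding i_def by linarith+
      have "\<tau> * x \<le> 1 * x" using t x1 by (intro mult_right_mono) auto
      then have "real i \<le> real n" using ri by (simp add: x_def)
      then have i: "i \<in> {1..n}" using ri by simp
      have it: "real i / x \<le> \<tau>" "\<tau> - 1 / x \<le> real i / x" using ri x1
        by (simp_all add: pos_divide_le_eq pos_le_divide_eq left_diff_distrib)
      have "(\<tau> - 1 / x) * J \<le> real i / x * J" using it J0 by (intro mult_right_mono) auto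
      then have "\<tau> * J - E / x \<le> gridcnt k n (real i / real n) l"
        using approx[OF n i] B x1 unfolding x_def[symmetric] E_def
        by (simp add: left_diff_distrib add_divide_distrib abs_le_iff)
      then have "?W n * (\<tau> * J - E / x) \<le> ?W n * gridcnt k n (real i / real n) l" by (intro mult_left_mono) auto
      also have "\<dots> = boxcnt k (n ^ (100 * k)) (real i / real n) l"
        using gb[of n "real i / real n"] n n0 by (simp add: mult.commute)
      also have "\<dots> \<le> real (N k l P \<tau>)" using P it by (intro boxcnt_le_N) (auto simp: x_def)
      finally show ?thesis .
    qed
    have up: "real (N k l P \<tau>) \<le> ?W (n + 1) * (\<tau> * J + E / x)"
    proof -
      \<comment> \<open>From above, both height and tolerance are rounded up to the grid of n +
        1.\<close>
      define y where "y = real (n + 1)"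
      have y: "y \<ge> 1" "x \<le> y" by (simp_all add: y_def x_def)
      define i where "i = nat \<lceil>\<tau> * y\<rceil>"
      have ty: "0 < \<tau> * y" "\<tau> * y \<le> y"
        using t y mult_right_mono[of \<tau> 1 y] by simp_all
      have ri: "\<tau> * y \<le> real i" "real i \<le> \<tau> * y + 1" using ty unfolding i_def by linarith+
      have "i \<ge> 1" using ty ri by (cases i) auto
      moreover have "\<lceil>\<tau> * y\<rceil> \<le> int (n + 1)" 
        unfolding ceiling_le_iff using ty(2) by (simp add: y_def)
      then have "i \<le> n + 1" by (simp add: i_def nat_le_iff)
      ultimately have i: "i \<in> {1..n + 1}" by simp
      have it: "\<tau> \<le> real i / y" "real i / y \<le> \<tau> + 1 / y" using ri y
        by (simp_all add: pos_divide_le_eq pos_le_divide_eq distrib_right)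
      have n1: "n + 1 \<ge> n0" using n by simp
      have "real (N k l P \<tau>) \<le> boxcnt k ((n + 1) ^ (100 * k)) (real i / real (n + 1)) l"
        using P it by (intro N_le_boxcnt) (auto simp: y_def add.commute)
      also have "\<dots> = ?W (n + 1) * gridcnt k (n + 1) (real i / real (n + 1)) l"
        using gb[of "n + 1" "real i / real (n + 1)"] by (simp add: mult.commute)
      also have "\<dots> \<le> ?W (n + 1) * (\<tau> * J + E / x)"
      proof (intro mult_left_mono)
        have "real i / y * J \<le> (\<tau> + 1 / y) * J" using it J0 by (intro mult_right_mono) auto
        moreover have "gridcnt k (n + 1) (real i / real (n + 1)) l \<le> real i / y * J + 3 * B / y"
          using approx[OF n1 i] unfolding y_def[symmetric] by linarith
        moreover have "(\<tau> + 1 / y) * J + 3 * B / y = \<tau> * J + (J + 3 * B) / y"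
          by (simp add: algebra_simps add_divide_distrib)
        moreover have "(J + 3 * B) / y \<le> E / x"
          using B J0 y x1 by (intro frac_le) (auto simp: E_def)
        ultimately show "gridcnt k (n + 1) (real i / real (n + 1)) l \<le> \<tau> * J + E / x" by linarith
      qed auto
      finally show ?thesis .
    qed
    have W1: "?W (n + 1) \<le> (1 + K / x) * ?W n"
    proof -
      have "?W (n + 1) = (1 + 1 / x) ^ (100 * k * (?s - k)) * ?W n"
        unfolding power_mult_distrib[symmetric] using x1 by (simp add: x_def distrib_right add.commute)
      also have "\<dots> \<le> (1 + (2 ^ (100 * k * (?s - k)) - 1) * (1 / x)) * ?W n"
        using x1 by (intro mult_right_mono power_one_plus_le) auto
      also have "\<dots> \<le> (1 + K / x) * ?W n"
        using x1 by (intro mult_right_mono add_left_mono) (auto simp: K_def divide_right_mono)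
      finally show ?thesis .
    qed
    have "\<bar>real (N k l P \<tau>) - \<tau> * J * P ^ (?s - k)\<bar> \<le> (K * (J + E) + E) / x * P ^ (?s - k)"
    proof (rule two_sided[OF x1 _ _ _ t _ _ _ W1 _ up lo])
      show "?W n \<le> P ^ (?s - k)" "P ^ (?s - k) \<le> ?W (n + 1)"
        unfolding W using P P0 by (auto intro!: power_mono)
    qed (use J0 B in \<open>auto simp: E_def K_def\<close>)
    then show ?thesis by (simp add: D_def x_def)
  qed
  then show ?thesis using J0 n0 by blast
qed

theorem theorem1:
  fixes k :: nat
  assumes "k \<ge> 2" and "CARD('s::finite) > 2 * k"
  defines "\<delta> \<equiv> (8::real) powr (- 2 * real k)"
  shows "AE l :: real ^ 's in lebesgue. l \<in> Lambda_k k \<longrightarrow>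
    (\<exists>P0 \<ge> 1. \<exists>J > 0. \<forall>P \<ge> P0. \<forall>\<tau>. 0 < \<tau> \<and> \<tau> \<le> 1 \<longrightarrow>
      \<bar>real (N k l P \<tau>) - 2 * \<tau> * J * P powr (real CARD('s) - real k)\<bar>
        < P powr (real CARD('s) - real k - \<delta>))"
  using AE_defect_bounded[OF assms(1,2)]
proof (rule AE_mp, intro AE_I2 impI)
  fix l :: "real ^ 's"
  let ?s = "CARD('s)"
  assume "\<exists>B. \<forall>n \<ge> 8 * ?s * k. real n ^ 2 * defect k n l \<le> B" and l: "l \<in> Lambda_k k"
  then obtain B where B: "\<And>n. n \<ge> 8 * ?s * k \<Longrightarrow> real n ^ 2 * defect k n l \<le> B" by blast
  have n0: "8 * ?s * k \<ge> 1" using assms(1) by (simp add: Suc_leI)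
  have ex: "\<exists>J>0. \<exists>D. \<exists>n1 \<ge> 1. \<forall>n \<ge> n1. \<forall>P \<tau>. real n ^ (100 * k) \<le> P \<longrightarrow> P < real (n + 1) ^ (100 * k) \<longrightarrow> 0 < \<tau> \<longrightarrow> \<tau> \<le> 1 \<longrightarrow>
    \<bar>real (N k l P \<tau>) - \<tau> * J * P ^ (?s - k)\<bar> \<le> D / real n * P ^ (?s - k)"
    by (intro asymptotic_of_defect_bounded[OF assms(1,2) l _ n0]) (rule B)
  obtain J D n1 where J: "J > 0" and n1: "n1 \<ge> 1"
    and asym: "\<And>n P \<tau>. n \<ge> n1 \<Longrightarrow> real n ^ (100 * k) \<le> P \<Longrightarrow> P < real (n + 1) ^ (100 * k) \<Longrightarrow> 0 < \<tau> \<Longrightarrow> \<tau> \<le> 1 \<Longrightarrow>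
      \<bar>real (N k l P \<tau>) - \<tau> * J * P ^ (?s - k)\<bar> \<le> D / real n * P ^ (?s - k)"
    using ex by (elim exE conjE) (rule that; blast)
  define a where "a = 1 / real (100 * k)"
  have a0: "a > 0" using assms(1) by (simp add: a_def)
  have da: "a - \<delta> > 0" using delta_lt[OF assms(1)] by (simp add: a_def \<delta>_def)
  \<comment> \<open>Chosen so that P >= P1 implies P^(a - \<delta>) > 2 |D|.\<close>
  define P1 where "P1 = (2 * \<bar>D\<bar> + 1) powr (1 / (a - \<delta>))"
  define P0 where "P0 = max 1 (max P1 (real n1 ^ (100 * k)))"
  \<comment> \<open>The limit J belongs to the whole interval (-\<tau>, \<tau>) of length 2 \<tau>,
    so the constant of the theorem is half of it.\<close>
  have "\<bar>real (N k l P \<tau>) - 2 * \<tau> * (J / 2) * P powr (real ?s - real k)\<bar> < P powr (real ?s - real k - \<delta>)"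
    if P: "P \<ge> P0" and t: "0 < \<tau>" "\<tau> \<le> 1" for P \<tau>
  proof -
    have PP: "P \<ge> 1" "P \<ge> P1" "P \<ge> real n1 ^ (100 * k)" using P by (auto simp: P0_def)
    define n where "n = nat \<lfloor>P powr a\<rfloor>"
    have "P powr a \<ge> 1" using PP a0 by (intro ge_one_powr_ge_zero) auto
    then have n: "real n \<le> P powr a" "P powr a < real (n + 1)" "n \<ge> 1" unfolding n_def by linarith+
    have pa: "(P powr a) ^ (100 * k) = P"
      using PP assms(1) by (simp add: powr_realpow[symmetric] powr_powr a_def)
    have nP: "real n ^ (100 * k) \<le> P" "P < real (n + 1) ^ (100 * k)"
    proof -
      have "real n ^ (100 * k) \<le> (P powr a) ^ (100 * k)" using n by (intro power_mono) auto
      then show "real n ^ (100 * k) \<le> P" unfolding pa .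
      have "(P powr a) ^ (100 * k) < real (n + 1) ^ (100 * k)"
        using n assms(1) by (intro power_strict_mono) auto
      then show "P < real (n + 1) ^ (100 * k)" unfolding pa .
    qed
    have "n1 \<le> n"
    proof (rule ccontr)
      assume "\<not> n1 \<le> n"
      then have "n + 1 \<le> n1" by simp
      then have "real (n + 1) ^ (100 * k) \<le> real n1 ^ (100 * k)" by (intro power_mono of_nat_mono) auto
      then show False using nP PP by linarith
    qed
    have Ps: "P ^ (?s - k) = P powr (real ?s - real k)"
      using PP assms(2) by (simp add: powr_realpow[symmetric] of_nat_diff)
    \<comment> \<open>For n >= 1 one has n >= (n + 1) / 2, and n + 1 exceeds P^a.\<close>
    have "D / real n \<le> \<bar>D\<bar> / (real (n + 1) / 2)"
      using n by (intro frac_le) auto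
    also have "\<dots> \<le> \<bar>D\<bar> / (P powr a / 2)" using n PP by (intro divide_left_mono) auto
    also have "\<dots> = 2 * \<bar>D\<bar> * P powr (- a)" by (simp add: powr_minus_divide)
    also have "\<dots> < P powr (a - \<delta>) * P powr (- a)"
    proof (rule mult_strict_right_mono)
      have "2 * \<bar>D\<bar> + 1 = P1 powr (a - \<delta>)" using da by (simp add: P1_def powr_powr)
      also have "\<dots> \<le> P powr (a - \<delta>)" using PP da by (intro powr_mono2) (auto simp: P1_def)
      finally show "2 * \<bar>D\<bar> < P powr (a - \<delta>)" by linarith
      show "0 < P powr (- a)" using PP by simp
    qed
    also have "\<dots> = P powr (- \<delta>)" by (simp add: powr_add[symmetric])
    finally have D: "D / real n < P powr (- \<delta>)" .
    have "\<bar>real (N k l P \<tau>) - 2 * \<tau> * (J / 2) * P powr (real ?s - real k)\<bar> \<le> D / real n * P powr (real ?s - real k)"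
      using asym[OF \<open>n1 \<le> n\<close> nP t] unfolding Ps by simp
    also have "\<dots> < P powr (- \<delta>) * P powr (real ?s - real k)"
      using D PP by (intro mult_strict_right_mono) auto
    also have "\<dots> = P powr (real ?s - real k - \<delta>)" by (simp add: powr_add[symmetric] algebra_simps)
    finally show ?thesis .
  qed
  moreover have "P0 \<ge> 1" by (simp add: P0_def)
  moreover have "J / 2 > 0" using J by simp
  ultimately show "\<exists>P0 \<ge> 1. \<exists>J > 0. \<forall>P \<ge> P0. \<forall>\<tau>. 0 < \<tau> \<and> \<tau> \<le> 1 \<longrightarrow>
      \<bar>real (N k l P \<tau>) - 2 * \<tau> * J * P powr (real ?s - real k)\<bar> < P powr (real ?s - real k - \<delta>)"
    by (intro exI[of _ P0] exI[of _ "J / 2"] conjI allI impI) simp_all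
qed

end
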